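(* Let $n\ge4$. With the sets defined in the context: (C.1) $T_{n,n}=A_1\cup A_2$, where $A_2$ is taken with $\ell=n$; (C.2) $T_{n,n-1}=A_1\cup\tilde A_1\cup\tilde A_2$; (C.3) for $1\le\ell\le n-2$, $T_{n,\ell}=A_1\cup A_2'\cup A_3\cup\{(n,\ell,n-1,n-2,\dots,\ell+1,\ell-1,\dots,1)\}$, where $A_2'$ and $A_3$ are taken with this $\ell$.
   Context: $\mathbb K$ is a field of characteristic $0$; $[m]=\{1,\dots,m\}$; permutations $w\in S_m$ are written in one-line notation $w=(w_1,\dots,w_m)$. For $A=\{a_1<\dots<a_k\}$ and $B=\{b_1<\dots<b_k\}$ write $A\le B$ if $a_i\le b_i$ for all $i$. For $w\in S_m$ put $S_w=\{J : \varnothing\ne J\subsetneq[m],\ J\not\le\{w_1,\dots,w_{|J|}\}\}$. Let $\mathbb K[P_J]$ be the polynomial ring in variables $P_J$, $\varnothing\neq J\subsetneq[m]$. For $\ell\ge 0$ and $J=\{j_1<\dots<j_k\}\subsetneq [m]$ the block diagonal matching field $B_\ell$ assigns to $J$ the permutation $B_\ell(J)\in S_k$ which is the transposition $(12)$ if $k\ge2$ and $|J\cap\{1,\dots,\ell\}|=1$, and the identity otherwise (so for $\ell=0$ or $\ell\ge m$ all $B_\ell(J)$ are identities: the diagonal matching field). Let $\phi_\ell:\mathbb K[P_J]\to\mathbb K[x_{i,j}:1\le i\le m-1,1\le j\le m]$, $P_J\mapsto \mathrm{sgn}(\sigma)\,x_{\sigma(1),j_1}\cdots x_{\sigma(k),j_k}$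 with $\sigma=B_\ell(J)$, $F_{m,\ell}=\ker\phi_\ell$, and $F_{m,\ell,w}=(F_{m,\ell}+\langle P_J:J\in S_w\rangle)\cap\mathbb K[P_J:J\notin S_w]$. $F_{m,\ell,w}$ is called binomial if it is non-zero and contains no monomial. Let $T_{m,\ell}=\{w\in S_m: F_{m,\ell,w}\text{ is binomial}\}$ and $Z_m=\{w\in S_m: F_{m,m,w}=0\}$. (In particular $T_{n-1,n}=T_{n-1,n-1}$ refers to the diagonal matching field on $[n-1]$.) A permutation $w\in S_m$ with $w_t=m$ has the descending property if $m=w_t>w_{t+1}>\dots>w_m$; $S_m^>$ is the set of such permutations. For $w\in S_n$, $\underline w\in S_{n-1}$ is obtained from $w$ by deleting the value $n$ from the one-line notation. Define $\underline Z_n=\{w\in S_n:\underline w\in Z_{n-1}\}$ and $\underline T_{n,\ell}=\{w\in S_n:\underline w\in T_{n-1,\ell}\}$. For $w\in S_n$ let $s,t$ denote the positions with $w_s=n-1$, $w_t=n$. Then: - $A_1=\underline Z_n\cap\{w\in S_n: w_n=n-2,\ \{w_{n-2},w_{n-1}\}=\{n-1,n\}\}$; - $A_2=\underline T_{n,\ell}\cap\{w\in S_n:\underline w\in S_{n-1}^>,\ t\ge s-1\}$; - $A_3=\underline T_{n,\ell}\cap\{w\in S_n:\underline w\in S_{n-1}\setminus S_{n-1}^>,\ t\ge s+2\}$; - $A_2'=A_2\setminus\{(n-1,n,n-2,n-3,\dots,1)\}$; - $\tilde A_1=A_2'\cap\underline T_{n,n-2}$, where $\ell=n-1$ in $A_2$;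 - $\tilde A_2=(\underline T_{n,n-1}\setminus\underline T_{n,n-2})\cap\{w\in S_n: t\ge s+1\}$. *)

theory Defs
  imports "HOL-Library.Poly_Mapping" "HOL-Combinatorics.Combinatorics"
begin

text \<open>Permutations of \<open>{1..m}\<close> are lists (one-line notation) with 1-based entries and positions.\<close>

definition perms :: "nat \<Rightarrow> nat list set" where
  "perms m = permutations_of_set {1..m}"

definition entry :: "nat list \<Rightarrow> nat \<Rightarrow> nat" where
  "entry w i = w ! (i - 1)"

definition pos :: "nat list \<Rightarrow> nat \<Rightarrow> nat" where
  "pos w v = (THE i. i \<in> {1..length w} \<and> entry w i = v)"

definition delete_value :: "nat \<Rightarrow> nat list \<Rightarrow> nat list" where
  "delete_value v w = filter (\<lambda>x. x \<noteq> v) w"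

definition desc_perms :: "nat \<Rightarrow> nat list set" where
  "desc_perms m = {w \<in> perms m. \<forall>i. pos w m \<le> i \<and> i < m \<longrightarrow> entry w i > entry w (i + 1)}"

text \<open>The relation \<open>A \<le> B\<close>; \<open>list_all2\<close> forces \<open>card A = card B\<close>.\<close>

definition subset_le :: "nat set \<Rightarrow> nat set \<Rightarrow> bool" where
  "subset_le A B \<longleftrightarrow> list_all2 (\<le>) (sorted_list_of_set A) (sorted_list_of_set B)"

definition proper_subsets :: "nat \<Rightarrow> nat set set" where
  "proper_subsets m = {J. J \<noteq> {} \<and> J \<subset> {1..m}}"

definition vanishing_sets :: "nat \<Rightarrow> nat list \<Rightarrow> nat set set" where
  "vanishing_sets m w = {J \<in> proper_subsets m. \<not> subset_le J (set (take (card J) w))}"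


text \<open>
  Polynomials with coefficients in \<open>'k\<close> and variables of type \<open>'v\<close> are finitely supported
  functions on monomials, and monomials are finitely supported exponent functions.
  \<open>polys V\<close> is the subring of polynomials involving only variables from \<open>V\<close>.
\<close>

type_synonym ('v, 'k) mpoly = "('v \<Rightarrow>\<^sub>0 nat) \<Rightarrow>\<^sub>0 'k"

definition polys :: "'v set \<Rightarrow> ('v, 'k::comm_ring_1) mpoly set" where
  "polys V = {p. \<forall>e \<in> Poly_Mapping.keys p. Poly_Mapping.keys e \<subseteq> V}"

definition monomial :: "('v \<Rightarrow>\<^sub>0 nat) \<Rightarrow> ('v, 'k::comm_ring_1) mpoly" where
  "monomial e = Poly_Mapping.single e 1"

definition var :: "'v \<Rightarrow> ('v, 'k::comm_ring_1) mpoly" where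
  "var v = monomial (Poly_Mapping.single v 1)"

text \<open>\<open>subst f\<close> is the homomorphism of \<open>'k\<close>-algebras sending the variable \<open>v\<close> to \<open>f v\<close>.\<close>

definition subst :: "('v \<Rightarrow> ('u, 'k) mpoly) \<Rightarrow> ('v, 'k::comm_ring_1) mpoly \<Rightarrow> ('u, 'k) mpoly" where
  "subst f p = (\<Sum>e \<in> Poly_Mapping.keys p.
     Poly_Mapping.single 0 (Poly_Mapping.lookup p e) *
     (\<Prod>v \<in> Poly_Mapping.keys e. f v ^ Poly_Mapping.lookup e v))"

definition ideal_generated :: "'r::comm_ring_1 set \<Rightarrow> 'r set \<Rightarrow> 'r set" where
  "ideal_generated R G =
     {\<Sum>g\<in>H. q g * g | H q. finite H \<and> H \<subseteq> G \<and> (\<forall>g\<in>H. q g \<in> R)}"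


definition block_matching :: "nat \<Rightarrow> nat set \<Rightarrow> nat \<Rightarrow> nat" where
  "block_matching l J =
     (if card J \<ge> 2 \<and> card (J \<inter> {1..l}) = 1 then Transposition.transpose 1 2 else id)"

text \<open>\<open>entry (sorted_list_of_set J) i\<close> is the \<open>i\<close>-th smallest element of \<open>J\<close>.\<close>

definition matching_term :: "nat \<Rightarrow> nat set \<Rightarrow> (nat \<times> nat, 'k::comm_ring_1) mpoly" where
  "matching_term l J = of_int (sign (block_matching l J)) *
     (\<Prod>i = 1..card J. var (block_matching l J i, entry (sorted_list_of_set J) i))"

text \<open>
  The codomain of \<open>subst (matching_term l)\<close> is the polynomial ring in all \<open>x\<^sub>i\<^sub>j\<close>;
  enlarging the codomain does not affect the kernel.
\<close>

definition matching_ideal :: "nat \<Rightarrow> nat \<Rightarrow> (nat set, 'k::field) mpoly set" where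
  "matching_ideal m l = {p \<in> polys (proper_subsets m). subst (matching_term l) p = 0}"

definition restricted_ideal :: "nat \<Rightarrow> nat \<Rightarrow> nat list \<Rightarrow> (nat set, 'k::field) mpoly set" where
  "restricted_ideal m l w =
     {f + g | f g. f \<in> matching_ideal m l \<and>
        g \<in> ideal_generated (polys (proper_subsets m)) (var ` vanishing_sets m w)}
     \<inter> polys (proper_subsets m - vanishing_sets m w)"

definition binomial_ideal :: "('v, 'k::field) mpoly set \<Rightarrow> bool" where
  "binomial_ideal I \<longleftrightarrow> I \<noteq> {0} \<and> (\<forall>e. monomial e \<notin> I)"


text \<open>The sets below depend on the ground field, which enters as a type argument.\<close>

definition T_set :: "'k::field itself \<Rightarrow> nat \<Rightarrow> nat \<Rightarrow> nat list set" where
  "T_set K m l =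
     {w \<in> perms m. binomial_ideal (restricted_ideal m l w :: (nat set, 'k) mpoly set)}"

definition Z_set :: "'k::field itself \<Rightarrow> nat \<Rightarrow> nat list set" where
  "Z_set K m = {w \<in> perms m. (restricted_ideal m m w :: (nat set, 'k) mpoly set) = {0}}"

definition T_under :: "'k::field itself \<Rightarrow> nat \<Rightarrow> nat \<Rightarrow> nat list set" where
  "T_under K n l = {w \<in> perms n. delete_value n w \<in> T_set K (n - 1) l}"

definition Z_under :: "'k::field itself \<Rightarrow> nat \<Rightarrow> nat list set" where
  "Z_under K n = {w \<in> perms n. delete_value n w \<in> Z_set K (n - 1)}"

definition A1 :: "'k::field itself \<Rightarrow> nat \<Rightarrow> nat list set" where
  "A1 K n = Z_under K n \<inter>
     {w \<in> perms n. entry w n = n - 2 \<and> {entry w (n - 2), entry w (n - 1)} = {n - 1, n}}"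

definition A2 :: "'k::field itself \<Rightarrow> nat \<Rightarrow> nat \<Rightarrow> nat list set" where
  "A2 K n l = T_under K n l \<inter>
     {w \<in> perms n. delete_value n w \<in> desc_perms (n - 1) \<and> pos w n \<ge> pos w (n - 1) - 1}"

definition A3 :: "'k::field itself \<Rightarrow> nat \<Rightarrow> nat \<Rightarrow> nat list set" where
  "A3 K n l = T_under K n l \<inter>
     {w \<in> perms n. delete_value n w \<in> perms (n - 1) - desc_perms (n - 1) \<and>
        pos w n \<ge> pos w (n - 1) + 2}"

definition A2' :: "'k::field itself \<Rightarrow> nat \<Rightarrow> nat \<Rightarrow> nat list set" where
  "A2' K n l = A2 K n l - {[n - 1, n] @ rev [1..<n - 1]}"

definition A1_tilde :: "'k::field itself \<Rightarrow> nat \<Rightarrow> nat list set" where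
  "A1_tilde K n = A2' K n (n - 1) \<inter> T_under K n (n - 2)"

definition A2_tilde :: "'k::field itself \<Rightarrow> nat \<Rightarrow> nat list set" where
  "A2_tilde K n = (T_under K n (n - 1) - T_under K n (n - 2)) \<inter>
     {w \<in> perms n. pos w n \<ge> pos w (n - 1) + 1}"

end

theory Submission
  imports Defs
begin

text \<open>
  Substituting the matching field maps monomials to monomials up to sign, so everything is decided
  on the fibres of this map: the restricted ideal contains a monomial iff some fibre contains both a
  monomial in the surviving variables and one involving a vanishing variable, and it is zero iff
  the monomials in the surviving variables are alone in their fibres.

  This leads to an explicit description. Let \<open>D\<close> be the set of values that play the role of \<open>1\<close>
  in a \<open>312\<close> pattern of \<open>w\<close>. The ideal has no monomial iff \<open>D \<subseteq> {w\<^sub>2}\<close> and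
  \<open>w\<^sub>1 = 1\<close>, \<open>w\<^sub>1 = w\<^sub>2 + 1\<close>, \<open>w\<^sub>1 < w\<^sub>2 \<le> l\<close> or \<open>w\<^sub>2 = l\<close>; it is zero iff \<open>w\<close> is a
  product of disjoint adjacent transpositions. If the condition holds, then the surviving sets \<open>J\<close>
  are cut out by the inequalities \<open>j\<^sub>i \<le> max (w\<^sub>1, \<dots>, w\<^sub>i)\<close> and \<open>j\<^sub>1 \<le> w\<^sub>2\<close>, which are visible
  on the rows of the image. If it fails, a three-term exchange on a common part \<open>A\<close> yields a
  quadratic relation with exactly one side surviving. The recursions are then a comparison of
  these conditions for \<open>w\<close> and for \<open>w\<close> without its largest value.
\<close>

section \<open>Fibres of the monomial map\<close>

text \<open>The obstacle is that a matching field may exchange the first two rows. From row 3 on,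
  the row of an entry is its rank, so the bounds pass from one monomial of a fibre to another; for
  the two smallest entries the image only gives the common bound max(w_1, w_2). It remains to
  recover j_1 \<le> w_1 and j_1 \<le> w_2, and the four alternatives are the ways to do so. If w_1 =
  1, every surviving set contains 1, and the number of sets containing 1 is visible in the image. If
  w_1 = w_2 + 1, the bound follows from j_1 < j_2. If w_1 < w_2 \<le> l, both smallest entries lie
  in {1,...,l} and nothing is exchanged. If w_2 = l, the row 2 entry of a surviving set is at most
  l, exchanged or not. The value w_2 is exempt from the pattern condition because the general
  exchange needs a common part, which the first prefixes are too short to supply; singletons and
  pairs replace it there. For the vanishing, two statistics of the image determine all
  multiplicities: how many sets contain a given value, and how many have at least a given
  size.\<close>

definition row :: "nat \<Rightarrow> nat set \<Rightarrow> nat \<Rightarrow> nat" where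
  "row l J j = block_matching l J (card {x \<in> J. x \<le> j})"

definition column_degree :: "nat \<Rightarrow> nat set \<Rightarrow> (nat \<times> nat) \<Rightarrow>\<^sub>0 nat" where
  "column_degree l J =
     (\<Sum>i = 1..card J. Poly_Mapping.single (block_matching l J i, entry (sorted_list_of_set J) i) 1)"

text \<open>The inner sum is the multiple of a vector by the exponent of \<open>J\<close>: this is
  the additive extension of \<open>column_degree\<close> to exponents. Signs are kept apart in
  \<open>image_sign\<close>.\<close>

definition image_degree :: "nat \<Rightarrow> (nat set \<Rightarrow>\<^sub>0 nat) \<Rightarrow> (nat \<times> nat) \<Rightarrow>\<^sub>0 nat" where
  "image_degree l e = (\<Sum>J \<in> Poly_Mapping.keys e. \<Sum>i<Poly_Mapping.lookup e J. column_degree l J)"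

definition image_sign :: "nat \<Rightarrow> (nat set \<Rightarrow>\<^sub>0 nat) \<Rightarrow> int" where
  "image_sign l e = (\<Prod>J \<in> Poly_Mapping.keys e. sign (block_matching l J) ^ Poly_Mapping.lookup e J)"

lemma monomial_mult: "monomial a * monomial b = monomial (a + b)"
  by (simp add: monomial_def mult_single)

lemma monomial_0: "monomial 0 = 1"
  by (simp add: monomial_def)

lemma monomial_sum: "(\<Prod>i\<in>A. monomial (f i)) = monomial (\<Sum>i\<in>A. f i)"
  by (induction A rule: infinite_finite_induct) (simp_all add: monomial_0 monomial_mult)

lemma monomial_power: "monomial a ^ k = monomial (\<Sum>i<k. a)"
  by (induction k) (simp_all add: monomial_0 monomial_mult add.commute)

lemma matching_term_eq:
  "matching_term l J = of_int (sign (block_matching l J)) * monomial (column_degree l J)"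
  by (simp add: matching_term_def column_degree_def var_def monomial_sum)

lemma of_int_mpoly: "(of_int i :: ('v, 'k::comm_ring_1) mpoly) = Poly_Mapping.single 0 (of_int i)"
  by simp

lemma image_sign_square: "image_sign l e * image_sign l e = 1"
  unfolding image_sign_def prod.distrib[symmetric] power_mult_distrib[symmetric]
  by (rule prod.neutral) (simp add: sign_def)

lemma subst_matching_term:
  assumes "finite S" "Poly_Mapping.keys p \<subseteq> S"
  shows "subst (matching_term l) p =
    (\<Sum>e\<in>S. Poly_Mapping.single (image_degree l e) (Poly_Mapping.lookup p e * of_int (image_sign l e)))"
proof -
  have "subst (matching_term l) p = (\<Sum>e\<in>Poly_Mapping.keys p.
      Poly_Mapping.single (image_degree l e) (Poly_Mapping.lookup p e * of_int (image_sign l e)))"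
    unfolding subst_def
  proof (rule sum.cong[OF refl])
    fix e
    have "(\<Prod>v\<in>Poly_Mapping.keys e. (matching_term l v :: (nat \<times> nat, 'a) mpoly) ^ Poly_Mapping.lookup e v)
        = of_int (image_sign l e) * monomial (image_degree l e)"
      by (simp add: matching_term_eq power_mult_distrib prod.distrib monomial_power monomial_sum
          image_sign_def image_degree_def)
    then show "Poly_Mapping.single 0 (Poly_Mapping.lookup p e) *
         (\<Prod>v\<in>Poly_Mapping.keys e. matching_term l v ^ Poly_Mapping.lookup e v) =
      Poly_Mapping.single (image_degree l e) (Poly_Mapping.lookup p e * of_int (image_sign l e))"
      by (simp add: of_int_mpoly monomial_def mult_single del: single_of_nat single_of_int)
  qed
  also have "\<dots> = (\<Sum>e\<in>S. Poly_Mapping.single (image_degree l e) (Poly_Mapping.lookup p e * of_int (image_sign l e)))"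
    by (rule sum.mono_neutral_left) (use assms in \<open>auto simp: in_keys_iff\<close>)
  finally show ?thesis .
qed

lemma card_le_sorted_list_of_set_nth:
  assumes "finite J" "t < card J"
  shows "card {x \<in> J. x \<le> sorted_list_of_set J ! t} = t + 1"
proof -
  let ?L = "sorted_list_of_set J"
  have len: "length ?L = card J" by simp
  have "{x \<in> J. x \<le> ?L ! t} = (\<lambda>s. ?L ! s) ` {..t}"
  proof -
    have "x \<in> (\<lambda>s. ?L ! s) ` {..t}" if x: "x \<in> J" "x \<le> ?L ! t" for x
    proof -
      obtain s where s: "s < card J" "x = ?L ! s"
        using x(1) assms by (metis in_set_conv_nth len set_sorted_list_of_set)
      have "s \<le> t"
      proof (rule ccontr)
        assume "\<not> s \<le> t"
        then have "?L ! t < ?L ! s"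
          using s(1) len strict_sorted_list_of_set[of J] sorted_wrt_nth_less[of "(<)" ?L t s] by auto
        then show False using s x by simp
      qed
      then show ?thesis using s by auto
    qed
    moreover have "?L ! s \<in> J \<and> ?L ! s \<le> ?L ! t" if "s \<le> t" for s
      using that assms len sorted_nth_mono[OF sorted_sorted_list_of_set, of s t J]
      by (metis le_less_trans nth_mem set_sorted_list_of_set)
    ultimately show ?thesis by auto
  qed
  moreover have "inj_on (\<lambda>s. ?L ! s) {..t}"
    using assms(2) len distinct_sorted_list_of_set[of J] by (auto simp: inj_on_def nth_eq_iff_index_eq)
  ultimately show ?thesis by (simp add: card_image)
qed

text \<open>The image of a variable is squarefree, with one factor for each
  \<open>j \<in> J\<close>. Passing from list positions to elements of \<open>J\<close> lets fibres
  be studied through sets.\<close>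

lemma lookup_column_degree:
  assumes "finite J"
  shows "Poly_Mapping.lookup (column_degree l J) (i, j) = (if j \<in> J \<and> row l J j = i then 1 else 0)"
proof -
  let ?L = "sorted_list_of_set J"
  have len: "length ?L = card J" by simp
  have "Poly_Mapping.lookup (column_degree l J) (i, j) =
     (\<Sum>t = 1..card J. if block_matching l J t = i \<and> ?L ! (t - 1) = j then 1 else 0)"
    unfolding column_degree_def lookup_sum lookup_single entry_def
    by (rule sum.cong) (auto simp: when_def)
  also have "\<dots> = (if j \<in> J \<and> row l J j = i then 1 else 0)"
  proof (cases "j \<in> J")
    case False
    have "?L ! (t - 1) \<noteq> j" if "t \<in> {1..card J}" for t
      using that False assms len by (metis One_nat_def Suc_le_lessD Suc_pred atLeastAtMost_iff nth_mem set_sorted_list_of_set)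
    then show ?thesis using False by (auto intro: sum.neutral)
  next
    case True
    then obtain s where s: "s < card J" "j = ?L ! s"
      using assms by (metis in_set_conv_nth len set_sorted_list_of_set)
    \<comment> \<open>Positions count from 0 in the list and from 1 in the product; distinctness
      leaves a single nonzero summand.\<close>
    have eq: "?L ! (t - 1) = j \<longleftrightarrow> t = s + 1" if "t \<in> {1..card J}" for t
      using that s len distinct_sorted_list_of_set[of J] by (auto simp: nth_eq_iff_index_eq)
    have "(\<Sum>t = 1..card J. if block_matching l J t = i \<and> ?L ! (t - 1) = j then 1 else 0)
      = (\<Sum>t = 1..card J. if t = s + 1 then (if block_matching l J (s+1) = i then 1 else 0) else (0::nat))"
      by (rule sum.cong[OF refl]) (use eq in force)
    also have "\<dots> = (if block_matching l J (s+1) = i then 1 else 0)"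
      using s by simp
    also have "block_matching l J (s+1) = row l J j"
      using card_le_sorted_list_of_set_nth[OF assms s(1)] s by (simp add: row_def)
    finally show ?thesis using True by simp
  qed
  finally show ?thesis .
qed

lemma lookup_image_degree:
  assumes "finite S" "Poly_Mapping.keys e \<subseteq> S"
  shows "Poly_Mapping.lookup (image_degree l e) x =
    (\<Sum>J\<in>S. Poly_Mapping.lookup e J * Poly_Mapping.lookup (column_degree l J) x)"
  unfolding image_degree_def lookup_sum
  by (rule sum.mono_neutral_cong_left) (use assms in \<open>auto simp: in_keys_iff\<close>)

lemma image_degree_add: "image_degree l (d + e) = image_degree l d + image_degree l e"
proof (rule poly_mapping_eqI)
  fix x
  let ?S = "Poly_Mapping.keys d \<union> Poly_Mapping.keys e"
  have "Poly_Mapping.keys (d + e) \<subseteq> ?S" by (simp add: keys_add)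
  then show "Poly_Mapping.lookup (image_degree l (d + e)) x
      = Poly_Mapping.lookup (image_degree l d + image_degree l e) x"
    by (simp add: lookup_add lookup_image_degree[of ?S] sum.distrib algebra_simps)
qed

lemma image_degree_single: "image_degree l (Poly_Mapping.single J 1) = column_degree l J"
  by (rule poly_mapping_eqI) (subst lookup_image_degree[of "{J}"], auto)

section \<open>Membership in the restricted ideal\<close>

definition surviving_sets :: "nat \<Rightarrow> nat list \<Rightarrow> nat set set" where
  "surviving_sets m w = proper_subsets m - vanishing_sets m w"

lemma surviving_subset: "surviving_sets m w \<subseteq> proper_subsets m"
  by (auto simp: surviving_sets_def)

text \<open>Each key of a multiple of \<open>var v\<close> is some exponent plus the unit vector at
  \<open>v\<close>, and sums create no new keys.\<close>

lemma keys_of_ideal_generated: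
  assumes "g \<in> ideal_generated R (var ` V)" "e \<in> Poly_Mapping.keys g"
  shows "Poly_Mapping.keys e \<inter> V \<noteq> {}"
proof -
  obtain H q where H: "finite H" "H \<subseteq> var ` V" "g = (\<Sum>h\<in>H. q h * h)"
    using assms(1) by (auto simp: ideal_generated_def)
  then obtain h where h: "h \<in> H" "e \<in> Poly_Mapping.keys (q h * h)"
    using assms(2) keys_sum[of "\<lambda>h. q h * h" H] by auto
  then obtain v where v: "v \<in> V" "h = var v" using H by auto
  then obtain a b where ab: "e = a + b" "b \<in> Poly_Mapping.keys (var v :: ('a, 'b) mpoly)"
    using h keys_mult[of "q h" h] by blast
  then have "b = Poly_Mapping.single v 1"
    by (auto simp: var_def monomial_def split: if_splits)
  then have "Poly_Mapping.lookup e v \<noteq> 0" using ab by (simp add: lookup_add)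
  then show ?thesis using v by (auto simp: in_keys_iff)
qed

text \<open>The summand from the ideal of vanishing variables has no monomial in surviving variables
  alone, so on such monomials \<open>p\<close> agrees with an element of the kernel.\<close>

lemma restricted_ideal_obtain:
  assumes "p \<in> restricted_ideal m l w"
  obtains f where "f \<in> matching_ideal m l"
    "\<And>e. Poly_Mapping.keys e \<subseteq> surviving_sets m w \<Longrightarrow> Poly_Mapping.lookup f e = Poly_Mapping.lookup p e"
    "\<And>e. e \<in> Poly_Mapping.keys p \<Longrightarrow> Poly_Mapping.keys e \<subseteq> surviving_sets m w"
proof -
  obtain f g where fg: "p = f + g" "f \<in> matching_ideal m l"
    "g \<in> ideal_generated (polys (proper_subsets m)) (var ` vanishing_sets m w)"
    and p: "p \<in> polys (proper_subsets m - vanishing_sets m w)"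
    using assms by (auto simp: restricted_ideal_def)
  have "Poly_Mapping.lookup f e = Poly_Mapping.lookup p e"
    if "Poly_Mapping.keys e \<subseteq> surviving_sets m w" for e
  proof -
    have "e \<notin> Poly_Mapping.keys g"
      using keys_of_ideal_generated[OF fg(3)] that by (fastforce simp: surviving_sets_def)
    then show ?thesis using fg by (simp add: lookup_add in_keys_iff)
  qed
  then show ?thesis using that fg p by (auto simp: polys_def surviving_sets_def)
qed

text \<open>The kernel condition splits into one linear equation per fibre, namely the coefficient
  of \<open>x\<close> in the image.\<close>

lemma matching_ideal_fibre_sum:
  assumes "f \<in> matching_ideal m l"
  shows "(\<Sum>e | e \<in> Poly_Mapping.keys f \<and> image_degree l e = x.
            Poly_Mapping.lookup f e * of_int (image_sign l e)) = 0"
proof -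
  have "0 = Poly_Mapping.lookup (subst (matching_term l) f) x"
    using assms by (simp add: matching_ideal_def)
  also have "\<dots> = (\<Sum>e \<in> Poly_Mapping.keys f.
      if image_degree l e = x then Poly_Mapping.lookup f e * of_int (image_sign l e) else 0)"
    by (subst subst_matching_term[OF finite_keys subset_refl])
       (auto simp: lookup_sum lookup_single when_def intro!: sum.cong)
  finally show ?thesis by (simp add: sum.If_cases Int_def)
qed

text \<open>A monomial of the restricted ideal is killed by the coefficient of its own image, unless
  its fibre leaves the ring of surviving variables.\<close>

lemma restricted_ideal_fibre:
  fixes p :: "(nat set, 'k::field) mpoly"
  assumes p: "p \<in> restricted_ideal m l w" and e: "e \<in> Poly_Mapping.keys p"
    and closed: "\<And>d. Poly_Mapping.keys d \<subseteq> proper_subsets m \<Longrightarrow> image_degree l d = image_degree l e \<Longrightarrow>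
      Poly_Mapping.keys d \<subseteq> surviving_sets m w \<and> (d = e \<or> d \<notin> Poly_Mapping.keys p)"
  shows False
proof -
  obtain f where f: "f \<in> matching_ideal m l"
    and eq: "\<And>e. Poly_Mapping.keys e \<subseteq> surviving_sets m w \<Longrightarrow> Poly_Mapping.lookup f e = Poly_Mapping.lookup p e"
    and pk: "\<And>e. e \<in> Poly_Mapping.keys p \<Longrightarrow> Poly_Mapping.keys e \<subseteq> surviving_sets m w"
    using restricted_ideal_obtain[OF p] by blast
  have fk: "Poly_Mapping.keys d \<subseteq> proper_subsets m" if "d \<in> Poly_Mapping.keys f" for d
    using f that by (auto simp: matching_ideal_def polys_def)
  \<comment> \<open>By \<open>closed\<close>, all monomials of \<open>f\<close> in this fibre are
    surviving; there \<open>f\<close> and \<open>p\<close> have equal coefficients, so only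
    \<open>e\<close> contributes to the fibre sum.\<close>
  have "{d \<in> Poly_Mapping.keys f. image_degree l d = image_degree l e} = {e}"
  proof -
    have "e \<in> Poly_Mapping.keys f" using e eq[OF pk[OF e]] by (simp add: in_keys_iff)
    moreover have "d = e" if d: "d \<in> Poly_Mapping.keys f" "image_degree l d = image_degree l e" for d
      using closed[OF fk[OF d(1)] d(2)] eq[of d] d(1) by (auto simp: in_keys_iff)
    ultimately show ?thesis by auto
  qed
  then have "Poly_Mapping.lookup p e * of_int (image_sign l e) = 0"
    using matching_ideal_fibre_sum[OF f, of "image_degree l e"] eq[OF pk[OF e]] by simp
  moreover have "(of_int (image_sign l e) :: 'k) \<noteq> 0"
    using image_sign_square[of l e] by (metis mult_zero_left of_int_1 of_int_mult one_neq_zero)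
  ultimately show False using e by (simp add: in_keys_iff)
qed

lemma monomial_notin_restricted_ideal:
  assumes "\<And>d e. Poly_Mapping.keys e \<subseteq> surviving_sets m w \<Longrightarrow> Poly_Mapping.keys d \<subseteq> proper_subsets m \<Longrightarrow>
    image_degree l d = image_degree l e \<Longrightarrow> Poly_Mapping.keys d \<subseteq> surviving_sets m w"
  shows "(monomial e :: (nat set, 'k::field) mpoly) \<notin> restricted_ideal m l w"
proof
  assume asm: "(monomial e :: (nat set, 'k) mpoly) \<in> restricted_ideal m l w"
  have k: "Poly_Mapping.keys (monomial e :: (nat set, 'k) mpoly) = {e}" by (simp add: monomial_def)
  have e: "Poly_Mapping.keys e \<subseteq> surviving_sets m w"
    using restricted_ideal_obtain[OF asm] k by blast
  show False
    by (rule restricted_ideal_fibre[OF asm, of e]) (use assms[OF e] k in auto)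
qed

lemma zero_in_restricted_ideal: "0 \<in> restricted_ideal m l w"
proof -
  have "(0 :: (nat set, 'a) mpoly) \<in> matching_ideal m l"
    by (simp add: matching_ideal_def polys_def subst_def)
  moreover have "(0 :: (nat set, 'a) mpoly) \<in> ideal_generated (polys (proper_subsets m)) (var ` vanishing_sets m w)"
    unfolding ideal_generated_def by (rule CollectI, rule exI[of _ "{}"]) auto
  ultimately have "\<exists>f g. (0::(nat set, 'a) mpoly) = f + g \<and> f \<in> matching_ideal m l \<and>
        g \<in> ideal_generated (polys (proper_subsets m)) (var ` vanishing_sets m w)"
    by (intro exI[of _ 0]) auto
  then show ?thesis by (simp add: restricted_ideal_def polys_def)
qed

lemma restricted_ideal_zero:
  assumes "\<And>d e. Poly_Mapping.keys e \<subseteq> surviving_sets m w \<Longrightarrow> Poly_Mapping.keys d \<subseteq> proper_subsets m \<Longrightarrow>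
    image_degree l d = image_degree l e \<Longrightarrow> d = e"
  shows "(restricted_ideal m l w :: (nat set, 'k::field) mpoly set) = {0}"
proof -
  have "p = 0" if p: "p \<in> restricted_ideal m l w" for p :: "(nat set, 'k) mpoly"
  proof (rule ccontr)
    assume "p \<noteq> 0"
    then obtain e where e: "e \<in> Poly_Mapping.keys p" by (meson ex_in_conv keys_eq_empty)
    then have "Poly_Mapping.keys e \<subseteq> surviving_sets m w"
      using restricted_ideal_obtain[OF p] by blast
    then show False
      using restricted_ideal_fibre[OF p e] assms by (metis)
  qed
  then show ?thesis using zero_in_restricted_ideal by auto
qed

text \<open>A sign is its own inverse, so with the product of both signs as coefficient the two
  images cancel.\<close>

lemma binomial_in_matching_ideal:
  fixes d e :: "nat set \<Rightarrow>\<^sub>0 nat"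
  assumes "Poly_Mapping.keys d \<subseteq> proper_subsets m" "Poly_Mapping.keys e \<subseteq> proper_subsets m"
    and "image_degree l d = image_degree l e"
  shows "monomial d - Poly_Mapping.single e (of_int (image_sign l d * image_sign l e)) \<in> matching_ideal m l"
    (is "?f \<in> _")
proof -
  have k: "Poly_Mapping.keys ?f \<subseteq> {d, e}"
    by (rule subset_trans[OF keys_diff]) (auto simp: monomial_def)
  have "subst (matching_term l) ?f = 0"
  proof (cases "d = e")
    case True
    then have "?f = 0" by (simp add: monomial_def image_sign_square flip: of_int_mult)
    then show ?thesis by (simp add: subst_def)
  next
    case False
    have "of_int (image_sign l d) - of_int (image_sign l d * image_sign l e) * of_int (image_sign l e) = (0 :: 'a)"
    proof -
      have "of_int (image_sign l d * image_sign l e) * (of_int (image_sign l e) :: 'a)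
          = of_int (image_sign l d * (image_sign l e * image_sign l e))"
        by (simp only: of_int_mult mult.assoc)
      then show ?thesis by (simp only: image_sign_square) simp
    qed
    then have zero: "Poly_Mapping.single (image_degree l e) (of_int (image_sign l d) -
        of_int (image_sign l d * image_sign l e) * of_int (image_sign l e)) = (0 :: (nat \<times> nat, 'a) mpoly)"
      by (simp only: single_zero)
    then show ?thesis using False assms(3)
        by (subst subst_matching_term[OF _ k])
         (simp_all add: lookup_minus monomial_def lookup_single when_def zero del: of_int_mult flip: single_add)
  qed
  then show ?thesis using k assms(1,2) by (auto simp: matching_ideal_def polys_def)
qed

text \<open>The binomial of \<open>d\<close> and \<open>e\<close> lies in the kernel, and its second
  term is divisible by a vanishing variable; adding that term back leaves the bare monomial.\<close>

lemma monomial_in_restricted_ideal: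
  assumes d: "Poly_Mapping.keys d \<subseteq> surviving_sets m w" and e: "Poly_Mapping.keys e \<subseteq> proper_subsets m"
    and deg: "image_degree l d = image_degree l e"
    and ne: "\<not> Poly_Mapping.keys e \<subseteq> surviving_sets m w"
  shows "(monomial d :: (nat set, 'k::field) mpoly) \<in> restricted_ideal m l w"
proof -
  obtain J where J: "J \<in> Poly_Mapping.keys e" "J \<in> vanishing_sets m w"
    using ne e by (auto simp: surviving_sets_def)
  define c :: 'k where "c = of_int (image_sign l d * image_sign l e)"
  define q :: "(nat set, 'k) mpoly" where "q = Poly_Mapping.single (e - Poly_Mapping.single J 1) c"
  have e_eq: "e - Poly_Mapping.single J 1 + Poly_Mapping.single J 1 = e"
    by (rule poly_mapping_eqI)
       (use J in \<open>auto simp: lookup_add lookup_minus lookup_single when_def in_keys_iff\<close>)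
  have q: "q * var J = Poly_Mapping.single e c"
    by (simp add: q_def var_def monomial_def mult_single e_eq[simplified])
  have "Poly_Mapping.keys (e - Poly_Mapping.single J 1) \<subseteq> Poly_Mapping.keys e"
    by (auto simp: in_keys_iff lookup_minus)
  then have "q \<in> polys (proper_subsets m)"
    using e by (auto simp: polys_def q_def)
  then have "Poly_Mapping.single e c \<in> ideal_generated (polys (proper_subsets m)) (var ` vanishing_sets m w)"
    unfolding ideal_generated_def using J q
    by (intro CollectI exI[of _ "{var J}"] exI[of _ "\<lambda>_. q"]) auto
  moreover have "monomial d - Poly_Mapping.single e c \<in> matching_ideal m l"
    unfolding c_def by (rule binomial_in_matching_ideal) (use d e deg surviving_subset[of m w] in auto)
  ultimately have "\<exists>f g. (monomial d :: (nat set, 'k) mpoly) = f + g \<and> f \<in> matching_ideal m l \<and>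
      g \<in> ideal_generated (polys (proper_subsets m)) (var ` vanishing_sets m w)"
    by (intro exI[of _ "monomial d - Poly_Mapping.single e c"] exI[of _ "Poly_Mapping.single e c"]) simp
  then show ?thesis using d
    by (auto simp: restricted_ideal_def polys_def monomial_def surviving_sets_def)
qed

lemma restricted_ideal_nonzero:
  assumes d: "Poly_Mapping.keys d \<subseteq> surviving_sets m w" and e: "Poly_Mapping.keys e \<subseteq> surviving_sets m w"
    and deg: "image_degree l d = image_degree l e" and ne: "d \<noteq> e"
  shows "(restricted_ideal m l w :: (nat set, 'k::field) mpoly set) \<noteq> {0}"
proof -
  define f :: "(nat set, 'k) mpoly"
    where "f = monomial d - Poly_Mapping.single e (of_int (image_sign l d * image_sign l e))"
  have "f \<in> matching_ideal m l"
    unfolding f_def using binomial_in_matching_ideal[OF subset_trans[OF d surviving_subset] subset_trans[OF e surviving_subset] deg] .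
  moreover have "(0 :: (nat set, 'k) mpoly) \<in> ideal_generated (polys (proper_subsets m)) (var ` vanishing_sets m w)"
    unfolding ideal_generated_def by (rule CollectI, rule exI[of _ "{}"]) auto
  ultimately have 1: "\<exists>a b. f = a + b \<and> a \<in> matching_ideal m l \<and>
      b \<in> ideal_generated (polys (proper_subsets m)) (var ` vanishing_sets m w)"
    by (intro exI[of _ f] exI[of _ 0]) simp
  have "Poly_Mapping.keys f \<subseteq> {d, e}"
    unfolding f_def by (rule subset_trans[OF keys_diff]) (auto simp: monomial_def)
  then have "f \<in> polys (surviving_sets m w)"
    using d e unfolding polys_def by blast
  with 1 have "f \<in> restricted_ideal m l w"
    by (simp add: restricted_ideal_def surviving_sets_def)
  moreover have "Poly_Mapping.lookup f d = 1"
    using ne by (simp add: f_def monomial_def lookup_minus lookup_single)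
  then have "f \<noteq> 0" by auto
  ultimately show ?thesis by auto
qed

section \<open>Surviving sets\<close>

definition below :: "nat set \<Rightarrow> nat \<Rightarrow> nat" where
  "below A c = card {a \<in> A. a < c}"

definition rank :: "nat set \<Rightarrow> nat \<Rightarrow> nat" where
  "rank J j = card {x \<in> J. x \<le> j}"

lemma row_rank: "row l J j = block_matching l J (rank J j)"
  by (simp add: row_def rank_def)

lemma below_le_card: "finite A \<Longrightarrow> below A c \<le> card A"
  by (auto simp: below_def intro: card_mono)

lemma below_insert:
  assumes "finite A" "z \<notin> A"
  shows "below (insert z A) c = below A c + (if z < c then 1 else 0)"
proof -
  have "{a \<in> insert z A. a < c} = (if z < c then insert z {a \<in> A. a < c} else {a \<in> A. a < c})" by auto
  then show ?thesis using assms by (auto simp: below_def)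
qed

lemma below_mono: "finite A \<Longrightarrow> c \<le> d \<Longrightarrow> below A c \<le> below A d"
  by (auto simp: below_def intro: card_mono)

lemma below_mono_set: "finite B \<Longrightarrow> A \<subseteq> B \<Longrightarrow> below A c \<le> below B c"
  by (auto simp: below_def intro: card_mono)

lemma rank_eq_below: "finite J \<Longrightarrow> j \<in> J \<Longrightarrow> rank J j = below J j + 1"
proof -
  assume a: "finite J" "j \<in> J"
  have "{x \<in> J. x \<le> j} = insert j {x \<in> J. x < j}" using a by auto
  then show ?thesis using a by (simp add: rank_def below_def)
qed

lemma rank_nth:
  assumes "finite J" "t < card J"
  shows "rank J (sorted_list_of_set J ! t) = t + 1"
  unfolding rank_def by (rule card_le_sorted_list_of_set_nth[OF assms])

lemma rank_less:
  assumes "finite J" "y \<in> J" "x < y"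
  shows "rank J x < rank J y"
proof -
  have "y \<in> {z \<in> J. z \<le> y} - {z \<in> J. z \<le> x}" using assms by auto
  then have "{z \<in> J. z \<le> x} \<noteq> {z \<in> J. z \<le> y}" by (metis DiffD1 DiffD2)
  moreover have "{z \<in> J. z \<le> x} \<subseteq> {z \<in> J. z \<le> y}" using assms by auto
  ultimately show ?thesis unfolding rank_def using assms(1) by (intro psubset_card_mono) auto
qed

lemma rank_bounds: "finite J \<Longrightarrow> j \<in> J \<Longrightarrow> 1 \<le> rank J j \<and> rank J j \<le> card J"
  using rank_eq_below[of J j] card_mono[of J "{x \<in> J. x \<le> j}"] by (auto simp: rank_def)

lemma rank_obtain:
  assumes "finite J" "1 \<le> r" "r \<le> card J"
  obtains x where "x \<in> J" "rank J x = r"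
proof
  show "sorted_list_of_set J ! (r - 1) \<in> J"
    using assms by (metis One_nat_def Suc_le_eq Suc_pred length_sorted_list_of_set nth_mem set_sorted_list_of_set)
  show "rank J (sorted_list_of_set J ! (r - 1)) = r"
    using rank_nth[of J "r - 1"] assms by simp
qed

lemma rank_bij: "finite J \<Longrightarrow> bij_betw (rank J) J {1..card J}"
  unfolding bij_betw_def
proof
  assume J: "finite J"
  show "inj_on (rank J) J"
    by (rule linorder_inj_onI') (metis rank_less[OF J] less_irrefl)
  show "rank J ` J = {1..card J}"
  proof (intro set_eqI iffI)
    fix r assume "r \<in> {1..card J}"
    then obtain x where "x \<in> J" "rank J x = r" using rank_obtain[OF J, of r] by auto
    then show "r \<in> rank J ` J" by auto
  qed (use rank_bounds[OF J] in auto)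
qed

text \<open>The elements below \<open>c\<close> form an initial segment of the sorted list, of
  length \<open>below A c\<close>.\<close>

lemma nth_less_iff_below:
  assumes "finite A" "i < card A"
  shows "sorted_list_of_set A ! i < c \<longleftrightarrow> i < below A c"
proof -
  let ?x = "sorted_list_of_set A ! i"
  have x: "?x \<in> A"
    using assms by (metis length_sorted_list_of_set nth_mem set_sorted_list_of_set)
  have "below A ?x = i" using rank_nth[OF assms] rank_eq_below[OF assms(1) x] by simp
  moreover have "below A ?x + 1 \<le> below A c" if "?x < c"
  proof -
    have "rank A ?x \<le> below A c"
      unfolding rank_def below_def using that assms by (intro card_mono) auto
    then show ?thesis using rank_eq_below[OF assms(1) x] by simp
  qed
  moreover have "below A c \<le> below A ?x" if "\<not> ?x < c"
    using that assms by (intro below_mono) auto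
  ultimately show ?thesis by linarith
qed

text \<open>Smaller entries mean more elements below each threshold, so the inequality turns around.
  Counts are easy to follow when elements are inserted or prefixes grow, which sorted lists are
  not.\<close>

lemma subset_le_iff_below:
  assumes "finite A" "finite B" "card A = card B"
  shows "subset_le A B \<longleftrightarrow> (\<forall>c. below B c \<le> below A c)"
proof
  assume le: "subset_le A B"
  show "\<forall>c. below B c \<le> below A c"
  proof (rule allI, rule ccontr)
    fix c assume asm: "\<not> below B c \<le> below A c"
    \<comment> \<open>This is the first index at which the list of \<open>A\<close> is no longer
      below \<open>c\<close>, while the list of \<open>B\<close> still is.\<close>
    let ?i = "below A c"
    have i: "?i < card B" using asm below_le_card[OF assms(2), of c] by linarith
    have "sorted_list_of_set B ! ?i < c" using asm nth_less_iff_below[OF assms(2) i, of c] by simp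
    moreover have "sorted_list_of_set A ! ?i \<le> sorted_list_of_set B ! ?i"
      using le i assms by (auto simp: subset_le_def list_all2_conv_all_nth)
    ultimately have "?i < ?i" using nth_less_iff_below[OF assms(1), of ?i c] i assms by simp
    then show False by simp
  qed
next
  assume b: "\<forall>c. below B c \<le> below A c"
  have "sorted_list_of_set A ! i \<le> sorted_list_of_set B ! i" if i: "i < card A" for i
  proof -
    have "i < below B (sorted_list_of_set B ! i + 1)"
      using nth_less_iff_below[OF assms(2), of i "sorted_list_of_set B ! i + 1"] i assms by simp
    then have "i < below A (sorted_list_of_set B ! i + 1)" using b by (meson less_le_trans)
    then show ?thesis using nth_less_iff_below[OF assms(1) i] by (metis Suc_eq_plus1 less_Suc_eq_le)
  qed
  then show "subset_le A B" using assms by (simp add: subset_le_def list_all2_conv_all_nth)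
qed

section \<open>Prefixes of a permutation\<close>

abbreviation prefix_set :: "nat list \<Rightarrow> nat \<Rightarrow> nat set" where
  "prefix_set w k \<equiv> set (take k w)"

lemma perms_iff: "w \<in> perms m \<longleftrightarrow> distinct w \<and> set w = {1..m}"
  by (auto simp: perms_def permutations_of_set_def)

lemma perms_length: "w \<in> perms m \<Longrightarrow> length w = m"
  using distinct_card[of w] by (simp add: perms_iff)

lemma perms_nth: "w \<in> perms m \<Longrightarrow> i < m \<Longrightarrow> w ! i \<in> {1..m}"
  by (metis nth_mem perms_iff perms_length)

lemma prefix_set_subset: "w \<in> perms m \<Longrightarrow> prefix_set w k \<subseteq> {1..m}"
  by (metis perms_iff set_take_subset)

lemma card_prefix_set: "w \<in> perms m \<Longrightarrow> k \<le> m \<Longrightarrow> card (prefix_set w k) = k"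
  by (metis distinct_card distinct_take length_take min.absorb2 perms_iff perms_length)

text \<open>List positions start at 0, so \<open>w ! k\<close> is the value following the first
  \<open>k\<close>; in particular \<open>w ! 0\<close> and \<open>w ! 1\<close> are w_1 and
  w_2.\<close>

lemma prefix_set_Suc: "w \<in> perms m \<Longrightarrow> k < m \<Longrightarrow> prefix_set w (Suc k) = insert (w ! k) (prefix_set w k)"
  by (simp add: perms_length take_Suc_conv_app_nth)

lemma nth_in_prefix_set: "w \<in> perms m \<Longrightarrow> i < m \<Longrightarrow> w ! i \<in> prefix_set w k \<longleftrightarrow> i < k"
  unfolding perms_iff using perms_length[of w m]
  by (auto simp: in_set_conv_nth nth_eq_iff_index_eq perms_iff)

lemma nth_notin_prefix_set: "w \<in> perms m \<Longrightarrow> k < m \<Longrightarrow> w ! k \<notin> prefix_set w k"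
  by (simp add: nth_in_prefix_set)

lemma surviving_iff:
  assumes "w \<in> perms m"
  shows "J \<in> surviving_sets m w \<longleftrightarrow>
    J \<noteq> {} \<and> J \<subset> {1..m} \<and> (\<forall>c. below (prefix_set w (card J)) c \<le> below J c)"
proof (cases "J \<noteq> {} \<and> J \<subset> {1..m}")
  case True
  then have fin: "finite J" by (meson finite_atLeastAtMost finite_subset psubset_imp_subset)
  have "card J \<le> m" using True by (metis card_atLeastAtMost card_mono diff_Suc_1 finite_atLeastAtMost psubset_imp_subset)
  then show ?thesis
    using True subset_le_iff_below[OF fin, of "prefix_set w (card J)"] card_prefix_set[OF assms]
    by (simp add: surviving_sets_def vanishing_sets_def proper_subsets_def)
qed (auto simp: surviving_sets_def proper_subsets_def)

lemma surviving_card: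
  assumes "J \<in> proper_subsets m"
  shows "finite J" "1 \<le> card J" "card J < m"
proof -
  show fin: "finite J" using assms by (auto simp: proper_subsets_def intro: finite_subset)
  then show "1 \<le> card J" using assms by (auto simp: proper_subsets_def Suc_le_eq card_gt_0_iff)
  show "card J < m" using assms psubset_card_mono[of "{1..m}" J] by (auto simp: proper_subsets_def)
qed

definition before :: "nat list \<Rightarrow> nat \<Rightarrow> nat \<Rightarrow> bool" where
  "before w x y \<longleftrightarrow> (\<exists>i j. i < j \<and> j < length w \<and> w ! i = x \<and> w ! j = y)"

text \<open>\<open>middle_of_312 w y\<close>: the value \<open>y\<close> plays the role of \<open>1\<close> in some occurrence of the pattern \<open>312\<close>.\<close>

definition middle_of_312 :: "nat list \<Rightarrow> nat \<Rightarrow> bool" where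
  "middle_of_312 w y \<longleftrightarrow> (\<exists>x c. y < c \<and> c < x \<and> before w x y \<and> before w y c)"

definition block_compatible :: "nat \<Rightarrow> nat list \<Rightarrow> bool" where
  "block_compatible l w \<longleftrightarrow> (\<forall>y. middle_of_312 w y \<longrightarrow> y = w ! 1) \<and>
     (w ! 0 = 1 \<or> w ! 0 = w ! 1 + 1 \<or> (w ! 0 < w ! 1 \<and> w ! 1 \<le> l) \<or> w ! 1 = l)"

text \<open>These are the products of pairwise disjoint adjacent transpositions.\<close>

definition adjacent_swaps :: "nat list \<Rightarrow> bool" where
  "adjacent_swaps w \<longleftrightarrow> (\<forall>y. \<not> middle_of_312 w y) \<and>
     (\<forall>y u v. y < u \<and> u < v \<and> before w u y \<and> before w v y \<longrightarrow> False)"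

lemma before_nth:
  assumes "w \<in> perms m" "i < m" "j < m"
  shows "before w (w ! i) (w ! j) \<longleftrightarrow> i < j"
  using assms perms_length[OF assms(1)] by (auto simp: before_def perms_iff nth_eq_iff_index_eq)

lemma before_in_perms:
  assumes "w \<in> perms m" "before w x y"
  shows "x \<in> {1..m}" "y \<in> {1..m}"
  using assms perms_nth[OF assms(1)] perms_length[OF assms(1)] by (auto simp: before_def)

lemma perms_obtain:
  assumes "w \<in> perms m" "v \<in> {1..m}"
  obtains i where "i < m" "w ! i = v"
  using assms perms_length[OF assms(1)] by (metis in_set_conv_nth perms_iff)

lemma before_nth_right:
  assumes "w \<in> perms m" "j < m"
  shows "before w x (w ! j) \<longleftrightarrow> x \<in> prefix_set w j"
proof
  assume b: "before w x (w ! j)"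
  then obtain i where i: "i < m" "w ! i = x" using perms_obtain before_in_perms(1) assms by metis
  then show "x \<in> prefix_set w j" using before_nth nth_in_prefix_set assms b by metis
next
  assume x: "x \<in> prefix_set w j"
  then obtain i where i: "i < m" "w ! i = x" using perms_obtain prefix_set_subset assms by blast
  then show "before w x (w ! j)" using before_nth nth_in_prefix_set assms x by metis
qed

lemma before_nth_left:
  assumes "w \<in> perms m" "j < m"
  shows "before w (w ! j) x \<longleftrightarrow> x \<in> {1..m} - prefix_set w (Suc j)"
proof (cases "x \<in> {1..m}")
  case True
  then obtain i where i: "i < m" "w ! i = x" using perms_obtain assms by metis
  then show ?thesis
    using before_nth[OF assms(1), of j i] nth_in_prefix_set[OF assms(1), of i "Suc j"] assms True by auto
qed (use before_in_perms assms in blast)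

text \<open>Survival sees only prefixes, so the pattern is put in the same terms: the 3 lies in the
  prefix before position \<open>p\<close>, the 2 outside the prefix that includes it.\<close>

lemma middle_of_312_nth:
  assumes "w \<in> perms m" "p < m"
  shows "middle_of_312 w (w ! p) \<longleftrightarrow>
    (\<exists>x c. w ! p < c \<and> c < x \<and> x \<in> prefix_set w p \<and> c \<in> {1..m} - prefix_set w (Suc p))"
  unfolding middle_of_312_def before_nth_left[OF assms] before_nth_right[OF assms] ..

text \<open>Let \<open>r\<close> be the rank of \<open>j\<close>. The first \<open>r\<close> values
  of \<open>w\<close> are at most their maximum \<open>M\<close>, so every longer prefix has at
  least \<open>r\<close> values up to \<open>M\<close>. Then so has a surviving \<open>J\<close>,
  and its \<open>r\<close>-th smallest element is \<open>j\<close>.\<close>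

lemma surviving_bounds:
  assumes w: "w \<in> perms m" and J: "J \<in> surviving_sets m w" and j: "j \<in> J"
  shows "j \<le> Max (prefix_set w (rank J j))"
proof -
  have p: "J \<in> proper_subsets m" using J surviving_subset by blast
  note c = surviving_card[OF p]
  let ?r = "rank J j" let ?M = "Max (prefix_set w ?r)"
  have r: "1 \<le> ?r" "?r \<le> card J" using rank_bounds[OF c(1) j] by auto
  have "below (prefix_set w ?r) (?M + 1) = card (prefix_set w ?r)"
    unfolding below_def by (rule arg_cong[where f = card]) (auto simp: less_Suc_eq_le)
  also have "\<dots> = ?r" using card_prefix_set[OF w, of ?r] r c by simp
  finally have "?r \<le> below (prefix_set w (card J)) (?M + 1)"
    using below_mono_set[of "prefix_set w (card J)" "prefix_set w ?r" "?M + 1"]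
      set_take_subset_set_take[OF r(2), of w] by auto
  also have "\<dots> \<le> below J (?M + 1)" using J surviving_iff[OF w] by blast
  finally have "below J j < below J (?M + 1)" using rank_eq_below[OF c(1) j] by simp
  then show ?thesis using below_mono[OF c(1), of "?M + 1" j] by linarith
qed

text \<open>A prefix of length at least 2 contains \<open>w ! 1\<close>, so a surviving set must
  have some element that small.\<close>

lemma surviving_min:
  assumes w: "w \<in> perms m" and J: "J \<in> surviving_sets m w" and k: "2 \<le> card J"
  shows "\<exists>x\<in>J. x \<le> w ! 1"
proof -
  have p: "J \<in> proper_subsets m" using J surviving_subset by blast
  note c = surviving_card[OF p]
  have "w ! 1 \<in> prefix_set w (card J)" using nth_in_prefix_set[OF w, of 1 "card J"] k c by simp
  then have "0 < below (prefix_set w (card J)) (w ! 1 + 1)"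
    by (auto simp: below_def card_gt_0_iff)
  then have "0 < below J (w ! 1 + 1)" using J surviving_iff[OF w] by (metis less_le_trans)
  then show ?thesis by (auto simp: below_def card_gt_0_iff less_Suc_eq_le)
qed

text \<open>This is the converse of the two preceding bounds. A failure of survival, taken at the
  shortest prefix that shows it, ends in a value \<open>y\<close> with a larger value before it. If
  \<open>y\<close> is the 1 of a 312 pattern, it is the second value and \<open>min\<close> applies;
  otherwise the values in between all occur already and counting contradicts
  \<open>bounds\<close>.\<close>

lemma surviving_if_bounds:
  assumes w: "w \<in> perms m" and pattern: "\<And>y. middle_of_312 w y \<Longrightarrow> y = w ! 1"
    and p: "J \<in> proper_subsets m"
    and bounds: "\<And>j. j \<in> J \<Longrightarrow> j \<le> Max (prefix_set w (rank J j))"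
    and min: "2 \<le> card J \<Longrightarrow> \<exists>x\<in>J. x \<le> w ! 1"
  shows "J \<in> surviving_sets m w"
proof (rule ccontr)
  assume neg: "J \<notin> surviving_sets m w"
  note cJ = surviving_card[OF p]
  let ?k = "card J"
  obtain c0 where c0: "below J c0 < below (prefix_set w ?k) c0"
    using neg p surviving_iff[OF w] by (force simp: proper_subsets_def not_le)
  have "below J c0 < card J"
    using c0 below_le_card[of "prefix_set w ?k" c0] card_prefix_set[OF w, of ?k] cJ by simp
  then have "{x \<in> J. c0 \<le> x} \<noteq> {}"
    unfolding below_def by (metis (no_types, lifting) Collect_cong Collect_mem_eq empty_Collect_eq leI less_irrefl)
  \<comment> \<open>Raising the threshold to the next element of \<open>J\<close> keeps the count in
    \<open>J\<close> and cannot lower the count in the prefix.\<close>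
  define c where "c = Min {x \<in> J. c0 \<le> x}"
  have c: "c \<in> J" "c0 \<le> c"
    using Min_in[of "{x \<in> J. c0 \<le> x}"] \<open>{x \<in> J. c0 \<le> x} \<noteq> {}\<close> cJ(1) by (auto simp: c_def)
  have "{x \<in> J. x < c} = {x \<in> J. x < c0}"
    using c(2) Min_le[of "{x \<in> J. c0 \<le> x}"] cJ(1) by (fastforce simp: c_def not_less)
  then have "below J c = below J c0" by (simp add: below_def)
  define i where "i = below J c"
  have i: "i < below (prefix_set w ?k) c"
    using \<open>below J c = below J c0\<close> c0 below_mono[of "prefix_set w ?k" c0 c] c(2) by (simp add: i_def)
  \<comment> \<open>In the shortest offending prefix the last value lies below \<open>c\<close>, and
    the count is exactly \<open>i + 1\<close>.\<close>
  define j where "j = (LEAST j. i < below (prefix_set w j) c)"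
  have j: "i < below (prefix_set w j) c" "j \<le> ?k"
    unfolding j_def using i by (rule LeastI, intro Least_le)
  have "j \<noteq> 0" using j(1) by (auto simp: below_def intro: ccontr)
  then obtain q where q: "j = Suc q" by (cases j) auto
  have "\<not> i < below (prefix_set w q) c" using not_less_Least[of q "\<lambda>j. i < below (prefix_set w j) c"] q j_def by auto
  have qm: "q < m" using q j cJ by simp
  define y where "y = w ! q"
  have step: "below (prefix_set w j) c = below (prefix_set w q) c + (if y < c then 1 else 0)"
    unfolding q prefix_set_Suc[OF w qm] y_def
    by (rule below_insert) (simp_all add: nth_notin_prefix_set[OF w qm])
  then have y: "y < c" and bj: "below (prefix_set w j) c = i + 1"
    using j(1) \<open>\<not> i < below (prefix_set w q) c\<close> by (auto split: if_splits)
  define M where "M = Max (prefix_set w j)"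
  have cardj: "card (prefix_set w j) = j" using card_prefix_set[OF w, of j] q qm by simp
  have Min: "M \<in> prefix_set w j" and Mmax: "\<And>x. x \<in> prefix_set w j \<Longrightarrow> x \<le> M"
    unfolding M_def using cardj q by (auto intro!: Max_in)
  have rank_c: "rank J c = i + 1" using rank_eq_below[OF cJ(1) c(1)] i_def by simp
  \<comment> \<open>Otherwise the whole prefix lies below \<open>c\<close>, so its length is the
    rank of \<open>c\<close>, and the bound at \<open>c\<close> itself is violated.\<close>
  have "c \<le> M"
  proof (rule ccontr)
    assume "\<not> c \<le> M"
    then have "{x \<in> prefix_set w j. x < c} = prefix_set w j" using Mmax by fastforce
    then have "j = i + 1" using bj cardj by (simp add: below_def)
    then show False using bounds[OF c(1)] rank_c \<open>\<not> c \<le> M\<close> by (simp add: M_def)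
  qed
  then have Mq: "M \<in> prefix_set w q"
    using Min y unfolding q prefix_set_Suc[OF w qm] y_def by auto
  show False
  proof (cases "middle_of_312 w y")
    case True
    then have "w ! q = w ! 1" using pattern by (simp add: y_def)
    moreover have "q \<noteq> 0" using Mq by (intro notI) simp
    ultimately have "q = 1"
      using w perms_length[OF w] qm nth_eq_iff_index_eq[of w q 1] by (auto simp: perms_iff)
    then have "prefix_set w q = {M}"
      using Mq card_prefix_set[OF w, of q] qm by (metis One_nat_def card_1_singletonE less_imp_le_nat singletonD)
    then have "below (prefix_set w q) c = 0" using \<open>c \<le> M\<close> by (auto simp: below_def)
    then have "i = 0" using bj step y by simp
    moreover obtain x where "x \<in> J" "x \<le> w ! 1" using min q \<open>q = 1\<close> j by auto
    ultimately show False using y cJ(1) \<open>q = 1\<close> by (auto simp: i_def below_def y_def)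
  next
    case False
    \<comment> \<open>A value \<open>v\<close> of this range outside the prefix would complete the
      312 pattern \<open>M\<close>, \<open>y\<close>, \<open>v\<close>.\<close>
    have "v \<in> prefix_set w j" if v: "c \<le> v" "v \<le> M" for v
    proof (rule ccontr)
      assume "v \<notin> prefix_set w j"
      then have "v < M" using Min v by (metis le_neq_implies_less)
      moreover have "v \<in> {1..m}" using v y Min prefix_set_subset[OF w, of j] by auto
      ultimately have "middle_of_312 w (w ! q)"
        unfolding middle_of_312_nth[OF w qm]
        using v y Mq \<open>v \<notin> prefix_set w j\<close> unfolding q y_def
        by (intro exI[of _ M] exI[of _ v]) auto
      then show False using False by (simp add: y_def)
    qed
    then have "prefix_set w j = {x \<in> prefix_set w j. x < c} \<union> {c..M}" using Mmax by fastforce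
    then have "j = card ({x \<in> prefix_set w j. x < c} \<union> {c..M})" using cardj by simp
    also have "\<dots> = i + 1 + (M + 1 - c)"
      using bj by (subst card_Un_disjoint) (auto simp: below_def)
    finally have j_eq: "j = i + 1 + (M + 1 - c)" .
    \<comment> \<open>The element of rank \<open>j\<close> is at most \<open>M\<close>, but
      \<open>J\<close> has only \<open>i\<close> elements below \<open>c\<close> and at most
      \<open>M + 1 - c\<close> from \<open>c\<close> to \<open>M\<close>, which is one too
      few.\<close>
    obtain x where x: "x \<in> J" "rank J x = j" using rank_obtain[OF cJ(1), of j] q j by auto
    then have "x \<le> M" using bounds M_def by metis
    then have "{z \<in> J. z \<le> x} \<subseteq> {z \<in> J. z < c} \<union> {c..M}" by auto
    then have "rank J x \<le> card ({z \<in> J. z < c} \<union> {c..M})"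
      unfolding rank_def using cJ(1) by (intro card_mono) auto
    also have "\<dots> \<le> i + (M + 1 - c)"
      using card_Un_le[of "{z \<in> J. z < c}" "{c..M}"] by (simp add: i_def below_def)
    finally show False using x j_eq by simp
  qed
qed

section \<open>Permutations without monomials\<close>

lemma finite_proper_subsets: "finite (proper_subsets m)"
  by (rule finite_subset[of _ "Pow {1..m}"]) (auto simp: proper_subsets_def)

lemma block_matching_ge_3: "3 \<le> i \<Longrightarrow> block_matching l J i = i"
  by (simp add: block_matching_def Transposition.transpose_def)

lemma block_matching_le_2: "i \<in> {1, 2} \<Longrightarrow> block_matching l J i \<in> {1, 2}"
  by (auto simp: block_matching_def Transposition.transpose_def)

text \<open>The exchange permutes rows 1 and 2 among themselves, so lying in one of them does not
  depend on it.\<close>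

lemma row_le_2_iff:
  assumes "finite J" "j \<in> J"
  shows "row l J j \<le> 2 \<longleftrightarrow> rank J j \<le> 2"
proof (cases "rank J j \<le> 2")
  case True
  then have "rank J j \<in> {1, 2}" using rank_bounds[OF assms] by auto
  then show ?thesis using block_matching_le_2[of "rank J j" l J] True by (auto simp: row_rank)
qed (simp add: row_rank block_matching_ge_3)

lemma row_ge_3: "\<not> rank J j \<le> 2 \<Longrightarrow> row l J j = rank J j"
  by (simp add: row_rank block_matching_ge_3)

lemma row_untwisted: "card (J \<inter> {1..l}) \<noteq> 1 \<or> card J < 2 \<Longrightarrow> row l J j = rank J j"
  by (auto simp: row_rank block_matching_def)

lemma row_twisted: "2 \<le> card J \<Longrightarrow> card (J \<inter> {1..l}) = 1 \<Longrightarrow> row l J j = Transposition.transpose 1 2 (rank J j)"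
  by (auto simp: row_rank block_matching_def)

lemma row_bij:
  assumes "finite J"
  shows "bij_betw (row l J) J {1..card J}"
proof -
  have "bij_betw (block_matching l J) {1..card J} {1..card J}"
    unfolding block_matching_def by (auto intro!: permutes_imp_bij permutes_swap_id)
  then have "bij_betw (block_matching l J \<circ> rank J) J {1..card J}"
    by (rule bij_betw_trans[OF rank_bij[OF assms]])
  then show ?thesis by (simp add: row_rank comp_def cong: bij_betw_cong)
qed

lemma row_bounds: "finite J \<Longrightarrow> j \<in> J \<Longrightarrow> 1 \<le> row l J j \<and> row l J j \<le> card J"
  using bij_betwE[OF row_bij, of J l] by auto

section \<open>Statistics of a monomial visible in its image\<close>

lemma sum_column_degree_rows:
  assumes "J \<in> proper_subsets m"
  shows "(\<Sum>i = 1..m. Poly_Mapping.lookup (column_degree l J) (i, j)) = (if j \<in> J then 1 else 0)"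
proof (cases "j \<in> J")
  case True
  have "(\<Sum>i = 1..m. Poly_Mapping.lookup (column_degree l J) (i, j)) = (\<Sum>i = 1..m. if i = row l J j then 1 else 0)"
    using True surviving_card(1)[OF assms] by (intro sum.cong) (auto simp: lookup_column_degree)
  also have "\<dots> = 1"
    using row_bounds[OF surviving_card(1)[OF assms] True, of l] surviving_card(3)[OF assms] by simp
  finally show ?thesis using True by simp
qed (simp add: lookup_column_degree surviving_card(1)[OF assms])

lemma sum_column_degree_entries:
  assumes "J \<in> proper_subsets m" "1 \<le> i"
  shows "(\<Sum>j = 1..m. Poly_Mapping.lookup (column_degree l J) (i, j)) = (if i \<le> card J then 1 else 0)"
proof -
  note fin = surviving_card(1)[OF assms(1)]
  have "(\<Sum>j = 1..m. Poly_Mapping.lookup (column_degree l J) (i, j))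
      = (\<Sum>j\<in>J. if row l J j = i then 1 else 0)"
    using assms fin
    by (intro sum.mono_neutral_cong_right) (auto simp: lookup_column_degree proper_subsets_def)
  also have "\<dots> = (\<Sum>r = 1..card J. if r = i then 1 else 0)"
    by (rule sum.reindex_bij_betw[OF row_bij[OF fin]])
  also have "\<dots> = (if i \<le> card J then 1 else 0)" using assms(2) by auto
  finally show ?thesis .
qed

text \<open>Summing over all rows forgets the exchange of rows; what remains is the number of
  factors, with multiplicity, whose set contains \<open>j\<close>.\<close>

lemma image_degree_content:
  assumes "Poly_Mapping.keys e \<subseteq> proper_subsets m"
  shows "(\<Sum>i = 1..m. Poly_Mapping.lookup (image_degree l e) (i, j)) =
    (\<Sum>J\<in>proper_subsets m. Poly_Mapping.lookup e J * (if j \<in> J then 1 else 0))"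
proof -
  have "(\<Sum>i = 1..m. Poly_Mapping.lookup (image_degree l e) (i, j)) =
    (\<Sum>J\<in>proper_subsets m. \<Sum>i = 1..m. Poly_Mapping.lookup e J * Poly_Mapping.lookup (column_degree l J) (i, j))"
    by (subst sum.swap) (simp add: lookup_image_degree[OF finite_proper_subsets assms])
  also have "\<dots> = (\<Sum>J\<in>proper_subsets m. Poly_Mapping.lookup e J * (if j \<in> J then 1 else 0))"
    by (rule sum.cong[OF refl]) (simp only: sum_distrib_left[symmetric] sum_column_degree_rows)
  finally show ?thesis .
qed

text \<open>Exchanged or not, a set with at least \<open>i\<close> elements has exactly one entry in
  row \<open>i\<close>, so the row sum counts such sets.\<close>

lemma image_degree_size:
  assumes "Poly_Mapping.keys e \<subseteq> proper_subsets m" "1 \<le> i"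
  shows "(\<Sum>j = 1..m. Poly_Mapping.lookup (image_degree l e) (i, j)) =
    (\<Sum>J\<in>proper_subsets m. Poly_Mapping.lookup e J * (if i \<le> card J then 1 else 0))"
proof -
  have "(\<Sum>j = 1..m. Poly_Mapping.lookup (image_degree l e) (i, j)) =
    (\<Sum>J\<in>proper_subsets m. \<Sum>j = 1..m. Poly_Mapping.lookup e J * Poly_Mapping.lookup (column_degree l J) (i, j))"
    by (subst sum.swap) (simp add: lookup_image_degree[OF finite_proper_subsets assms(1)])
  also have "\<dots> = (\<Sum>J\<in>proper_subsets m. Poly_Mapping.lookup e J * (if i \<le> card J then 1 else 0))"
    using assms(2) by (intro sum.cong[OF refl]) (simp only: sum_distrib_left[symmetric] sum_column_degree_entries)
  finally show ?thesis .
qed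

text \<open>Exponents cannot cancel: a variable dividing the image of one monomial comes from a
  factor of every other monomial of the fibre.\<close>

lemma fibre_transport:
  assumes d: "Poly_Mapping.keys d \<subseteq> proper_subsets m" and e: "Poly_Mapping.keys e \<subseteq> proper_subsets m"
    and deg: "image_degree l d = image_degree l e"
    and J: "J \<in> Poly_Mapping.keys d" "j \<in> J"
  obtains I where "I \<in> Poly_Mapping.keys e" "j \<in> I" "row l I j = row l J j"
proof -
  have fin: "finite I" if "I \<in> proper_subsets m" for I using surviving_card(1)[OF that] .
  let ?x = "(row l J j, j)"
  have "0 < Poly_Mapping.lookup d J * Poly_Mapping.lookup (column_degree l J) ?x"
    using J fin[OF subsetD[OF d J(1)]] by (subst lookup_column_degree) (auto simp: in_keys_iff)
  also have "\<dots> \<le> Poly_Mapping.lookup (image_degree l d) ?x"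
    unfolding lookup_image_degree[OF finite_proper_subsets d]
    by (rule member_le_sum) (use J d finite_proper_subsets in auto)
  finally have "Poly_Mapping.lookup (image_degree l e) ?x \<noteq> 0" using deg by simp
  then obtain I where I: "I \<in> proper_subsets m"
    "Poly_Mapping.lookup e I * Poly_Mapping.lookup (column_degree l I) ?x \<noteq> 0"
    unfolding lookup_image_degree[OF finite_proper_subsets e] by (meson sum.not_neutral_contains_not_neutral)
  then show ?thesis
    using that[of I] fin[OF I(1)] by (auto simp: lookup_column_degree in_keys_iff split: if_splits)
qed

text \<open>All factors contain \<open>v\<close> exactly when the number of factors containing
  \<open>v\<close> is the number of all factors. Both numbers are read off the image, the latter as
  the sum over row 1.\<close>

lemma fibre_all_contain:
  assumes d: "Poly_Mapping.keys d \<subseteq> proper_subsets m" and e: "Poly_Mapping.keys e \<subseteq> proper_subsets m"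
    and deg: "image_degree l d = image_degree l e"
    and all: "\<And>I. I \<in> Poly_Mapping.keys e \<Longrightarrow> v \<in> I" and J: "J \<in> Poly_Mapping.keys d"
  shows "v \<in> J"
proof (rule ccontr)
  assume v: "v \<notin> J"
  have size: "(\<Sum>J\<in>proper_subsets m. Poly_Mapping.lookup c J * (if 1 \<le> card J then 1 else 0))
      = (\<Sum>J\<in>proper_subsets m. Poly_Mapping.lookup c J)" for c :: "nat set \<Rightarrow>\<^sub>0 nat"
    using surviving_card(2) by (intro sum.cong) (auto simp: Suc_le_eq)
  have "(\<Sum>J\<in>proper_subsets m. Poly_Mapping.lookup d J * (if v \<in> J then 1 else 0))
     = (\<Sum>J\<in>proper_subsets m. Poly_Mapping.lookup e J * (if v \<in> J then 1 else 0))"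
    using image_degree_content[OF d, of l v] image_degree_content[OF e, of l v] deg by simp
  also have "\<dots> = (\<Sum>J\<in>proper_subsets m. Poly_Mapping.lookup e J)"
    using all by (intro sum.cong[OF refl]) (auto simp: in_keys_iff)
  also have "\<dots> = (\<Sum>J\<in>proper_subsets m. Poly_Mapping.lookup d J)"
    using image_degree_size[OF d, of 1 l] image_degree_size[OF e, of 1 l] deg unfolding size by simp
  also have "\<dots> > (\<Sum>J\<in>proper_subsets m. Poly_Mapping.lookup d J * (if v \<in> J then 1 else 0))"
  proof (rule sum_strict_mono_ex1[OF finite_proper_subsets])
    show "\<exists>J\<in>proper_subsets m.
        Poly_Mapping.lookup d J * (if v \<in> J then 1 else 0) < Poly_Mapping.lookup d J"
      by (rule bexI[of _ J]) (use J v d in \<open>auto simp: in_keys_iff\<close>)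
  qed simp
  finally show False by simp
qed

lemma perms_first_two:
  assumes w: "w \<in> perms m" and m: "2 \<le> m"
  shows "prefix_set w 1 = {w ! 0}" "prefix_set w 2 = {w ! 0, w ! 1}" "w ! 0 \<noteq> w ! 1"
    "w ! 0 \<in> {1..m}" "w ! 1 \<in> {1..m}"
proof -
  show p1: "prefix_set w 1 = {w ! 0}" using prefix_set_Suc[OF w, of 0] m by simp
  show "prefix_set w 2 = {w ! 0, w ! 1}"
    using prefix_set_Suc[OF w, of 1] m p1 by (simp add: numeral_2_eq_2 insert_commute)
  show "w ! 0 \<noteq> w ! 1" using nth_notin_prefix_set[OF w, of 1] m p1 by simp
  show "w ! 0 \<in> {1..m}" "w ! 1 \<in> {1..m}" using perms_nth[OF w] m by auto
qed

text \<open>Survival of all variables of a monomial can be read off from the entries in the rows of its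
  image; only for \<open>w ! 0 = 1\<close> one also has to count the occurrences of \<open>1\<close>.\<close>

lemma block_compatible_fibre_closed:
  assumes w: "w \<in> perms m" and m: "2 \<le> m" and comp: "block_compatible l w"
    and e: "Poly_Mapping.keys e \<subseteq> surviving_sets m w" and d: "Poly_Mapping.keys d \<subseteq> proper_subsets m"
    and deg: "image_degree l d = image_degree l e"
  shows "Poly_Mapping.keys d \<subseteq> surviving_sets m w"
proof
  fix J assume J: "J \<in> Poly_Mapping.keys d"
  have e': "Poly_Mapping.keys e \<subseteq> proper_subsets m" using e surviving_subset by blast
  have Jp: "J \<in> proper_subsets m" using J d by blast
  note cJ = surviving_card[OF Jp]
  note w12 = perms_first_two[OF w m]
  have fin: "finite I" if "I \<in> surviving_sets m w" for I
    using that surviving_subset surviving_card(1) by blast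
  have max1: "Max (prefix_set w 1) = w ! 0" using w12 by simp
  have max2: "Max (prefix_set w 2) = max (w ! 0) (w ! 1)" using w12 by simp
  have transport: "\<exists>I\<in>surviving_sets m w. j \<in> I \<and> row l I j = row l J j" if "j \<in> J" for j
    using fibre_transport[OF d e' deg J that] e by blast
  have high: "j \<le> Max (prefix_set w (rank J j))" if j: "j \<in> J" "\<not> rank J j \<le> 2" for j
  proof -
    obtain I where I: "I \<in> surviving_sets m w" "j \<in> I" "row l I j = row l J j"
      using transport[OF j(1)] by blast
    have "row l J j = rank J j" using row_ge_3 j by blast
    moreover have "row l I j = rank I j"
      using row_ge_3 row_le_2_iff[OF fin[OF I(1)] I(2)] I(3) j(2) \<open>row l J j = rank J j\<close> by metis
    ultimately show ?thesis using surviving_bounds[OF w I(1,2)] I(3) by simp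
  qed
  have low: "\<exists>I\<in>surviving_sets m w. j \<in> I \<and> rank I j \<le> 2 \<and> row l I j = row l J j"
    if "j \<in> J" "rank J j \<le> 2" for j
    using transport[OF that(1)] row_le_2_iff[OF cJ(1) that(1), of l] row_le_2_iff[OF fin, of _ j l] that(2)
    by metis
  have rank12: "rank I j = 1 \<or> rank I j = 2" if "finite I" "j \<in> I" "rank I j \<le> 2" for I j
    using rank_bounds[OF that(1,2)] that(3) by linarith
  \<comment> \<open>The ranks of \<open>j\<close> in \<open>J\<close> and in \<open>I\<close> may
    differ by the exchange, so only the weaker of the two bounds is transported.\<close>
  have low_max: "j \<le> max (w ! 0) (w ! 1)" if j: "j \<in> J" "rank J j \<le> 2" for j
  proof -
    obtain I where I: "I \<in> surviving_sets m w" "j \<in> I" "rank I j \<le> 2" using low[OF j] by blast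
    then show ?thesis
      using rank12[OF fin[OF I(1)] I(2,3)] surviving_bounds[OF w I(1,2)] max1 max2 by auto
  qed
  have pattern: "y = w ! 1" if "middle_of_312 w y" for y
    using comp that by (auto simp: block_compatible_def)
  \<comment> \<open>What \<open>low_max\<close> does not provide is the bound of the smallest entry
    by \<open>w ! 0\<close> and by \<open>w ! 1\<close>; here the four alternatives part.\<close>
  have conclude: "J \<in> surviving_sets m w"
    if one: "\<And>j. j \<in> J \<Longrightarrow> rank J j = 1 \<Longrightarrow> j \<le> w ! 0"
      and two: "\<And>j. j \<in> J \<Longrightarrow> rank J j = 2 \<Longrightarrow> j \<le> max (w ! 0) (w ! 1)"
      and min: "2 \<le> card J \<Longrightarrow> \<exists>x\<in>J. x \<le> w ! 1"
  proof (rule surviving_if_bounds[OF w pattern Jp _ min])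
    fix j assume j: "j \<in> J"
    show "j \<le> Max (prefix_set w (rank J j))"
      using high[OF j] one[OF j] two[OF j] rank12[OF cJ(1) j] max1 max2 by fastforce
  qed
  consider (first) "w ! 0 = 1" | (step) "w ! 0 = w ! 1 + 1" | (small) "w ! 0 < w ! 1" "w ! 1 \<le> l"
    | (l) "w ! 1 = l" "l < w ! 0"
    using comp w12(3) unfolding block_compatible_def by (metis linorder_neqE_nat order_refl)
  then show "J \<in> surviving_sets m w"
  proof cases
    case first
    have "1 \<in> I" if "I \<in> Poly_Mapping.keys e" for I
    proof -
      have I: "I \<in> surviving_sets m w" using that e by blast
      then have "I \<in> proper_subsets m" using surviving_subset by blast
      note cI = surviving_card[OF this]
      obtain x where x: "x \<in> I" "rank I x = 1" using rank_obtain[OF cI(1), of 1] cI by auto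
      then have "x \<le> 1" using surviving_bounds[OF w I x(1)] max1 first by simp
      moreover have "x \<ge> 1" using x \<open>I \<in> proper_subsets m\<close> by (auto simp: proper_subsets_def)
      ultimately show ?thesis using x by simp
    qed
    then have "1 \<in> J" using fibre_all_contain[OF d e' deg _ J] by blast
    moreover have "j = 1" if "j \<in> J" "rank J j = 1" for j
    proof (rule ccontr)
      assume "j \<noteq> 1"
      then have "1 < j" using that Jp by (fastforce simp: proper_subsets_def)
      then show False using rank_less[OF cJ(1) that(1), of 1] rank_bounds[OF cJ(1) \<open>1 \<in> J\<close>] that by simp
    qed
    ultimately show ?thesis using low_max w12(5) first by (intro conclude) force+
  next
    case step
    have "\<exists>x\<in>J. x \<le> w ! 1" if k: "2 \<le> card J"
    proof -
      obtain x where x: "x \<in> J" "rank J x = 1" using rank_obtain[OF cJ(1), of 1] cJ by auto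
      obtain z where z: "z \<in> J" "rank J z = 2" using rank_obtain[OF cJ(1), of 2] k by auto
      have "x < z" using rank_less[OF cJ(1) x(1), of z] x z by (metis less_not_refl linorder_neqE_nat one_less_numeral_iff order.asym semiring_norm(76))
      moreover have "z \<le> w ! 1 + 1" using low_max[OF z(1)] z(2) step by simp
      ultimately have "x \<le> w ! 1" by simp
      then show ?thesis using x by blast
    qed
    then show ?thesis using low_max step by (intro conclude) force+
  next
    case small
    have untwisted: "row l I j = rank I j"
      if I: "finite I" "\<And>j. j \<in> I \<Longrightarrow> rank I j \<le> 2 \<Longrightarrow> j \<le> l" "I \<subseteq> {1..m}" for I j
    proof (rule row_untwisted, rule disjCI)
      assume "\<not> card I < 2"
      obtain x where x: "x \<in> I" "rank I x = 1" using rank_obtain[OF I(1), of 1] \<open>\<not> card I < 2\<close> by auto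
      obtain z where z: "z \<in> I" "rank I z = 2" using rank_obtain[OF I(1), of 2] \<open>\<not> card I < 2\<close> by auto
      have "{x, z} \<subseteq> I \<inter> {1..l}" using x z I(2)[OF x(1)] I(2)[OF z(1)] I(3) by auto
      moreover have "x \<noteq> z" using x z by auto
      ultimately show "card (I \<inter> {1..l}) \<noteq> 1"
        using card_mono[of "I \<inter> {1..l}" "{x, z}"] by auto
    qed
    have I_small: "j \<le> l" if "I \<in> surviving_sets m w" "j \<in> I" "rank I j \<le> 2" for I j
      using rank12[OF fin[OF that(1)] that(2,3)] surviving_bounds[OF w that(1,2)] max1 max2 small by auto
    have rowJ: "row l J j = rank J j" for j
      using untwisted[of J j] cJ(1) low_max small Jp by (fastforce simp: proper_subsets_def)
    have bound: "j \<le> Max (prefix_set w (rank J j))" if j: "j \<in> J" for j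
    proof -
      obtain I where I: "I \<in> surviving_sets m w" "j \<in> I" "row l I j = row l J j"
        using transport[OF j] by blast
      moreover have "row l I j = rank I j"
        using untwisted[of I j] fin[OF I(1)] I_small[OF I(1)] I(1) surviving_iff[OF w] by blast
      ultimately show ?thesis using surviving_bounds[OF w I(1,2)] rowJ by simp
    qed
    have "\<exists>x\<in>J. x \<le> w ! 1"
    proof -
      obtain x where x: "x \<in> J" "rank J x = 1" using rank_obtain[OF cJ(1), of 1] cJ by auto
      then have "x \<le> w ! 1" using bound[OF x(1)] max1 small by simp
      then show ?thesis using x by blast
    qed
    then show ?thesis using bound by (intro surviving_if_bounds[OF w pattern Jp])
  next
    case l
    have "\<exists>x\<in>J. x \<le> w ! 1" if k: "2 \<le> card J"
    proof -
      obtain j where j: "j \<in> J" "row l J j = 2"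
        using bij_betw_imp_surj_on[OF row_bij[OF cJ(1), of l]] k by (metis atLeastAtMost_iff image_iff one_le_numeral)
      obtain I where I: "I \<in> surviving_sets m w" "j \<in> I" "row l I j = 2"
        using transport[OF j(1)] j(2) by auto
      have kI: "2 \<le> card I" using row_bounds[OF fin[OF I(1)] I(2), of l] I(3) by simp
      obtain x where x: "x \<in> I" "x \<le> l" using surviving_min[OF w I(1) kI] l by auto
      have xI: "x \<in> I \<inter> {1..l}" using x I(1) surviving_iff[OF w] by auto
      \<comment> \<open>If rows are exchanged, \<open>j\<close> is the smallest element of
        \<open>I\<close>, hence at most \<open>x\<close>. If not, \<open>I\<close> has at least two
        elements up to \<open>l\<close>, and \<open>j\<close> is the second smallest.\<close>
      have "j \<le> l"
      proof (cases "card (I \<inter> {1..l}) = 1")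
        case True
        then have "Transposition.transpose 1 2 (rank I j) = 2" using row_twisted[OF kI True] I(3) by simp
        then have r: "rank I j = 1" by (auto simp: Transposition.transpose_def split: if_splits)
        have "\<not> x < j"
          using rank_less[OF fin[OF I(1)] I(2), of x] rank_bounds[OF fin[OF I(1)] x(1)] r by auto
        then show ?thesis using x by simp
      next
        case False
        then have r: "rank I j = 2" using row_untwisted I(3) by metis
        have "card (I \<inter> {1..l}) \<noteq> 0" using xI by (auto simp: card_eq_0_iff)
        then have "\<not> I \<inter> {1..l} \<subseteq> {x}" using False subset_singletonD[of "I \<inter> {1..l}" x] by auto
        then obtain z where "z \<in> I \<inter> {1..l}" "z \<noteq> x" by blast
        then have z: "z \<in> I" "z \<le> l" "z \<noteq> x" by auto
        show ?thesis
        proof (rule ccontr)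
          assume "\<not> j \<le> l"
          then have "{x, z, j} \<subseteq> {y \<in> I. y \<le> j}" "card {x, z, j} = 3" using x z I(2) by auto
          then have "3 \<le> rank I j"
            unfolding rank_def using fin[OF I(1)] card_mono[of "{y \<in> I. y \<le> j}" "{x, z, j}"] by simp
          then show False using r by simp
        qed
      qed
      then show ?thesis using j l by auto
    qed
    then show ?thesis using low_max l by (intro conclude) force+
  qed
qed

section \<open>Quadratic relations\<close>

lemma rank_insert:
  assumes "finite A" "z \<notin> A"
  shows "rank (insert z A) j = rank A j + (if z \<le> j then 1 else 0)"
proof -
  have "{x \<in> insert z A. x \<le> j} = (if z \<le> j then insert z {x \<in> A. x \<le> j} else {x \<in> A. x \<le> j})" by auto
  then show ?thesis using assms by (auto simp: rank_def)
qed

lemma card_Int_insert: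
  assumes "finite A" "z \<notin> A"
  shows "card (insert z A \<inter> B) = card (A \<inter> B) + (if z \<in> B then 1 else 0)"
  using assms by (auto simp: Int_insert_left)

lemma row_cong:
  assumes "rank I j = rank J j" "card (I \<inter> {1..l}) = 1 \<longleftrightarrow> card (J \<inter> {1..l}) = 1"
    and "2 \<le> card I \<longleftrightarrow> 2 \<le> card J"
  shows "row l I j = row l J j"
  using assms by (simp add: row_rank block_matching_def)

text \<open>Adding \<open>x\<close> does not move the entries below \<open>x\<close>. Entries above \<open>x\<close> have rank at
  least \<open>3\<close> because of \<open>a\<close>, so they are never twisted, and replacing \<open>y\<close> by \<open>c\<close> does not move them.\<close>

lemma column_degree_exchange:
  assumes fin: "finite A" and yc: "1 \<le> y" "y < c" "c < x" and notin: "y \<notin> A" "c \<notin> A" "x \<notin> A"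
    and a: "a \<in> A" "1 \<le> a" "a < x"
  shows "column_degree l (insert c A) + column_degree l (insert y (insert x A)) =
         column_degree l (insert y A) + column_degree l (insert c (insert x A))"
proof (rule poly_mapping_eqI)
  fix ij :: "nat \<times> nat"
  obtain i j where ij: "ij = (i, j)" by (cases ij)
  let ?S1 = "insert c A" and ?S2 = "insert y (insert x A)" and ?S3 = "insert y A" and ?S4 = "insert c (insert x A)"
  have "1 \<le> card A" using a fin by (simp add: Suc_le_eq card_gt_0_iff) blast
  then have cards: "2 \<le> card ?S1" "2 \<le> card ?S2" "2 \<le> card ?S3" "2 \<le> card ?S4"
    using fin notin yc by auto
  have rk: "rank ?S1 z = rank A z + (if c \<le> z then 1 else 0)"
    "rank ?S2 z = rank A z + (if x \<le> z then 1 else 0) + (if y \<le> z then 1 else 0)"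
    "rank ?S3 z = rank A z + (if y \<le> z then 1 else 0)"
    "rank ?S4 z = rank A z + (if x \<le> z then 1 else 0) + (if c \<le> z then 1 else 0)" for z
    using fin notin yc by (simp_all add: rank_insert)
  have ci: "card (?S1 \<inter> {1..l}) = card (A \<inter> {1..l}) + (if c \<in> {1..l} then 1 else 0)"
    "card (?S2 \<inter> {1..l}) = card (A \<inter> {1..l}) + (if x \<in> {1..l} then 1 else 0) + (if y \<in> {1..l} then 1 else 0)"
    "card (?S3 \<inter> {1..l}) = card (A \<inter> {1..l}) + (if y \<in> {1..l} then 1 else 0)"
    "card (?S4 \<inter> {1..l}) = card (A \<inter> {1..l}) + (if x \<in> {1..l} then 1 else 0) + (if c \<in> {1..l} then 1 else 0)"
    using fin notin yc card_Int_insert[of A c "{1..l}"] card_Int_insert[of A y "{1..l}"] card_Int_insert[of A x "{1..l}"]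
      card_Int_insert[of "insert x A" y "{1..l}"] card_Int_insert[of "insert x A" c "{1..l}"] by auto
  \<comment> \<open>Adding \<open>x\<close> changes the count of elements up to \<open>l\<close>
    only if \<open>x \<le> l\<close>. Then \<open>a\<close>, \<open>y\<close> and \<open>c\<close>
    are counted too, so the count is at least 2 with or without \<open>x\<close>, and there is no
    exchange either way.\<close>
  have "1 \<le> card (A \<inter> {1..l})" if "x \<le> l"
    using that a fin by (auto simp: Suc_le_eq card_gt_0_iff)
  then have twist: "card (?S1 \<inter> {1..l}) = 1 \<longleftrightarrow> card (?S4 \<inter> {1..l}) = 1"
    "card (?S2 \<inter> {1..l}) = 1 \<longleftrightarrow> card (?S3 \<inter> {1..l}) = 1"
    unfolding ci using yc by auto
  have lower: "row l ?S1 z = row l ?S4 z \<and> row l ?S2 z = row l ?S3 z" if "z < x" for z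
    using that cards twist by (auto intro!: row_cong simp: rk)
  have top: "row l ?S2 x = row l ?S4 x"
  proof -
    have "1 \<le> rank A x" using a fin by (auto simp: rank_def Suc_le_eq card_gt_0_iff)
    then have "rank ?S2 x = rank ?S4 x" "\<not> rank ?S2 x \<le> 2" using yc unfolding rk by auto
    then show ?thesis by (simp add: row_ge_3)
  qed
  have upper: "row l ?S1 z = row l ?S3 z \<and> row l ?S2 z = row l ?S4 z" if "x < z" "z \<in> A" for z
  proof -
    have "rank A a < rank A z" using rank_less[OF fin that(2), of a] a that by simp
    then have "2 \<le> rank A z" using rank_bounds[OF fin a(1)] by simp
    then have "rank ?S1 z = rank ?S3 z" "\<not> rank ?S1 z \<le> 2" "rank ?S2 z = rank ?S4 z" "\<not> rank ?S2 z \<le> 2"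
      using that yc unfolding rk by auto
    then show ?thesis by (simp add: row_ge_3)
  qed
  have mem: "finite ?S1" "finite ?S2" "finite ?S3" "finite ?S4" using fin by auto
  consider "j < x" | "j = x" | "x < j" "j \<in> A" | "j \<notin> ?S1 \<union> ?S2 \<union> ?S3 \<union> ?S4"
    using yc by force
  then show "Poly_Mapping.lookup (column_degree l ?S1 + column_degree l ?S2) ij =
        Poly_Mapping.lookup (column_degree l ?S3 + column_degree l ?S4) ij"
    unfolding ij lookup_add lookup_column_degree[OF mem(1)] lookup_column_degree[OF mem(2)]
      lookup_column_degree[OF mem(3)] lookup_column_degree[OF mem(4)]
  proof cases
    case 1
    then show "(if j \<in> ?S1 \<and> row l ?S1 j = i then 1 else 0) + (if j \<in> ?S2 \<and> row l ?S2 j = i then 1 else 0) =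
      (if j \<in> ?S3 \<and> row l ?S3 j = i then 1 else 0) + (if j \<in> ?S4 \<and> row l ?S4 j = i then 1 else (0::nat))"
      using lower[OF 1] by simp
  next
    case 2
    then show "(if j \<in> ?S1 \<and> row l ?S1 j = i then 1 else 0) + (if j \<in> ?S2 \<and> row l ?S2 j = i then 1 else 0) =
      (if j \<in> ?S3 \<and> row l ?S3 j = i then 1 else 0) + (if j \<in> ?S4 \<and> row l ?S4 j = i then 1 else (0::nat))"
      using top yc notin by simp
  next
    case 3
    then show "(if j \<in> ?S1 \<and> row l ?S1 j = i then 1 else 0) + (if j \<in> ?S2 \<and> row l ?S2 j = i then 1 else 0) =
      (if j \<in> ?S3 \<and> row l ?S3 j = i then 1 else 0) + (if j \<in> ?S4 \<and> row l ?S4 j = i then 1 else (0::nat))"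
      using upper[OF 3] by simp
  next
    case 4
    then show "(if j \<in> ?S1 \<and> row l ?S1 j = i then 1 else 0) + (if j \<in> ?S2 \<and> row l ?S2 j = i then 1 else 0) =
      (if j \<in> ?S3 \<and> row l ?S3 j = i then 1 else 0) + (if j \<in> ?S4 \<and> row l ?S4 j = i then 1 else (0::nat))"
      by auto
  qed
qed

text \<open>\<open>precedes l\<close> is the order \<open>l+1, l+2, \<dots>, 1, \<dots>, l\<close>, with respect to which the first two
  rows of a column are always increasing.\<close>

definition precedes :: "nat \<Rightarrow> nat \<Rightarrow> nat \<Rightarrow> bool" where
  "precedes l p q \<longleftrightarrow> (if p \<le> l \<longleftrightarrow> q \<le> l then p < q else l < p)"

section \<open>Relations among singletons and pairs\<close>

lemma column_degree_singleton: "column_degree l {p} = Poly_Mapping.single (1, p) 1"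
  by (simp add: column_degree_def block_matching_def entry_def)

lemma column_degree_pair:
  assumes "1 \<le> p" "1 \<le> q" "precedes l p q"
  shows "column_degree l {p, q} = Poly_Mapping.single (1, p) 1 + Poly_Mapping.single (2, q) 1"
proof -
  have less: "column_degree l {a, b} = (if a \<le> l \<and> l < b
      then Poly_Mapping.single (2, a) 1 + Poly_Mapping.single (1, b) 1
      else Poly_Mapping.single (1, a) 1 + Poly_Mapping.single (2, b) 1)" if "1 \<le> a" "a < b" for a b
  proof -
    have card: "card {a, b} = 2" using that by simp
    have "sorted_list_of_set {a, b} = [a, b]" using that by simp
    moreover have "card ({a, b} \<inter> {1..l}) = (if a \<le> l then 1 else 0) + (if b \<le> l then 1 else 0)"
      using that by (auto simp: Int_insert_left)
    moreover have "{1..2} = {1, 2 :: nat}" by auto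
    ultimately show ?thesis
      using that by (auto simp: column_degree_def card block_matching_def entry_def Transposition.transpose_def)
  qed
  consider "p < q" | "q < p" using assms by (fastforce simp: precedes_def split: if_splits)
  then show ?thesis
  proof cases
    case 1
    then show ?thesis using less[of p q] assms by (auto simp: precedes_def split: if_splits)
  next
    case 2
    then show ?thesis using less[of q p] assms
      by (auto simp: precedes_def insert_commute add.commute split: if_splits)
  qed
qed

lemma column_degree_pair_exchange:
  assumes "1 \<le> u" "1 \<le> v" "1 \<le> z" "precedes l u z" "precedes l v z"
  shows "column_degree l {u} + column_degree l {v, z} = column_degree l {v} + column_degree l {u, z}"
  using assms by (simp add: column_degree_singleton column_degree_pair algebra_simps)

definition pair_exponent :: "nat set \<Rightarrow> nat set \<Rightarrow> nat set \<Rightarrow>\<^sub>0 nat" where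
  "pair_exponent I J = Poly_Mapping.single I 1 + Poly_Mapping.single J 1"

lemma image_degree_pair_exponent:
  "image_degree l (pair_exponent I J) = column_degree l I + column_degree l J"
  by (simp only: pair_exponent_def image_degree_add image_degree_single)

lemma keys_pair_exponent: "Poly_Mapping.keys (pair_exponent I J) = {I, J}"
  by (auto simp: pair_exponent_def in_keys_iff lookup_add lookup_single when_def split: if_splits)

lemma monomial_of_relation:
  assumes "S1 \<in> surviving_sets m w" "S2 \<in> surviving_sets m w" "S3 \<in> proper_subsets m" "S4 \<in> proper_subsets m"
    and "S3 \<notin> surviving_sets m w \<or> S4 \<notin> surviving_sets m w"
    and "column_degree l S1 + column_degree l S2 = column_degree l S3 + column_degree l S4"
  shows "\<exists>e. (monomial e :: (nat set, 'k::field) mpoly) \<in> restricted_ideal m l w"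
proof
  show "(monomial (pair_exponent S1 S2) :: (nat set, 'k) mpoly) \<in> restricted_ideal m l w"
    by (rule monomial_in_restricted_ideal[where e = "pair_exponent S3 S4"])
       (use assms in \<open>auto simp: keys_pair_exponent image_degree_pair_exponent\<close>)
qed

text \<open>\<open>S1\<close> occurs on one side only, which already makes the two quadratic
  monomials different.\<close>

lemma nonzero_of_relation:
  assumes "S1 \<in> surviving_sets m w" "S2 \<in> surviving_sets m w" "S3 \<in> surviving_sets m w" "S4 \<in> surviving_sets m w"
    and "S1 \<noteq> S3" "S1 \<noteq> S4"
    and "column_degree l S1 + column_degree l S2 = column_degree l S3 + column_degree l S4"
  shows "(restricted_ideal m l w :: (nat set, 'k::field) mpoly set) \<noteq> {0}"
proof (rule restricted_ideal_nonzero[where d = "pair_exponent S1 S2"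
      and e = "pair_exponent S3 S4"])
  show "pair_exponent S1 S2 \<noteq> pair_exponent S3 S4"
    using assms(5,6) keys_pair_exponent[of S1 S2] keys_pair_exponent[of S3 S4] by auto
qed (use assms in \<open>auto simp: keys_pair_exponent image_degree_pair_exponent\<close>)

text \<open>The exchanged sets lie in the union of the old ones and have the sizes of old ones,
  hence fewer than \<open>m\<close> elements.\<close>

lemma exchange_proper:
  assumes "insert c A \<in> proper_subsets m" "insert y (insert x A) \<in> proper_subsets m"
    and "y \<notin> A" "c \<notin> A" "x \<notin> A" "y \<noteq> x" "c \<noteq> x"
  shows "insert y A \<in> proper_subsets m" "insert c (insert x A) \<in> proper_subsets m"
proof -
  have fin: "finite A" using surviving_card(1)[OF assms(1)] by simp
  have "card (insert y A) = card (insert c A)" "card (insert c (insert x A)) = card (insert y (insert x A))"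
    using assms(3-7) fin by auto
  then have "card (insert y A) < m" "card (insert c (insert x A)) < m"
    using surviving_card(3)[OF assms(1)] surviving_card(3)[OF assms(2)] by auto
  then show "insert y A \<in> proper_subsets m" "insert c (insert x A) \<in> proper_subsets m"
    using assms(1,2) by (auto simp: proper_subsets_def)
qed

lemma exchange_monomial:
  assumes "1 \<le> y" "y < c" "c < x" "y \<notin> A" "c \<notin> A" "x \<notin> A" "a \<in> A" "a < x"
    and S: "insert c A \<in> surviving_sets m w" "insert y (insert x A) \<in> surviving_sets m w"
      "insert c (insert x A) \<notin> surviving_sets m w"
  shows "\<exists>e. (monomial e :: (nat set, 'k::field) mpoly) \<in> restricted_ideal m l w"
proof -
  have p: "insert c A \<in> proper_subsets m" "insert y (insert x A) \<in> proper_subsets m"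
    using S surviving_subset by blast+
  have "finite A" "1 \<le> a" using surviving_card(1)[OF p(1)] p(1) assms(7) by (auto simp: proper_subsets_def)
  then show ?thesis
    using monomial_of_relation[OF S(1,2) exchange_proper[OF p] _ column_degree_exchange] assms by auto
qed

lemma exchange_nonzero:
  assumes "1 \<le> y" "y < c" "c < x" "y \<notin> A" "c \<notin> A" "x \<notin> A" "a \<in> A" "a < x"
    and S: "insert c A \<in> surviving_sets m w" "insert y (insert x A) \<in> surviving_sets m w"
      "insert y A \<in> surviving_sets m w" "insert c (insert x A) \<in> surviving_sets m w"
  shows "(restricted_ideal m l w :: (nat set, 'k::field) mpoly set) \<noteq> {0}"
proof -
  have p: "insert c A \<in> proper_subsets m" using S surviving_subset by blast
  have "finite A" "1 \<le> a" using surviving_card(1)[OF p(1)] p(1) assms(7) by (auto simp: proper_subsets_def)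
  moreover have "insert c A \<noteq> insert y A" "insert c A \<noteq> insert c (insert x A)" using assms(1-6) by auto
  ultimately show ?thesis
    using nonzero_of_relation[OF S _ _ column_degree_exchange] assms by auto
qed

lemma surviving_pairs:
  assumes w: "w \<in> perms m"
  shows "1 < m \<Longrightarrow> 1 \<le> u \<Longrightarrow> {u} \<in> surviving_sets m w \<longleftrightarrow> u \<le> w ! 0"
    and "2 < m \<Longrightarrow> 1 \<le> u \<Longrightarrow> u < v \<Longrightarrow>
      {u, v} \<in> surviving_sets m w \<longleftrightarrow> u \<le> min (w ! 0) (w ! 1) \<and> v \<le> max (w ! 0) (w ! 1)"
proof -
  assume m: "1 < m" and u: "1 \<le> u"
  note w12 = perms_first_two[OF w]
  have p1: "prefix_set w 1 = {w ! 0}" using w12 m by simp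
  have "{u} \<noteq> {1..m}" using m by (metis card_atLeastAtMost diff_Suc_1 is_singletonI is_singleton_altdef less_irrefl)
  then have "u \<in> {1..m} \<Longrightarrow> {u} \<subset> {1..m}" by auto
  moreover have "(\<forall>c. below {w ! 0} c \<le> below {u} c) \<longleftrightarrow> u \<le> w ! 0"
    using spec[of "\<lambda>c. below {w ! 0} c \<le> below {u} c" "w ! 0 + 1"] by (auto simp: below_insert below_def[of "{}"])
  moreover have "w ! 0 \<le> m" using w12 m by simp
  ultimately show "{u} \<in> surviving_sets m w \<longleftrightarrow> u \<le> w ! 0"
    unfolding surviving_iff[OF w] using p1 u by auto
next
  assume m: "2 < m" and u: "1 \<le> u" "u < v"
  note w12 = perms_first_two[OF w]
  have p2: "prefix_set w 2 = {w ! 0, w ! 1}" "w ! 0 \<noteq> w ! 1" "w ! 0 \<le> m" "w ! 1 \<le> m" using w12 m by auto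
  have card: "card {u, v} = 2" using u by simp
  have proper: "{u, v} \<subset> {1..m}" if "v \<le> m"
  proof -
    have "card {u, v} < card {1..m}" using card m by simp
    then have "{u, v} \<noteq> {1..m}" by (metis less_irrefl)
    then show ?thesis using that u by auto
  qed
  have b2: "below {a, b} c = (if a < c then 1 else 0) + (if b < c then 1 else 0)" if "a \<noteq> b" for a b c
    using that by (simp add: below_insert below_def[of "{}"])
  have "(\<forall>c. below {w ! 0, w ! 1} c \<le> below {u, v} c) \<longleftrightarrow> u \<le> min (w ! 0) (w ! 1) \<and> v \<le> max (w ! 0) (w ! 1)"
  proof
    assume all: "\<forall>c. below {w ! 0, w ! 1} c \<le> below {u, v} c"
    show "u \<le> min (w ! 0) (w ! 1) \<and> v \<le> max (w ! 0) (w ! 1)"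
      using all[THEN spec, of "min (w ! 0) (w ! 1) + 1"] all[THEN spec, of "max (w ! 0) (w ! 1) + 1"] p2(2) u
      by (auto simp: b2 min_def max_def split: if_splits)
  next
    assume "u \<le> min (w ! 0) (w ! 1) \<and> v \<le> max (w ! 0) (w ! 1)"
    then show "\<forall>c. below {w ! 0, w ! 1} c \<le> below {u, v} c"
      using p2(2) u by (auto simp: b2 min_def max_def split: if_splits)
  qed
  moreover have "max (w ! 0) (w ! 1) \<le> m" using p2 by simp
  ultimately show "{u, v} \<in> surviving_sets m w \<longleftrightarrow> u \<le> min (w ! 0) (w ! 1) \<and> v \<le> max (w ! 0) (w ! 1)"
    unfolding surviving_iff[OF w] card p2(1) using proper le_trans by blast
qed

section \<open>Permutations with monomials\<close>

lemma prefix_set_surviving: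
  assumes w: "w \<in> perms m" and k: "1 \<le> k" "k < m"
  shows "prefix_set w k \<in> surviving_sets m w"
proof -
  have c: "card (prefix_set w k) = k" using card_prefix_set[OF w, of k] k by simp
  then have "prefix_set w k \<noteq> {}" "prefix_set w k \<noteq> {1..m}" using k by (metis card.empty not_one_le_zero, metis card_atLeastAtMost diff_Suc_1 less_irrefl)
  then show ?thesis using prefix_set_subset[OF w, of k] by (auto simp: surviving_iff[OF w] c)
qed

text \<open>Survival is an upper bound in the order on sets of equal size, so it passes to smaller
  sets.\<close>

lemma surviving_lower:
  assumes w: "w \<in> perms m" and I: "I \<in> surviving_sets m w" and J: "J \<subseteq> {1..m}" "card J = card I"
    and le: "\<And>c. below I c \<le> below J c"
  shows "J \<in> surviving_sets m w"
proof -
  have p: "I \<in> proper_subsets m" using I surviving_subset by blast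
  have "J \<noteq> {}" "J \<noteq> {1..m}"
    using J surviving_card[OF p] by (auto dest!: sym[of "card J"])
  moreover have "below (prefix_set w (card J)) c \<le> below J c" for c
    using I le[of c] J(2) unfolding surviving_iff[OF w] by (metis le_trans)
  ultimately show ?thesis using J by (auto simp: surviving_iff[OF w])
qed

lemma surviving_replace:
  assumes w: "w \<in> perms m" and I: "insert x A \<in> surviving_sets m w" and A: "x \<notin> A" "c \<notin> A" "1 \<le> c" "c \<le> x"
  shows "insert c A \<in> surviving_sets m w"
proof (rule surviving_lower[OF w I])
  have p: "insert x A \<in> proper_subsets m" using I surviving_subset by blast
  have fin: "finite A" using surviving_card(1)[OF p] by simp
  show "insert c A \<subseteq> {1..m}" using p A by (auto simp: proper_subsets_def)
  show "card (insert c A) = card (insert x A)" using fin A by simp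
  show "below (insert x A) d \<le> below (insert c A) d" for d
    using fin A by (simp add: below_insert)
qed

text \<open>A prefix survives, but replacing one of its elements below \<open>c\<close> by
  \<open>c\<close> leaves too few elements below \<open>c\<close>. The exchange also needs a common
  element below the largest moved value; \<open>2 \<le> p\<close>, the third position or later,
  leaves room for it.\<close>

lemma incompatible_monomial_late:
  assumes w: "w \<in> perms m" and p: "2 \<le> p" "p < m" and pattern: "middle_of_312 w (w ! p)"
  shows "\<exists>e. (monomial e :: (nat set, 'k::field) mpoly) \<in> restricted_ideal m l w"
proof -
  define y where "y = w ! p"
  define A where "A = prefix_set w p"
  obtain x c where xc: "y < c" "c < x" "x \<in> A" "c \<in> {1..m}" "c \<notin> prefix_set w (Suc p)"
    using pattern unfolding middle_of_312_nth[OF w p(2)] y_def A_def by auto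
  have B: "prefix_set w (Suc p) = insert y A" using prefix_set_Suc[OF w p(2)] by (simp add: y_def A_def)
  have yA: "y \<notin> A" using nth_notin_prefix_set[OF w p(2)] by (simp add: y_def A_def)
  have y1: "1 \<le> y" using perms_nth[OF w p(2)] by (simp add: y_def)
  have finA: "finite A" by (simp add: A_def)
  have cA: "c \<notin> A" using xc B by auto
  have cardA: "card A = p" using card_prefix_set[OF w, of p] p by (simp add: A_def)
  have "Suc p < m"
  proof -
    have "insert y A \<subset> {1..m}" using xc B prefix_set_subset[OF w, of "Suc p"] by auto
    then have "card (insert y A) < m" using psubset_card_mono[of "{1..m}" "insert y A"] by simp
    then show ?thesis using yA finA cardA by simp
  qed
  then have SA: "A \<in> surviving_sets m w" and SB: "insert y A \<in> surviving_sets m w"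
    using prefix_set_surviving[OF w, of p] prefix_set_surviving[OF w, of "Suc p"] p B A_def by auto
  have notin: "S \<notin> surviving_sets m w" if "card S = Suc p" "below S c < below (insert y A) c" for S
    using that B unfolding surviving_iff[OF w] by (metis linorder_not_le)
  show ?thesis
  proof (cases "\<exists>a\<in>A. a < c")
    case True
    then obtain a where a: "a \<in> A" "a < c" by blast
    \<comment> \<open>The smaller of \<open>a\<close> and \<open>y\<close> stays in the common part
      and the larger is exchanged with \<open>c\<close>. The first set of the relation arises from
      \<open>A\<close> by lowering \<open>x\<close> to \<open>c\<close> and \<open>a\<close> to
      \<open>lo\<close>.\<close>
    define lo where "lo = min a y"
    define hi where "hi = max a y"
    define B0 where "B0 = A - {x, a}"
    have ay: "a \<noteq> y" "a \<noteq> x" using a yA xc by auto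
    have a1: "1 \<le> a" using a prefix_set_subset[OF w, of p] by (auto simp: A_def)
    have lohi: "lo < hi" "hi < c" "lo \<le> a" "1 \<le> lo" using ay a y1 xc a1 by (auto simp: lo_def hi_def)
    have lohi_set: "{lo, hi} = {a, y}" by (auto simp: lo_def hi_def min_def max_def)
    then have nB0: "lo \<notin> B0" "hi \<notin> B0" "c \<notin> B0" "x \<notin> B0" "finite B0" "a \<notin> B0" "y \<notin> B0"
      using yA cA finA by (auto simp: B0_def)
    have A_eq: "insert x (insert a B0) = A" using a xc by (auto simp: B0_def)
    have eq: "insert hi (insert x (insert lo B0)) = insert y A"
    proof -
      have "insert hi (insert x (insert lo B0)) = insert x ({lo, hi} \<union> B0)" by auto
      then show ?thesis unfolding lohi_set using A_eq by auto
    qed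
    have S1: "insert c (insert lo B0) \<in> surviving_sets m w"
    proof -
      have "insert c (insert a B0) \<in> surviving_sets m w"
        by (rule surviving_replace[OF w, of x]) (use A_eq SA nB0 xc ay a in auto)
      then have "insert a (insert c B0) \<in> surviving_sets m w" by (simp add: insert_commute)
      then have "insert lo (insert c B0) \<in> surviving_sets m w"
        by (rule surviving_replace[OF w]) (use nB0 lohi xc a in auto)
      then show ?thesis by (simp add: insert_commute)
    qed
    have S4: "insert c (insert x (insert lo B0)) \<notin> surviving_sets m w"
    proof (rule notin)
      have d: "c \<notin> insert x (insert lo B0)" "x \<notin> insert lo B0" "hi \<notin> insert x (insert lo B0)"
        using nB0 lohi xc by auto
      show "card (insert c (insert x (insert lo B0))) = Suc p"
      proof -
        have "card (insert c (insert x (insert lo B0))) = card (insert hi (insert x (insert lo B0)))"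
          using d nB0 by simp
        then show ?thesis unfolding eq using yA finA cardA by simp
      qed
      show "below (insert c (insert x (insert lo B0))) c < below (insert y A) c"
        unfolding eq[symmetric] using d nB0 lohi by (simp add: below_insert)
    qed
    show ?thesis
      by (rule exchange_monomial[of hi c x "insert lo B0" lo]) (use lohi xc nB0 S1 S4 SB eq ay in auto)
  next
    case False
    \<comment> \<open>Here \<open>A\<close> lies above \<open>c\<close>, so \<open>y\<close> is the
      only element of the next prefix below \<open>c\<close>. The maximum of \<open>A\<close> takes
      the role of \<open>x\<close>, and any other element of \<open>A\<close> serves as the common
      one.\<close>
    define M where "M = Max A"
    have "A \<noteq> {}" using xc by auto
    then have M: "M \<in> A" "\<And>a. a \<in> A \<Longrightarrow> a \<le> M" using finA by (auto simp: M_def)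
    have cM: "c < M" using xc M(2)[of x] by simp
    define B0 where "B0 = A - {M}"
    have A_eq: "insert M B0 = A" using M by (auto simp: B0_def)
    have "card B0 \<noteq> 0" using cardA p M finA by (simp add: B0_def)
    then obtain a where a: "a \<in> B0" by (metis card.empty ex_in_conv)
    have aM: "a < M" using a M(2)[of a] by (auto simp: B0_def)
    have nB0: "M \<notin> B0" "c \<notin> B0" "y \<notin> B0" "finite B0" using cA yA finA by (auto simp: B0_def)
    have S1: "insert c B0 \<in> surviving_sets m w"
      by (rule surviving_replace[OF w, of M]) (use A_eq SA nB0 cM xc in auto)
    have S4: "insert c (insert M B0) \<notin> surviving_sets m w"
    proof (rule notin)
      show "card (insert c (insert M B0)) = Suc p" unfolding A_eq using cA finA cardA by simp
      have "below A c = 0" using False by (auto simp: below_def)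
      then show "below (insert c (insert M B0)) c < below (insert y A) c"
        unfolding A_eq using cA yA finA xc by (simp add: below_insert)
    qed
    show ?thesis
      by (rule exchange_monomial[of y c M B0 a]) (use y1 xc cM nB0 a aM S1 S4 SB A_eq in auto)
  qed
qed

text \<open>The case \<open>u = v\<close> is included, so singletons are covered as well.\<close>

lemma pair_proper: "u \<in> {1..m} \<Longrightarrow> v \<in> {1..m} \<Longrightarrow> 2 < m \<Longrightarrow> {u, v} \<in> proper_subsets m"
proof -
  assume a: "u \<in> {1..m}" "v \<in> {1..m}" "2 < m"
  have "card {u, v} \<le> 2" by (simp add: card_insert_le_m1)
  then have "card {u, v} \<noteq> card {1..m}" using a by simp
  then have "{u, v} \<noteq> {1..m}" by metis
  then show ?thesis using a by (auto simp: proper_subsets_def)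
qed

text \<open>Once no pattern has its 1 at the third position or later, the failure lies in the first
  two values. Then either the singleton of \<open>w ! 1\<close> or the pair of \<open>w ! 0\<close>
  and \<open>w ! 1 + 1\<close> vanishes, and it occurs in a pair relation whose other side
  survives.\<close>

lemma incompatible_monomial:
  assumes w: "w \<in> perms m" and m: "2 \<le> m" and l: "1 \<le> l" and comp: "\<not> block_compatible l w"
  shows "\<exists>e. (monomial e :: (nat set, 'k::field) mpoly) \<in> restricted_ideal m l w"
proof (cases "\<exists>p. 2 \<le> p \<and> p < m \<and> middle_of_312 w (w ! p)")
  case True
  then show ?thesis using incompatible_monomial_late[OF w] by blast
next
  case False
  note w12 = perms_first_two[OF w m]
  have "y = w ! 1" if y: "middle_of_312 w y" for y
  proof -
    obtain p where p: "p < m" "w ! p = y"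
      using y before_in_perms[OF w] perms_obtain[OF w] unfolding middle_of_312_def by metis
    have "p \<noteq> 0" using y middle_of_312_nth[OF w p(1)] p by (intro notI) simp
    then show ?thesis using False p y by (cases "p = 1") auto
  qed
  then have neg: "w ! 0 \<noteq> 1" "w ! 0 \<noteq> w ! 1 + 1" "w ! 0 < w ! 1 \<Longrightarrow> l < w ! 1" "w ! 1 \<noteq> l"
    using comp by (auto simp: block_compatible_def)
  show ?thesis
  proof (cases "w ! 0 < w ! 1")
    case True
    define a where "a = w ! 0"
    define b where "b = w ! 1"
    have ab: "1 < a" "a < b" "b \<le> m" "l < b" using True neg w12 by (auto simp: a_def b_def)
    have m3: "1 < m" "2 < m" using ab by auto
    note sp = surviving_pairs(1)[OF w m3(1)] surviving_pairs(2)[OF w m3(2)]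
    have surv: "{1} \<in> surviving_sets m w" "{a} \<in> surviving_sets m w" "{b} \<notin> surviving_sets m w"
      "{1, a} \<in> surviving_sets m w" "{1, b} \<in> surviving_sets m w" "{a, b} \<in> surviving_sets m w"
      using ab sp by (auto simp: a_def b_def)
    have proper: "{b} \<in> proper_subsets m" using ab m3 pair_proper[of b m b] by auto
    show ?thesis
    \<comment> \<open>The common row 2 entry has to come last in the order \<open>precedes\<close>:
      among 1, \<open>a\<close> and \<open>b\<close> this is \<open>a\<close> if
      \<open>a \<le> l\<close>, and 1 otherwise.\<close>
    proof (cases "a \<le> l")
      case True
      have "column_degree l {1} + column_degree l {b, a} = column_degree l {b} + column_degree l {1, a}"
        by (rule column_degree_pair_exchange) (use True ab l in \<open>auto simp: precedes_def\<close>)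
      then show ?thesis
        using surv proper surviving_subset
        by (intro monomial_of_relation[of "{1}" m w "{b, a}" "{b}" "{1, a}" l]) (auto simp: insert_commute)
    next
      case False
      have "column_degree l {a} + column_degree l {b, 1} = column_degree l {b} + column_degree l {a, 1}"
        by (rule column_degree_pair_exchange) (use False ab l in \<open>auto simp: precedes_def\<close>)
      then show ?thesis
        using surv proper surviving_subset
        by (intro monomial_of_relation[of "{a}" m w "{b, 1}" "{b}" "{a, 1}" l]) (auto simp: insert_commute)
    qed
  next
    case False
    define a where "a = w ! 0"
    define y where "y = w ! 1"
    \<comment> \<open>As \<open>y \<noteq> l\<close>, the successor \<open>c\<close> lies on the
      same side of \<open>l\<close> as \<open>y\<close>; it is below \<open>a\<close> because the
      first value exceeds the second by at least 2.\<close>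
    define c where "c = y + 1"
    have ay: "1 \<le> y" "y < c" "c < a" "a \<le> m" "y \<noteq> l" using False neg w12 by (auto simp: a_def y_def c_def)
    have m3: "1 < m" "2 < m" using ay by auto
    note sp = surviving_pairs(1)[OF w m3(1)] surviving_pairs(2)[OF w m3(2)]
    have surv: "{a} \<in> surviving_sets m w" "{c} \<in> surviving_sets m w"
      "{y, c} \<in> surviving_sets m w" "{y, a} \<in> surviving_sets m w" "{c, a} \<notin> surviving_sets m w"
      using ay sp by (auto simp: a_def y_def)
    have proper: "{y} \<in> proper_subsets m" "{c, a} \<in> proper_subsets m"
      using ay m3 pair_proper[of y m y] pair_proper[of c m a] by auto
    show ?thesis
    proof (cases "y \<le> l \<and> l < a")
      case True
      have "column_degree l {a} + column_degree l {y, c} = column_degree l {y} + column_degree l {a, c}"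
        by (rule column_degree_pair_exchange) (use True ay c_def in \<open>auto simp: precedes_def\<close>)
      then show ?thesis
        using surv proper
        by (intro monomial_of_relation[of "{a}" m w "{y, c}" "{y}" "{a, c}" l]) (auto simp: insert_commute)
    next
      case False
      have "column_degree l {c} + column_degree l {y, a} = column_degree l {y} + column_degree l {c, a}"
        by (rule column_degree_pair_exchange) (use False ay in \<open>auto simp: precedes_def\<close>)
      then show ?thesis
        using surv proper
        by (intro monomial_of_relation[of "{c}" m w "{y, a}" "{y}" "{c, a}" l]) (auto simp: insert_commute)
    qed
  qed
qed

section \<open>Vanishing of the restricted ideal\<close>

text \<open>Since the prefix ends in \<open>c\<close> or \<open>x\<close>, removing \<open>x\<close>
  gives the previous prefix or a set below it. So all four sets of the exchange are prefixes or
  lowered prefixes, and they survive.\<close>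

lemma inversions_nonzero:
  assumes w: "w \<in> perms m" and p: "2 \<le> p" "p < m" and cx: "c < x" "{c, x} \<subseteq> prefix_set w p"
    "w ! (p - 1) \<in> {c, x}" and y: "1 \<le> y" "y < c" "y \<notin> prefix_set w p"
    and a: "a \<in> prefix_set w p - {c, x}" "a < x"
  shows "(restricted_ideal m l w :: (nat set, 'k::field) mpoly set) \<noteq> {0}"
proof -
  define A where "A = prefix_set w p - {c, x}"
  have n: "c \<notin> A" "x \<notin> A" "y \<notin> A" using y by (auto simp: A_def)
  have S4: "insert c (insert x A) \<in> surviving_sets m w"
  proof -
    have "insert c (insert x A) = prefix_set w p" using cx by (auto simp: A_def)
    then show ?thesis using prefix_set_surviving[OF w, of p] p by simp
  qed
  have S2: "insert y (insert x A) \<in> surviving_sets m w"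
    by (rule surviving_replace[OF w S4]) (use n cx y in auto)
  have pre: "prefix_set w (p - 1) = prefix_set w p - {w ! (p - 1)}"
    using prefix_set_Suc[OF w, of "p - 1"] nth_notin_prefix_set[OF w, of "p - 1"] p by simp
  have S1: "insert c A \<in> surviving_sets m w"
  proof (cases "w ! (p - 1) = x")
    case True
    then have "insert c A = prefix_set w (p - 1)" using cx pre by (auto simp: A_def)
    then show ?thesis using prefix_set_surviving[OF w, of "p - 1"] p by simp
  next
    case False
    then have "insert x A = prefix_set w (p - 1)" using cx pre by (auto simp: A_def)
    then have "insert x A \<in> surviving_sets m w" using prefix_set_surviving[OF w, of "p - 1"] p by simp
    then show ?thesis by (rule surviving_replace[OF w]) (use n cx y in auto)
  qed
  have S3: "insert y A \<in> surviving_sets m w"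
    by (rule surviving_replace[OF w S1]) (use n y in auto)
  show ?thesis
    by (rule exchange_nonzero[OF y(1,2) cx(1) n(3,1,2) _ a(2) S1 S2 S3 S4]) (use a in \<open>simp add: A_def\<close>)
qed

lemma compatible_nonzero:
  assumes w: "w \<in> perms m" and m: "2 \<le> m" and comp: "block_compatible l w" and swaps: "\<not> adjacent_swaps w"
  shows "(restricted_ideal m l w :: (nat set, 'k::field) mpoly set) \<noteq> {0}"
proof (cases "\<exists>y. middle_of_312 w y")
  case True
  note w12 = perms_first_two[OF w m]
  define a where "a = w ! 0"
  define y where "y = w ! 1"
  have "middle_of_312 w (w ! 1)" using True comp by (auto simp: block_compatible_def)
  then obtain c where c: "y < c" "c < a" "c \<in> {1..m}"
    using middle_of_312_nth[OF w, of 1] m w12(1) by (auto simp: a_def y_def)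
  \<comment> \<open>A value strictly between the second and the first rules out every alternative
    but the last.\<close>
  then have y: "y = l" using comp by (auto simp: block_compatible_def a_def y_def)
  have b: "1 \<le> y" "a \<le> m" using w12 by (auto simp: a_def y_def)
  then have m3: "1 < m" "2 < m" using c by auto
  note sp = surviving_pairs(1)[OF w m3(1)] surviving_pairs(2)[OF w m3(2)]
  have surv: "{c} \<in> surviving_sets m w" "{a} \<in> surviving_sets m w"
    "{y, a} \<in> surviving_sets m w" "{y, c} \<in> surviving_sets m w"
    using c b sp by (auto simp: a_def y_def)
  have "column_degree l {c} + column_degree l {a, y} = column_degree l {a} + column_degree l {c, y}"
    by (rule column_degree_pair_exchange) (use c b y in \<open>auto simp: precedes_def\<close>)
  then show ?thesis
    using surv c by (intro nonzero_of_relation[of "{c}" m w "{a, y}" "{a}" "{c, y}" l])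
      (auto simp: insert_commute)
next
  case False
  then obtain y u v where yuv: "y < u" "u < v" "before w u y" "before w v y"
    using swaps by (auto simp: adjacent_swaps_def)
  have y1: "1 \<le> y" using before_in_perms[OF w yuv(3)] by simp
  obtain q where q: "q < m" "w ! q = y" using perms_obtain[OF w] before_in_perms[OF w yuv(3)] by metis
  obtain i where i: "i < m" "w ! i = u" using perms_obtain[OF w] before_in_perms[OF w yuv(3)] by metis
  obtain j where j: "j < m" "w ! j = v" using perms_obtain[OF w] before_in_perms[OF w yuv(4)] by metis
  have ij: "i < q" "j < q" using before_nth[OF w] yuv(3,4) q i j by metis+
  have "i \<noteq> j" using i j yuv by auto
  \<comment> \<open>This is the shortest prefix containing \<open>u\<close> and \<open>v\<close>, so
    it ends in one of them.\<close>
  define p where "p = Suc (max i j)"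
  have p: "2 \<le> p" "p < m" using ij q \<open>i \<noteq> j\<close> by (auto simp: p_def)
  have uv: "{u, v} \<subseteq> prefix_set w p" using nth_in_prefix_set[OF w, of _ p] i j by (auto simp: p_def)
  have t: "w ! (p - 1) \<in> {u, v}" using i j by (auto simp: p_def max_def)
  have yp: "y \<notin> prefix_set w p" using nth_in_prefix_set[OF w q(1), of p] q ij by (auto simp: p_def)
  have cp: "card (prefix_set w p) = p" using card_prefix_set[OF w, of p] p by simp
  show ?thesis
  proof (cases "p = 2")
    case False
    then have "card (prefix_set w p - {u, v}) \<noteq> 0" using cp uv p yuv by (subst card_Diff_subset) auto
    then obtain b where b: "b \<in> prefix_set w p - {u, v}" by (metis card.empty ex_in_conv)
    show ?thesis
    proof (cases "b < v")
      case True
      show ?thesis by (rule inversions_nonzero[OF w p yuv(2) uv t y1 yuv(1) yp b True])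
    next
      case False
      then have vb: "v < b" using b by (metis DiffE insertCI linorder_neqE_nat)
      show ?thesis
      \<comment> \<open>Now \<open>b\<close> is the largest of the three. It is moved together with
        the last value of the prefix, and the other one of \<open>u\<close> and \<open>v\<close> is
        the common element.\<close>
      proof (cases "w ! (p - 1) = u")
        case True
        show ?thesis
          by (rule inversions_nonzero[OF w p, of u b y v]) (use True vb b uv yuv yp y1 in auto)
      next
        case False
        show ?thesis
          by (rule inversions_nonzero[OF w p, of v b y u]) (use False t vb b uv yuv yp y1 in auto)
      qed
    qed
  next
    case True
    note w12 = perms_first_two[OF w m]
    have "{u, v} = prefix_set w 2"
      using uv cp True yuv by (intro card_subset_eq) auto
    then have uv01: "{u, v} = {w ! 0, w ! 1}" using w12 by simp
    have b: "u \<le> m" "v \<le> m" using before_in_perms[OF w yuv(3)] before_in_perms[OF w yuv(4)] by auto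
    then have m3: "1 < m" "2 < m" using yuv y1 by auto
    note sp = surviving_pairs(1)[OF w m3(1)] surviving_pairs(2)[OF w m3(2)]
    have mm: "min (w ! 0) (w ! 1) = u" "max (w ! 0) (w ! 1) = v"
      using uv01 yuv(2) by (auto simp: doubleton_eq_iff)
    have surv: "{y} \<in> surviving_sets m w" "{u} \<in> surviving_sets m w"
      "{y, u} \<in> surviving_sets m w" "{y, v} \<in> surviving_sets m w" "{u, v} \<in> surviving_sets m w"
      using yuv y1 sp mm by auto
    show ?thesis
    proof (cases "precedes l y v \<and> precedes l u v")
      case True
      have "column_degree l {y} + column_degree l {u, v} = column_degree l {u} + column_degree l {y, v}"
        by (rule column_degree_pair_exchange) (use True yuv y1 in auto)
      then show ?thesis
        using surv yuv by (intro nonzero_of_relation[of "{y}" m w "{u, v}" "{u}" "{y, v}" l]) auto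
    next
      case False
      \<comment> \<open>With \<open>y\<close> and \<open>v\<close> on different sides of
        \<open>l\<close>, compatibility forces \<open>v\<close> to be the first value, so that also
        \<open>{v}\<close> survives.\<close>
      then have lv: "y \<le> l" "l < v" using yuv by (auto simp: precedes_def split: if_splits)
      have vu: "w ! 0 = v" "w ! 1 = u \<or> w ! 1 = v"
      proof -
        have "\<not> (w ! 0 = u \<and> w ! 1 = v)" using comp lv yuv y1 by (auto simp: block_compatible_def)
        then show "w ! 0 = v" "w ! 1 = u \<or> w ! 1 = v" using uv01 by (auto simp: doubleton_eq_iff)
      qed
      then have sv: "{v} \<in> surviving_sets m w" using sp yuv y1 by auto
      show ?thesis
      proof (cases "u \<le> l")
        case True
        have "column_degree l {v} + column_degree l {y, u} = column_degree l {y} + column_degree l {v, u}"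
          by (rule column_degree_pair_exchange) (use True yuv y1 lv in \<open>auto simp: precedes_def\<close>)
        then show ?thesis
          using surv sv yuv by (intro nonzero_of_relation[of "{v}" m w "{y, u}" "{y}" "{v, u}" l])
            (auto simp: insert_commute)
      next
        case False
        have "column_degree l {u} + column_degree l {v, y} = column_degree l {v} + column_degree l {u, y}"
          by (rule column_degree_pair_exchange) (use False yuv y1 lv in \<open>auto simp: precedes_def\<close>)
        then show ?thesis
          using surv sv yuv by (intro nonzero_of_relation[of "{u}" m w "{v, y}" "{v}" "{u, y}" l])
            (auto simp: insert_commute)
      qed
    qed
  qed
qed

text \<open>Values missing below the maximum \<open>M\<close> of the prefix come after all of it.
  Two of them would give either a 312 pattern with \<open>M\<close> or two larger values before the
  smaller one; a single one must be \<open>M - 1\<close>, as otherwise \<open>M - 1\<close> and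
  \<open>M\<close> both precede it.\<close>

lemma adjacent_swaps_prefix_set:
  assumes w: "w \<in> perms m" and swaps: "adjacent_swaps w" and k: "1 \<le> k" "k \<le> m"
  shows "prefix_set w k = {1..k} \<or> prefix_set w k = insert (k + 1) {1..k - 1}"
proof -
  define P where "P = prefix_set w k"
  have card: "card P = k" using card_prefix_set[OF w k(2)] by (simp add: P_def)
  have P: "P \<subseteq> {1..m}" "finite P" "P \<noteq> {}" using prefix_set_subset[OF w] card k by (auto simp: P_def)
  define M where "M = Max P"
  have M: "M \<in> P" "\<And>x. x \<in> P \<Longrightarrow> x \<le> M" using P by (auto simp: M_def)
  have bef: "before w x y" if "x \<in> P" "y \<in> {1..M} - P" for x y
  proof -
    have "y \<in> {1..m}" using that(2) M(1) P by auto
    then obtain j where j: "j < m" "w ! j = y" using perms_obtain[OF w] by metis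
    then have "k \<le> j" using that(2) nth_in_prefix_set[OF w j(1), of k] by (auto simp: P_def)
    then have "prefix_set w k \<subseteq> prefix_set w j" by (rule set_take_subset_set_take)
    then show ?thesis using before_nth_right[OF w j(1), of x] that(1) j by (auto simp: P_def)
  qed
  have nomid: "\<not> middle_of_312 w y" and noinv: "\<not> (y < u \<and> u < v \<and> before w u y \<and> before w v y)" for y u v
    using swaps by (auto simp: adjacent_swaps_def)
  show ?thesis
  proof (cases "{1..M} \<subseteq> P")
    case True
    then have "P = {1..M}" using M P by force
    then show ?thesis using card by (auto simp: P_def)
  next
    case False
    then obtain y where y: "y \<in> {1..M} - P" by blast
    then have yM: "y < M" using M by (metis DiffE atLeastAtMost_iff le_neq_implies_less)
    have uniq: "z = y" if z: "z \<in> {1..M} - P" for z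
    proof (rule ccontr)
      assume "z \<noteq> y"
      define y1 where "y1 = min y z"
      define y2 where "y2 = max y z"
      have y12: "y1 < y2" "y1 \<in> {1..M} - P" "y2 \<in> {1..M} - P"
        using \<open>z \<noteq> y\<close> y z by (auto simp: y1_def y2_def min_def max_def)
      then have "y2 < M" using M by (metis DiffE atLeastAtMost_iff le_neq_implies_less)
      have "y1 \<in> {1..m}" "y2 \<in> {1..m}" using y12 M(1) P by auto
      then obtain i j where "i < m" "w ! i = y1" "j < m" "w ! j = y2" using perms_obtain[OF w] by metis
      then have "before w y1 y2 \<or> before w y2 y1"
        using before_nth[OF w] y12(1) by (metis less_irrefl linorder_neqE_nat)
      then show False
        using nomid[of y1] noinv[of y1 y2 M] bef[OF M(1) y12(2)] y12(1) \<open>y2 < M\<close>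
        unfolding middle_of_312_def by blast
    qed
    have "y = M - 1"
    proof (rule ccontr)
      assume "y \<noteq> M - 1"
      then have lt: "y < M - 1" "M - 1 < M" using yM by auto
      then have "M - 1 \<in> P" using uniq[of "M - 1"] by force
      then show False using noinv[of y "M - 1" M] bef[OF _ y] M(1) lt by blast
    qed
    have P_eq: "P = insert M {1..M - 2}"
    proof (intro set_eqI iffI)
      fix x assume x: "x \<in> P"
      then have "1 \<le> x" "x \<le> M" "x \<noteq> M - 1" using M P y \<open>y = M - 1\<close> by auto
      then show "x \<in> insert M {1..M - 2}" by auto
    next
      fix x assume x: "x \<in> insert M {1..M - 2}"
      show "x \<in> P"
      proof (rule ccontr)
        assume "x \<notin> P"
        then have "x \<in> {1..M} - P" "x \<noteq> M - 1" using x M yM by auto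
        then show False using uniq \<open>y = M - 1\<close> by blast
      qed
    qed
    moreover have "2 \<le> M" using yM y by auto
    moreover have "card (insert M {1..M - 2}) = M - 1" using \<open>2 \<le> M\<close> by simp
    ultimately have "k + 1 = M" "k - 1 = M - 2" using card unfolding P_eq by auto
    then have "P = insert (k + 1) {1..k - 1}" unfolding P_eq by simp
    then show ?thesis unfolding P_def ..
  qed
qed

text \<open>Among sets of size k, only {1,...,k} and {1,...,k-1,k+1} lie below the latter, so the
  two kinds of prefix leave no other choice.\<close>

lemma adjacent_swaps_surviving:
  assumes w: "w \<in> perms m" and swaps: "adjacent_swaps w" and J: "J \<in> surviving_sets m w"
  shows "J = {1..card J} \<or> (J = insert (card J + 1) {1..card J - 1} \<and> prefix_set w (card J) = J)"
proof -
  have p: "J \<in> proper_subsets m" using J surviving_subset by blast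
  note c = surviving_card[OF p]
  let ?k = "card J"
  have le: "below (prefix_set w ?k) d \<le> below J d" for d using J surviving_iff[OF w] by blast
  have sub: "J \<subseteq> {1..N}" if "below (prefix_set w ?k) (N + 1) = ?k" for N
  proof -
    have "?k \<le> card {x \<in> J. x < N + 1}" using le[of "N + 1"] that by (simp add: below_def)
    with c(1) have "{x \<in> J. x < N + 1} = J" by (intro card_seteq Collect_subset) simp_all
    then have "\<forall>x\<in>J. x < N + 1" by blast
    moreover have "J \<subseteq> {1..m}" using p by (auto simp: proper_subsets_def)
    ultimately show ?thesis by (auto simp: less_Suc_eq_le)
  qed
  consider "prefix_set w ?k = {1..?k}" | "prefix_set w ?k = insert (?k + 1) {1..?k - 1}"
    using adjacent_swaps_prefix_set[OF w swaps, of ?k] c by fastforce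
  then show ?thesis
  proof cases
    case 1
    have "{a \<in> {1..?k}. a < ?k + 1} = {1..?k}" by auto
    then have "J \<subseteq> {1..?k}" using 1 by (intro sub) (simp add: below_def)
    then show ?thesis using card_subset_eq[of "{1..?k}" J] by simp
  next
    case 2
    have "{a \<in> insert (?k + 1) {1..?k - 1}. a < ?k + 1 + 1} = insert (?k + 1) {1..?k - 1}" using c by auto
    then have J1: "J \<subseteq> {1..?k + 1}" using 2 c by (intro sub) (simp add: below_def)
    have "{a \<in> insert (?k + 1) {1..?k - 1}. a < ?k} = {1..?k - 1}" using c by auto
    then have "?k - 1 \<le> card {x \<in> J. x < ?k}" using le[of ?k] 2 by (simp add: below_def)
    moreover have "{x \<in> J. x < ?k} \<subseteq> {1..?k - 1}" using J1 by auto
    ultimately have low: "{x \<in> J. x < ?k} = {1..?k - 1}"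
      by (intro card_seteq) auto
    show ?thesis
    proof (cases "?k \<in> J")
      case True
      moreover have "{1..?k} = insert ?k {1..?k - 1}" using c by auto
      moreover have "{x \<in> J. x < ?k} \<subseteq> J" by auto
      ultimately have "{1..?k} \<subseteq> J" unfolding low by simp
      then show ?thesis using card_subset_eq[of J "{1..?k}"] c by simp
    next
      case False
      have "J \<subseteq> insert (?k + 1) {1..?k - 1}"
      proof
        fix x assume "x \<in> J"
        then have "x \<in> {1..?k + 1}" "x \<noteq> ?k" using J1 False by auto
        then show "x \<in> insert (?k + 1) {1..?k - 1}" by auto
      qed
      moreover have "card (insert (?k + 1) {1..?k - 1}) = ?k" using c by simp
      ultimately have "J = insert (?k + 1) {1..?k - 1}" by (intro card_subset_eq) auto
      then show ?thesis using 2 by simp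
    qed
  qed
qed

text \<open>The first two values form {1,2} or {1,3}, so a first value 2 forces the second to be
  1.\<close>

lemma adjacent_swaps_compatible:
  assumes w: "w \<in> perms m" and m: "2 \<le> m" and swaps: "adjacent_swaps w"
  shows "block_compatible l w"
proof -
  note w12 = perms_first_two[OF w m]
  have "{w ! 0} = {1} \<or> {w ! 0} = {2}"
    using adjacent_swaps_prefix_set[OF w swaps, of 1] m w12(1) by auto
  moreover have "{w ! 0, w ! 1} = {1, 2} \<or> {w ! 0, w ! 1} = {1, 3}"
  proof -
    have "{1..2} = {1, 2 :: nat}" "insert 3 {1..1} = {1, 3 :: nat}" by auto
    then show ?thesis using adjacent_swaps_prefix_set[OF w swaps, of 2] m w12(2) by auto
  qed
  ultimately have "w ! 0 = 1 \<or> w ! 0 = w ! 1 + 1" by (auto simp: doubleton_eq_iff)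
  then show ?thesis using swaps by (auto simp: block_compatible_def adjacent_swaps_def)
qed

text \<open>With at most two surviving sets of each size, the statistics suffice: the number of sets
  containing \<open>k + 1\<close> gives the multiplicity of the swapped set of size
  \<open>k\<close>, and the number of sets of size \<open>k\<close> then gives that of
  \<open>{1..k}\<close>.\<close>

lemma adjacent_swaps_zero:
  assumes w: "w \<in> perms m" and m: "2 \<le> m" and swaps: "adjacent_swaps w"
  shows "(restricted_ideal m l w :: (nat set, 'k::field) mpoly set) = {0}"
proof (rule restricted_ideal_zero)
  fix d e :: "nat set \<Rightarrow>\<^sub>0 nat"
  assume e: "Poly_Mapping.keys e \<subseteq> surviving_sets m w" and d': "Poly_Mapping.keys d \<subseteq> proper_subsets m"
    and deg: "image_degree l d = image_degree l e"
  have d: "Poly_Mapping.keys d \<subseteq> surviving_sets m w"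
    by (rule block_compatible_fibre_closed[OF w m adjacent_swaps_compatible[OF w m swaps] e d' deg])
  have e': "Poly_Mapping.keys e \<subseteq> proper_subsets m" using e surviving_subset by blast
  define S where "S f g = (\<Sum>J\<in>proper_subsets m. Poly_Mapping.lookup f J * g J)"
    for f :: "nat set \<Rightarrow>\<^sub>0 nat" and g :: "nat set \<Rightarrow> nat"
  have S_add: "S f g = S f h1 + S f h2"
    if "Poly_Mapping.keys f \<subseteq> surviving_sets m w" "\<And>J. J \<in> surviving_sets m w \<Longrightarrow> g J = h1 J + h2 J" for f g h1 h2
    unfolding S_def sum.distrib[symmetric]
    by (rule sum.cong[OF refl]) (use that in \<open>metis (no_types, lifting) add_mult_distrib2 in_keys_iff mult_zero_left add_0 subsetD\<close>)
  have S_delta: "S f (\<lambda>J. if J = K then 1 else 0) = (if K \<in> proper_subsets m then Poly_Mapping.lookup f K else 0)" for f K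
    unfolding S_def using finite_proper_subsets by (simp add: if_distrib cong: if_cong)
  have content: "S d (\<lambda>J. if v \<in> J then 1 else 0) = S e (\<lambda>J. if v \<in> J then 1 else 0)" for v
    using image_degree_content[OF d', of l v] image_degree_content[OF e', of l v] deg by (simp add: S_def)
  have size: "S d (\<lambda>J. if i \<le> card J then 1 else 0) = S e (\<lambda>J. if i \<le> card J then 1 else 0)" if "1 \<le> i" for i
    using image_degree_size[OF d' that, of l] image_degree_size[OF e' that, of l] deg by (simp add: S_def)
  note shape = adjacent_swaps_surviving[OF w swaps]
  have card1: "1 \<le> card J" "card J < m" if "J \<in> surviving_sets m w" for J
    using that surviving_subset surviving_card by blast+
  have swapped: "Poly_Mapping.lookup d K = Poly_Mapping.lookup e K"
    if K: "K = insert (k + 1) {1..k - 1}" "prefix_set w k = K" "1 \<le> k" "k < m" for k K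
  proof -
    \<comment> \<open>Every surviving set with more than \<open>k\<close> elements contains
      \<open>k + 1\<close>, because swaps at \<open>k\<close> and at \<open>k + 1\<close> would
      overlap; this is \<open>ne\<close>. Of the others only \<open>K\<close> contains it.\<close>
    have pt: "(if k + 1 \<in> J then 1 else 0) = (if J = K then 1 else 0) + (if k + 1 \<le> card J then 1 else (0 :: nat))"
      if J: "J \<in> surviving_sets m w" for J
    proof -
      have "card K = k" using K by simp
      have ne: "prefix_set w (k + 1) \<noteq> insert (k + 1 + 1) {1..k + 1 - 1}"
      proof
        assume "prefix_set w (k + 1) = insert (k + 1 + 1) {1..k + 1 - 1}"
        moreover have "k + 1 \<in> prefix_set w (k + 1)"
          using K set_take_subset_set_take[of k "k + 1" w] by auto
        ultimately show False by auto
      qed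
      have n: "J = {1..k + 1}" if "card J = k + 1"
        using shape[OF J] ne unfolding that by metis
      have eqK: "J = K \<longleftrightarrow> card J = k \<and> k + 1 \<in> J"
      proof
        assume "J = K"
        then show "card J = k \<and> k + 1 \<in> J" using K \<open>card K = k\<close> by simp
      next
        assume asm: "card J = k \<and> k + 1 \<in> J"
        then have "J \<noteq> {1..card J}" by (metis Suc_eq_plus1 atLeastAtMost_iff not_less_eq_eq order_refl)
        then show "J = K" using shape[OF J] asm K by metis
      qed
      show ?thesis
      proof (cases "card J \<le> k")
        case True
        have "card J = k" if "k + 1 \<in> J"
        proof (rule ccontr)
          assume "card J \<noteq> k"
          then have "k + 1 \<notin> {1..card J}" "k + 1 \<notin> insert (card J + 1) {1..card J - 1}" using True by auto
          then show False using shape[OF J] \<open>k + 1 \<in> J\<close> by metis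
        qed
        then show ?thesis using True eqK by auto
      next
        case False
        have "k + 1 \<in> J"
        proof (cases "card J = k + 1")
          case True
          have "k + 1 \<in> {1..k + 1}" by simp
          then show ?thesis using n[OF True] by simp
        next
          case False
          then have "k + 1 \<in> {1..card J - 1}" "k + 1 \<in> {1..card J}" using \<open>\<not> card J \<le> k\<close> by auto
          then show ?thesis using shape[OF J] by (metis insertCI)
        qed
        then show ?thesis using False eqK by auto
      qed
    qed
    have "S f (\<lambda>J. if k + 1 \<in> J then 1 else 0) = S f (\<lambda>J. if J = K then 1 else 0)
        + S f (\<lambda>J. if k + 1 \<le> card J then 1 else 0)"
      if "Poly_Mapping.keys f \<subseteq> surviving_sets m w" for f by (rule S_add[OF that pt])
    moreover have "K \<in> proper_subsets m"
      using prefix_set_surviving[OF w K(3,4)] K(2) surviving_subset by blast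
    ultimately show ?thesis using d e content[of "k + 1"] size[of "k + 1"] S_delta by simp
  qed
  have initial: "Poly_Mapping.lookup d {1..k} = Poly_Mapping.lookup e {1..k}" if k: "1 \<le> k" "k < m" for k
  proof -
    let ?K = "insert (k + 1) {1..k - 1}"
    have K: "card ?K = k" using k by simp
    have "k + 1 \<in> ?K" "k + 1 \<notin> {1..k}" by auto
    then have ne: "{1..k} \<noteq> ?K" by blast
    \<comment> \<open>The condition on the prefix makes the middle indicator zero when there is no
      swap at \<open>k\<close>, so \<open>swapped\<close> is invoked only where it applies.\<close>
    have pt: "(if k \<le> card J then 1 else 0) = (if J = {1..k} then 1 else 0) +
       ((if prefix_set w k = ?K \<and> J = ?K then 1 else 0) + (if k + 1 \<le> card J then 1 else (0 :: nat)))"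
      if J: "J \<in> surviving_sets m w" for J
    proof (cases "card J = k")
      case True
      from shape[OF J, unfolded True] show ?thesis
      proof (elim disjE conjE)
        assume "J = {1..k}"
        then show ?thesis using ne by simp
      next
        assume "J = ?K" "prefix_set w k = J"
        then show ?thesis using ne K by auto
      qed
    next
      case False
      then have "J \<noteq> {1..k}" "J \<noteq> ?K" using K by auto
      then show ?thesis using False by auto
    qed
    have 1: "S f (\<lambda>J. if k \<le> card J then 1 else 0) = S f (\<lambda>J. if J = {1..k} then 1 else 0)
        + S f (\<lambda>J. (if prefix_set w k = ?K \<and> J = ?K then 1 else 0) + (if k + 1 \<le> card J then 1 else 0))"
      if "Poly_Mapping.keys f \<subseteq> surviving_sets m w" for f by (rule S_add[OF that pt])
    have 2: "S f (\<lambda>J. (if prefix_set w k = ?K \<and> J = ?K then 1 else 0) + (if k + 1 \<le> card J then 1 else 0))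
      = S f (\<lambda>J. if prefix_set w k = ?K \<and> J = ?K then 1 else 0) + S f (\<lambda>J. if k + 1 \<le> card J then 1 else 0)"
      if "Poly_Mapping.keys f \<subseteq> surviving_sets m w" for f by (rule S_add[OF that refl])
    have 3: "S d (\<lambda>J. if prefix_set w k = ?K \<and> J = ?K then 1 else 0) = S e (\<lambda>J. if prefix_set w k = ?K \<and> J = ?K then 1 else 0)"
    proof (cases "prefix_set w k = ?K")
      case True
      then show ?thesis using swapped[OF refl True k] S_delta[of d ?K] S_delta[of e ?K] by simp
    qed (simp add: S_def)
    have "{1..k} \<in> proper_subsets m" using k by (auto simp: proper_subsets_def)
    then show ?thesis
      using 1[OF d] 1[OF e] 2[OF d] 2[OF e] 3 size[OF k(1)] size[of "k + 1"] S_delta by simp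
  qed
  show "d = e"
  proof (rule poly_mapping_eqI)
    fix J
    show "Poly_Mapping.lookup d J = Poly_Mapping.lookup e J"
    proof (cases "J \<in> surviving_sets m w")
      case True
      then show ?thesis
        using shape[OF True] initial[OF card1[OF True]] swapped[of J "card J"] card1[OF True] by metis
    next
      case False
      then show ?thesis using d e by (metis in_keys_iff subsetD)
    qed
  qed
qed

section \<open>Explicit description of the sets T and Z\<close>

lemma T_set_iff:
  assumes w: "w \<in> perms m" and m: "2 \<le> m" and l: "1 \<le> l"
  shows "w \<in> T_set (K :: 'k::field itself) m l \<longleftrightarrow> block_compatible l w \<and> \<not> adjacent_swaps w"
proof (cases "block_compatible l w")
  case True
  have "(monomial e :: (nat set, 'k) mpoly) \<notin> restricted_ideal m l w" for e
    by (rule monomial_notin_restricted_ideal) (rule block_compatible_fibre_closed[OF w m True])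
  moreover have "(restricted_ideal m l w :: (nat set, 'k) mpoly set) = {0} \<longleftrightarrow> adjacent_swaps w"
    using adjacent_swaps_zero[OF w m] compatible_nonzero[OF w m True] by blast
  ultimately show ?thesis using True w by (simp add: T_set_def binomial_ideal_def)
next
  case False
  then show ?thesis
    using incompatible_monomial[OF w m l False, where 'k = 'k] by (auto simp: T_set_def binomial_ideal_def)
qed

text \<open>A monomial is nonzero, so incompatibility also prevents the ideal from
  vanishing.\<close>

lemma Z_set_iff:
  assumes w: "w \<in> perms m" and m: "2 \<le> m"
  shows "w \<in> Z_set (K :: 'k::field itself) m \<longleftrightarrow> adjacent_swaps w"
proof -
  have "(restricted_ideal m m w :: (nat set, 'k) mpoly set) \<noteq> {0}" if neg: "\<not> adjacent_swaps w"
  proof (cases "block_compatible m w")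
    case True
    then show ?thesis using compatible_nonzero[OF w m _ neg] by blast
  next
    case False
    then obtain e where "(monomial e :: (nat set, 'k) mpoly) \<in> restricted_ideal m m w"
      using incompatible_monomial[OF w m, of m] m by auto
    moreover have "(monomial e :: (nat set, 'k) mpoly) \<noteq> 0"
      by (metis lookup_single_eq lookup_zero monomial_def one_neq_zero)
    ultimately show ?thesis by auto
  qed
  then show ?thesis using adjacent_swaps_zero[OF w m] w by (auto simp: Z_set_def)
qed

section \<open>Removing the largest value\<close>

lemma before_Cons: "before (x # ys) a b \<longleftrightarrow> (a = x \<and> b \<in> set ys) \<or> before ys a b"
proof
  assume "before (x # ys) a b"
  then obtain i j where ij: "i < j" "j < Suc (length ys)" "(x # ys) ! i = a" "(x # ys) ! j = b"
    by (auto simp: before_def)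
  then obtain j' where j': "j = Suc j'" by (cases j) auto
  show "(a = x \<and> b \<in> set ys) \<or> before ys a b"
  proof (cases i)
    case 0
    then show ?thesis using ij j' by auto
  next
    case (Suc i')
    then show ?thesis using ij j' by (auto simp: before_def)
  qed
next
  assume "(a = x \<and> b \<in> set ys) \<or> before ys a b"
  then show "before (x # ys) a b"
  proof
    assume a: "a = x \<and> b \<in> set ys"
    then obtain j where "j < length ys" "ys ! j = b" by (auto simp: in_set_conv_nth)
    then show ?thesis unfolding before_def using a by (intro exI[of _ 0] exI[of _ "Suc j"]) auto
  next
    assume "before ys a b"
    then obtain i j where "i < j" "j < length ys" "ys ! i = a" "ys ! j = b" by (auto simp: before_def)
    then show ?thesis unfolding before_def by (intro exI[of _ "Suc i"] exI[of _ "Suc j"]) auto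
  qed
qed

lemma before_Nil: "\<not> before [] a b"
  by (simp add: before_def)

lemma before_append:
  "before (xs @ ys) a b \<longleftrightarrow> before xs a b \<or> before ys a b \<or> (a \<in> set xs \<and> b \<in> set ys)"
  by (induction xs) (auto simp: before_Cons before_Nil)

lemma before_set: "before w a b \<Longrightarrow> a \<in> set w \<and> b \<in> set w"
  by (auto simp: before_def)

lemma sorted_wrt_greater_before: "sorted_wrt (>) (xs :: nat list) \<longleftrightarrow> (\<forall>a b. before xs a b \<longrightarrow> b < a)"
  by (induction xs) (auto simp: before_Cons before_Nil)

lemma decreasing_unique:
  assumes "sorted_wrt (>) (xs :: nat list)" "sorted_wrt (>) ys" "set xs = set ys"
  shows "xs = ys"
proof -
  have "sorted_wrt (<) (rev xs)" "sorted_wrt (<) (rev ys)" using assms by (simp_all add: sorted_wrt_rev)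
  then have "rev ys = rev xs" using assms(3) by (intro strict_sorted_equal) simp_all
  then show ?thesis by simp
qed

lemma decreasing_rev_upt: "sorted_wrt (>) (rev [i..<j])"
  by (simp add: sorted_wrt_rev)

lemma pos_eq:
  assumes "w \<in> perms m" "i < m" "w ! i = v"
  shows "pos w v = i + 1"
  unfolding pos_def
proof (rule the_equality)
  have len: "length w = m" by (rule perms_length[OF assms(1)])
  show "i + 1 \<in> {1..length w} \<and> entry w (i + 1) = v" using assms len by (simp add: entry_def)
  fix k assume k: "k \<in> {1..length w} \<and> entry w k = v"
  then have "w ! (k - 1) = w ! i" "k - 1 < length w" using assms by (auto simp: entry_def)
  moreover have "distinct w" "i < length w" using assms len by (simp_all add: perms_iff)
  ultimately have "k - 1 = i" using nth_eq_iff_index_eq by blast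
  then show "k = i + 1" using k by auto
qed

text \<open>Neighbour comparisons from the position of \<open>m\<close> on amount to comparing all
  pairs after \<open>m\<close>, as \<open>m\<close> exceeds its successor anyway.\<close>

lemma desc_perms_iff:
  assumes w: "w \<in> perms m" and m: "1 \<le> m"
  shows "w \<in> desc_perms m \<longleftrightarrow> (\<forall>u v. before w m u \<and> before w u v \<longrightarrow> v < u)"
proof -
  obtain t where t: "t < m" "w ! t = m" using perms_obtain[OF w, of m] m by auto
  have p: "pos w m = t + 1" by (rule pos_eq[OF w t])
  have nth_less: "w ! i < m" if "i < m" "i \<noteq> t" for i
    using perms_nth[OF w that(1)] t that w perms_length[OF w]
    by (metis atLeastAtMost_iff le_neq_implies_less nth_eq_iff_index_eq perms_iff)
  show ?thesis
  proof
    assume d: "w \<in> desc_perms m"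
    have step: "w ! Suc i < w ! i" if "t \<le> i" "Suc i < m" for i
    proof -
      have "entry w (Suc i + 1) < entry w (Suc i)" using d p that unfolding desc_perms_def by simp
      then show ?thesis by (simp add: entry_def)
    qed
    have mono: "w ! j < w ! i" if "t \<le> i" "i < j" "j < m" for i j
      using that(2,3)
    proof (induction j)
      case (Suc j)
      then show ?case using step[of j] \<open>t \<le> i\<close> by (cases "i = j") auto
    qed simp
    show "\<forall>u v. before w m u \<and> before w u v \<longrightarrow> v < u"
    proof (intro allI impI)
      fix u v assume b: "before w m u \<and> before w u v"
      then obtain i j where "i < m" "w ! i = u" "j < m" "w ! j = v"
        using before_in_perms[OF w] perms_obtain[OF w] by metis
      then show "v < u" using b before_nth[OF w] t mono[of i j] by (metis less_imp_le)
    qed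
  next
    assume d: "\<forall>u v. before w m u \<and> before w u v \<longrightarrow> v < u"
    have "entry w (i + 1) < entry w i" if i: "pos w m \<le> i" "i < m" for i
    proof (cases "i = t + 1")
      case True
      then show ?thesis using nth_less[of i] i t by (simp add: entry_def)
    next
      case False
      then have "before w m (w ! (i - 1))" "before w (w ! (i - 1)) (w ! i)"
        using before_nth[OF w, of t "i - 1"] before_nth[OF w, of "i - 1" i] t i p by auto
      then show ?thesis using d by (simp add: entry_def)
    qed
    then show "w \<in> desc_perms m" using w by (simp add: desc_perms_def)
  qed
qed

definition avoids_312 :: "nat list \<Rightarrow> bool" where
  "avoids_312 w \<longleftrightarrow> (\<forall>y. \<not> middle_of_312 w y)"

text \<open>Any value strictly between the first two comes later and completes the pattern.\<close>

lemma middle_of_312_second: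
  assumes "w \<in> perms m" "2 \<le> m"
  shows "middle_of_312 w (w ! 1) \<longleftrightarrow> w ! 1 + 1 < w ! 0"
proof -
  note w12 = perms_first_two[OF assms]
  have "middle_of_312 w (w ! 1) \<longleftrightarrow> (\<exists>c. w ! 1 < c \<and> c < w ! 0 \<and> c \<in> {1..m})"
    using middle_of_312_nth[OF assms(1), of 1] assms(2) w12(1,2) by (auto simp: numeral_2_eq_2)
  also have "\<dots> \<longleftrightarrow> w ! 1 + 1 < w ! 0"
  proof
    assume "w ! 1 + 1 < w ! 0"
    then have "w ! 1 < w ! 1 + 1 \<and> w ! 1 + 1 < w ! 0 \<and> w ! 1 + 1 \<in> {1..m}" using w12(4) by simp
    then show "\<exists>c. w ! 1 < c \<and> c < w ! 0 \<and> c \<in> {1..m}" ..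
  qed auto
  finally show ?thesis .
qed

text \<open>No value exceeds \<open>l\<close>, so the four alternatives together say only that the
  first value exceeds the second by at most 1, i.e. that the second is not the 1 of a
  pattern.\<close>

lemma block_compatible_diagonal:
  assumes w: "w \<in> perms m" and m: "2 \<le> m" "m \<le> l"
  shows "block_compatible l w \<longleftrightarrow> avoids_312 w"
proof -
  note w12 = perms_first_two[OF w m(1)] and mid = middle_of_312_second[OF w m(1)]
  show ?thesis
  proof
    assume c: "block_compatible l w"
    have "w ! 0 \<le> m" "w ! 1 \<ge> 1" using w12(4,5) by auto
    with c m have "\<not> w ! 1 + 1 < w ! 0" unfolding block_compatible_def by linarith
    then have "\<not> middle_of_312 w (w ! 1)" using mid by blast
    then show "avoids_312 w" using c by (auto simp: block_compatible_def avoids_312_def)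
  next
    assume a: "avoids_312 w"
    then have "\<not> w ! 1 + 1 < w ! 0" using mid by (auto simp: avoids_312_def)
    then have "w ! 0 = w ! 1 + 1 \<or> w ! 0 < w ! 1" using w12(3) by linarith
    then show "block_compatible l w" using a w12(3-5) m by (auto simp: block_compatible_def avoids_312_def)
  qed
qed

text \<open>An initial ascent breaks the bound \<open>m - 1\<close> only if
  \<open>w ! 1 = m\<close>, and then \<open>w ! 0 = 1\<close> is the sole way out. The last
  alternative permits no gap: a first value above \<open>m - 1\<close> is \<open>m\<close>.\<close>

lemma block_compatible_pred:
  assumes w: "w \<in> perms m" and m: "2 \<le> m"
  shows "block_compatible (m - 1) w \<longleftrightarrow> avoids_312 w \<and> \<not> (w ! 0 \<noteq> 1 \<and> w ! 1 = m)"
proof -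
  note w12 = perms_first_two[OF w m] and mid = middle_of_312_second[OF w m]
  show ?thesis
  proof
    assume c: "block_compatible (m - 1) w"
    have b: "w ! 0 \<le> m" "w ! 1 \<ge> 1" using w12(4,5) by auto
    with c m have "\<not> w ! 1 + 1 < w ! 0" unfolding block_compatible_def by linarith
    then have "\<not> middle_of_312 w (w ! 1)" using mid by blast
    moreover have "\<not> (w ! 0 \<noteq> 1 \<and> w ! 1 = m)" using c b m unfolding block_compatible_def by linarith
    ultimately show "avoids_312 w \<and> \<not> (w ! 0 \<noteq> 1 \<and> w ! 1 = m)"
      using c by (auto simp: block_compatible_def avoids_312_def)
  next
    assume a: "avoids_312 w \<and> \<not> (w ! 0 \<noteq> 1 \<and> w ! 1 = m)"
    then have "\<not> w ! 1 + 1 < w ! 0" using mid by (auto simp: avoids_312_def)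
    then have "w ! 0 = w ! 1 + 1 \<or> w ! 0 < w ! 1" using w12(3) by linarith
    moreover have "w ! 0 = 1 \<or> w ! 1 \<le> m - 1" using a w12(4,5) by auto
    ultimately show "block_compatible (m - 1) w" using a by (auto simp: block_compatible_def avoids_312_def)
  qed
qed

section \<open>Inserting n between the parts us and vs of a shorter permutation\<close>

context
  fixes n :: nat and us vs w w' :: "nat list"
  assumes w: "w \<in> perms n" and n: "4 \<le> n" and w_eq: "w = us @ n # vs" and w'_eq: "w' = us @ vs"
begin

lemma distinct_parts: "distinct us" "distinct vs" "set us \<inter> set vs = {}" "n \<notin> set us" "n \<notin> set vs"
  using w by (auto simp: w_eq perms_iff)

lemma set_parts: "set us \<union> set vs = {1..n - 1}"
proof -
  have "insert n (set us \<union> set vs) = {1..n}" using w by (auto simp: w_eq perms_iff)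
  moreover have "{1..n - 1} = {1..n} - {n}" using n by auto
  ultimately show ?thesis using distinct_parts by auto
qed

lemma other_part:
  assumes "1 \<le> x" "x < n" "x \<notin> set us"
  shows "x \<in> set vs"
proof -
  have "x \<in> set us \<union> set vs" unfolding set_parts using assms by simp
  then show ?thesis using assms by simp
qed

lemma in_parts:
  assumes "x \<in> set us \<or> x \<in> set vs"
  shows "1 \<le> x" "x < n"
proof -
  have "x \<in> {1..n - 1}" using assms unfolding set_parts[symmetric] by simp
  then show "1 \<le> x" "x < n" using n by auto
qed

lemma perms_w': "w' \<in> perms (n - 1)"
  using distinct_parts set_parts by (simp add: w'_eq perms_iff)

lemma delete_max: "delete_value n w = w'"
  using distinct_parts by (simp add: delete_value_def w_eq w'_eq filter_id_conv) (metis (mono_tags, lifting) filter_True)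

lemma lengths: "length us + length vs + 1 = n"
  using perms_length[OF w] by (simp add: w_eq)

lemma before_w: "before w x y \<longleftrightarrow> before w' x y \<or> (x \<in> set us \<and> y = n) \<or> (x = n \<and> y \<in> set vs)"
  by (auto simp: w_eq w'_eq before_append before_Cons)

lemma before_w'_less: "before w' x y \<Longrightarrow> x < n \<and> y < n"
  using before_in_perms[OF perms_w'] n by fastforce

lemma before_w'_vs: "y \<in> set vs \<Longrightarrow> before w' y c \<longleftrightarrow> before vs y c"
  using distinct_parts before_set[of us y c] by (auto simp: w'_eq before_append)

text \<open>The largest value can only be the 3 of a pattern, so a new middle is the start of an
  ascent within the part after \<open>n\<close>.\<close>

lemma middle_w: "middle_of_312 w y \<longleftrightarrow> middle_of_312 w' y \<or> (\<exists>c. y < c \<and> before vs y c)"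
proof
  assume "middle_of_312 w y"
  then obtain x c where xc: "y < c" "c < x" "before w x y" "before w y c" by (auto simp: middle_of_312_def)
  have "x \<le> n" using before_in_perms[OF w xc(3)] by simp
  then have yc: "before w' y c" using xc before_w by auto
  show "middle_of_312 w' y \<or> (\<exists>c. y < c \<and> before vs y c)"
  proof (cases "x = n")
    case True
    then have "y \<in> set vs" using xc before_w before_w'_less by auto
    then show ?thesis using before_w'_vs yc xc by auto
  next
    case False
    then have "before w' x y" using xc \<open>x \<le> n\<close> before_w by auto
    then show ?thesis using yc xc by (auto simp: middle_of_312_def)
  qed
next
  assume "middle_of_312 w' y \<or> (\<exists>c. y < c \<and> before vs y c)"
  then show "middle_of_312 w y"
  proof
    assume "\<exists>c. y < c \<and> before vs y c"
    then obtain c where c: "y < c" "before vs y c" by blast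
    then have "before w n y" "before w y c" "c < n"
      using before_set[OF c(2)] in_parts before_w before_w'_vs by auto
    then show ?thesis using c by (auto simp: middle_of_312_def)
  qed (auto simp: middle_of_312_def before_w)
qed

lemma middle_mono: "middle_of_312 w' y \<Longrightarrow> middle_of_312 w y"
  by (simp add: middle_w)

lemma middle_eq: "sorted_wrt (>) vs \<Longrightarrow> middle_of_312 w y \<longleftrightarrow> middle_of_312 w' y"
  by (auto simp: middle_w sorted_wrt_greater_before dest: order.asym)

lemma adjacent_swaps_mono: "adjacent_swaps w \<Longrightarrow> adjacent_swaps w'"
  unfolding adjacent_swaps_def using middle_mono before_w by blast

lemma decreasing_if: "(\<And>y c. before vs y c \<Longrightarrow> \<not> y < c) \<Longrightarrow> sorted_wrt (>) vs"
proof (unfold sorted_wrt_iff_nth_less, intro allI impI)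
  fix i j assume ind: "\<And>y c. before vs y c \<Longrightarrow> \<not> y < c" and ij: "i < j" "j < length vs"
  have "before vs (vs ! i) (vs ! j)" unfolding before_def using ij by blast
  moreover have "vs ! i \<noteq> vs ! j" using distinct_parts(2) ij by (simp add: nth_eq_iff_index_eq)
  ultimately show "vs ! j < vs ! i" using ind by (meson linorder_neqE_nat)
qed

lemma avoids_w: "avoids_312 w \<longleftrightarrow> avoids_312 w' \<and> sorted_wrt (>) vs"
proof -
  have "(\<forall>y c. \<not> (y < c \<and> before vs y c)) \<longleftrightarrow> sorted_wrt (>) vs"
  proof
    assume "sorted_wrt (>) vs"
    then show "\<forall>y c. \<not> (y < c \<and> before vs y c)"
      unfolding sorted_wrt_greater_before by (meson order.asym)
  qed (use decreasing_if in blast)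
  then show ?thesis unfolding avoids_312_def middle_w by blast
qed

text \<open>This is the position condition in \<open>A2\<close>: \<open>n - 1\<close> stands
  anywhere before \<open>n\<close> or immediately after it.\<close>

definition large_adjacent :: bool where
  "large_adjacent \<longleftrightarrow> n - 1 \<in> set us \<or> (vs \<noteq> [] \<and> hd vs = n - 1)"

lemma desc_iff: "w' \<in> desc_perms (n - 1) \<longleftrightarrow> (\<forall>u v. before w' (n - 1) u \<and> before w' u v \<longrightarrow> v < u)"
  using desc_perms_iff[OF perms_w'] n by simp

lemma desc_if_avoids: "avoids_312 w' \<Longrightarrow> w' \<in> desc_perms (n - 1)"
  unfolding desc_iff
proof (intro allI impI, rule ccontr)
  fix u v assume a: "avoids_312 w'" "before w' (n - 1) u \<and> before w' u v" "\<not> v < u"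
  have d: "distinct w'" using perms_w' by (simp add: perms_iff)
  then have "u \<noteq> v" "n - 1 \<noteq> v" using a(2) by (auto simp: before_def nth_eq_iff_index_eq)
  then have "u < v" "v < n - 1" using a(2,3) before_w'_less[of u v] by auto
  then show False using a by (auto simp: avoids_312_def middle_of_312_def)
qed

lemma large_adjacent_if_decreasing:
  assumes "sorted_wrt (>) vs"
  shows "large_adjacent"
proof (cases "n - 1 \<in> set us")
  case False
  then have v: "n - 1 \<in> set vs" using other_part[of "n - 1"] n by auto
  then obtain b bs where vs: "vs = b # bs" by (cases vs) auto
  have "b = n - 1" using v assms in_parts[of b] by (auto simp: vs)
  then show ?thesis unfolding large_adjacent_def by (simp add: vs)
qed (simp add: large_adjacent_def)

text \<open>Every element of \<open>vs\<close> other than \<open>n - 1\<close> itself comes after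
  \<open>n - 1\<close>, where \<open>w'\<close> descends.\<close>

lemma decreasing_if_large_adjacent:
  assumes "w' \<in> desc_perms (n - 1)" "large_adjacent"
  shows "sorted_wrt (>) vs"
proof -
  have d: "v < u" if "before w' (n - 1) u" "before w' u v" for u v using assms(1) that unfolding desc_iff by blast
  show ?thesis
  proof (rule decreasing_if)
    fix y c assume b: "before vs y c"
    then have bv: "before w' y c" "y \<in> set vs" "c \<in> set vs" using before_set[OF b] before_w'_vs by auto
    show "\<not> y < c"
    proof (cases "n - 1 \<in> set us")
      case True
      then have "before w' (n - 1) y" using bv by (simp add: w'_eq before_append)
      then show ?thesis using d bv by fastforce
    next
      case False
      then obtain bs where vs: "vs = (n - 1) # bs"
        using assms(2) unfolding large_adjacent_def by (metis list.exhaust_sel)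
      show ?thesis
      proof (cases "y = n - 1")
        case True
        then show ?thesis using in_parts[of c] bv(3) by simp
      next
        case False
        then have "before vs (n - 1) y" using bv by (auto simp: vs before_Cons)
        then have "before w' (n - 1) y" by (simp add: w'_eq before_append)
        then show ?thesis using d bv by fastforce
      qed
    qed
  qed
qed

lemma pos_max: "pos w n = length us + 1"
  by (rule pos_eq[OF w]) (use lengths in \<open>auto simp: w_eq\<close>)

lemma pos_us: "i < length us \<Longrightarrow> pos w (us ! i) = i + 1"
  by (rule pos_eq[OF w]) (use lengths in \<open>auto simp: w_eq nth_append\<close>)

lemma pos_vs: "i < length vs \<Longrightarrow> pos w (vs ! i) = length us + i + 2"
  using pos_eq[OF w, of "length us + Suc i" "vs ! i"] lengths by (simp add: w_eq nth_append)

lemma large_adjacent_iff: "pos w (n - 1) - 1 \<le> pos w n \<longleftrightarrow> large_adjacent"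
proof (cases "n - 1 \<in> set us")
  case True
  then obtain i where "i < length us" "us ! i = n - 1" by (auto simp: in_set_conv_nth)
  then show ?thesis using pos_us[of i] True by (simp add: pos_max large_adjacent_def)
next
  case False
  then have "n - 1 \<in> set vs" using other_part[of "n - 1"] n by auto
  then obtain i where i: "i < length vs" "vs ! i = n - 1" by (auto simp: in_set_conv_nth)
  then have p: "pos w (n - 1) = length us + i + 2" using pos_vs[of i] by simp
  have "hd vs = n - 1 \<longleftrightarrow> i = 0"
  proof -
    have vs: "vs \<noteq> []" "0 < length vs" using i by auto
    have "hd vs = n - 1 \<longleftrightarrow> vs ! 0 = vs ! i" using vs i by (simp add: hd_conv_nth)
    also have "\<dots> \<longleftrightarrow> i = 0" using nth_eq_iff_index_eq[OF distinct_parts(2) vs(2) i(1)] by blast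
    finally show ?thesis .
  qed
  moreover have "vs \<noteq> []" using i by auto
  ultimately have "large_adjacent \<longleftrightarrow> i = 0" unfolding large_adjacent_def using False by simp
  then show ?thesis unfolding p pos_max by simp
qed

lemma late_iff: "pos w (n - 1) + 1 \<le> pos w n \<longleftrightarrow> n - 1 \<in> set us"
proof (cases "n - 1 \<in> set us")
  case True
  then obtain i where "i < length us" "us ! i = n - 1" by (auto simp: in_set_conv_nth)
  then show ?thesis using pos_us[of i] True by (simp add: pos_max)
next
  case False
  then have "n - 1 \<in> set vs" using other_part[of "n - 1"] n by auto
  then obtain i where i: "i < length vs" "vs ! i = n - 1" by (auto simp: in_set_conv_nth)
  then show ?thesis using pos_vs[of i] False by (simp add: pos_max)
qed

lemma A1_iff: "entry w n = n - 2 \<and> {entry w (n - 2), entry w (n - 1)} = {n - 1, n} \<longleftrightarrow>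
   (vs = [n - 2] \<and> us \<noteq> [] \<and> last us = n - 1) \<or> vs = [n - 1, n - 2]"
proof
  assume a: "entry w n = n - 2 \<and> {entry w (n - 2), entry w (n - 1)} = {n - 1, n}"
  have len: "length w = n" by (rule perms_length[OF w])
  have at: "i = length us" if "i < n" "w ! i = n" for i
  proof -
    have "w ! length us = n" by (simp add: w_eq)
    then show ?thesis using that len w lengths nth_eq_iff_index_eq[of w i "length us"] by (simp add: perms_iff)
  qed
  have e: "w ! (n - 1) = n - 2" "{w ! (n - 3), w ! (n - 2)} = {n - 1, n}"
    using a n by (simp_all add: entry_def numeral_3_eq_3 numeral_2_eq_2)
  then consider "w ! (n - 2) = n" "w ! (n - 3) = n - 1" | "w ! (n - 3) = n" "w ! (n - 2) = n - 1"
    by (auto simp: doubleton_eq_iff)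
  then show "(vs = [n - 2] \<and> us \<noteq> [] \<and> last us = n - 1) \<or> vs = [n - 1, n - 2]"
  proof cases
    case 1
    then have l: "length us = n - 2" using at[of "n - 2"] n by simp
    then have "length vs = 1" using lengths n by simp
    then obtain b where b: "vs = [b]" by (cases vs) auto
    have "n - 1 = Suc (length us)" using l n by auto
    then have "b = n - 2" using e(1) by (simp add: w_eq b nth_append)
    moreover have "us \<noteq> []" using l n by auto
    moreover have "last us = n - 1"
    proof -
      have "n - 3 = length us - 1" "length us - 1 < length us" using l n by auto
      then show ?thesis using 1(2) \<open>us \<noteq> []\<close> by (simp add: w_eq nth_append last_conv_nth)
    qed
    ultimately show ?thesis using b by simp
  next
    case 2
    then have l: "length us = n - 3" using at[of "n - 3"] n by simp
    then have "length vs = 2" using lengths n by simp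
    then obtain b c where b: "vs = [b, c]" by (auto simp: numeral_2_eq_2 length_Suc_conv)
    have "n - 2 = Suc (length us)" "n - 1 = Suc (Suc (length us))" using l n by auto
    then have "b = n - 1" "c = n - 2" using e(1) 2(2) by (auto simp: w_eq b nth_append)
    then show ?thesis using b by simp
  qed
next
  assume "(vs = [n - 2] \<and> us \<noteq> [] \<and> last us = n - 1) \<or> vs = [n - 1, n - 2]"
  then show "entry w n = n - 2 \<and> {entry w (n - 2), entry w (n - 1)} = {n - 1, n}"
  proof
    assume a: "vs = [n - 2] \<and> us \<noteq> [] \<and> last us = n - 1"
    then have l: "n = length us + 2" using lengths by simp
    then show ?thesis using a by (auto simp: entry_def w_eq nth_append last_conv_nth)
  next
    assume a: "vs = [n - 1, n - 2]"
    then have l: "n = length us + 3" using lengths by simp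
    then show ?thesis using a by (auto simp: entry_def w_eq nth_append)
  qed
qed

text \<open>If \<open>n\<close> creates no pattern, it can only spoil the second condition, as one
  of two larger values before some \<open>y\<close>. The last value of \<open>w'\<close> must then
  be \<open>n - 2\<close>, since \<open>n - 2\<close> and \<open>n - 1\<close> cannot both precede
  it; this leaves the two endings that occur in \<open>A1\<close>.\<close>

lemma swaps_extension:
  "adjacent_swaps w' \<and> avoids_312 w \<and> \<not> adjacent_swaps w \<longleftrightarrow>
    adjacent_swaps w' \<and> ((vs = [n - 2] \<and> us \<noteq> [] \<and> last us = n - 1) \<or> vs = [n - 1, n - 2])"
proof (rule conj_cong[OF refl])
  assume s: "adjacent_swaps w'"
  have noinv: False if "y < u" "u < v" "before w' u y" "before w' v y" for y u v
    using s that unfolding adjacent_swaps_def by blast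
  have nomid: "avoids_312 w'" using s by (simp add: adjacent_swaps_def avoids_312_def)
  have set_w': "set w' = {1..n - 1}" using perms_w' by (simp add: perms_iff)
  show "avoids_312 w \<and> \<not> adjacent_swaps w \<longleftrightarrow>
     ((vs = [n - 2] \<and> us \<noteq> [] \<and> last us = n - 1) \<or> vs = [n - 1, n - 2])"
  proof
    assume a: "avoids_312 w \<and> \<not> adjacent_swaps w"
    then have dec: "sorted_wrt (>) vs" by (simp add: avoids_w)
    obtain y u v where yuv: "y < u" "u < v" "before w u y" "before w v y"
      using a by (auto simp: adjacent_swaps_def avoids_312_def)
    have "v \<le> n" using before_in_perms[OF w yuv(4)] by simp
    then have uy: "before w' u y" using yuv before_w by auto
    have "v = n"
      using noinv[OF yuv(1,2) uy] yuv(2,4) \<open>v \<le> n\<close> before_w uy before_w'_less by fastforce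
    then have y: "y \<in> set vs" using yuv before_w before_w'_less by auto
    then have "vs \<noteq> []" by auto
    then obtain bs z where vs: "vs = bs @ [z]" by (metis rev_exhaust)
    have zy: "z \<le> y" using dec y by (auto simp: vs sorted_wrt_append)
    have bz: "before w' x z" if "x \<in> {1..n - 1}" "x \<noteq> z" for x
    proof -
      have "x \<in> set w'" using that(1) set_w' by simp
      then show ?thesis using that(2) by (auto simp: w'_eq vs before_append)
    qed
    have "z < n - 1" using zy yuv(1) before_w'_less[OF uy] by linarith
    have z: "z = n - 2"
    proof (rule ccontr)
      assume "z \<noteq> n - 2"
      then have "z < n - 2" "n - 2 < n - 1" using \<open>z < n - 1\<close> by auto
      then show False using noinv[of z "n - 2" "n - 1"] bz[of "n - 2"] bz[of "n - 1"] n by auto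
    qed
    show "(vs = [n - 2] \<and> us \<noteq> [] \<and> last us = n - 1) \<or> vs = [n - 1, n - 2]"
    proof (cases bs rule: rev_exhaust)
      case Nil
      have "n - 1 \<in> set us"
      proof (rule ccontr)
        assume "n - 1 \<notin> set us"
        then have "n - 1 \<in> set vs" using other_part[of "n - 1"] n by simp
        then show False using Nil vs z n by simp
      qed
      \<comment> \<open>Otherwise the last entry \<open>b\<close> of \<open>us\<close> is below
        \<open>n - 2\<close>, and \<open>n - 1\<close>, \<open>b\<close>, \<open>n - 2\<close> form
        a 312 pattern.\<close>
      moreover have "last us = n - 1"
      proof (rule ccontr)
        assume ne: "last us \<noteq> n - 1"
        obtain cs b where us: "us = cs @ [b]" using \<open>n - 1 \<in> set us\<close> by (metis empty_iff list.set(1) rev_exhaust)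
        then have "before w' (n - 1) b" "before w' b z" using \<open>n - 1 \<in> set us\<close> ne
          by (auto simp: w'_eq vs before_append before_Cons)
        moreover have "b < z"
        proof -
          have "b \<noteq> z" using distinct_parts(3) by (auto simp: us vs)
          then show ?thesis using ne in_parts[of b] z by (auto simp: us)
        qed
        ultimately show False using nomid \<open>z < n - 1\<close> by (auto simp: avoids_312_def middle_of_312_def)
      qed
      ultimately show ?thesis using Nil vs z by auto
    next
      case (snoc cs b)
      have b: "z < b" using dec by (auto simp: vs snoc sorted_wrt_append)
      have "b = n - 1" using b z in_parts[of b] by (auto simp: vs snoc)
      moreover have "cs = []"
      proof (rule ccontr)
        assume "cs \<noteq> []"
        then obtain d where "d \<in> set cs" by (metis list.set_sel(1))
        then have "b < d" "d < n" using dec in_parts[of d] by (auto simp: vs snoc sorted_wrt_append)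
        then show False using \<open>b = n - 1\<close> by simp
      qed
      ultimately show ?thesis using vs snoc z by simp
    qed
  next
    assume c: "(vs = [n - 2] \<and> us \<noteq> [] \<and> last us = n - 1) \<or> vs = [n - 1, n - 2]"
    have dec: "sorted_wrt (>) vs" using c n by auto
    have "before w' (n - 1) (n - 2)"
    proof -
      have "n - 1 \<in> set us \<and> n - 2 \<in> set vs \<or> before vs (n - 1) (n - 2)" using c
      proof
        assume "vs = [n - 2] \<and> us \<noteq> [] \<and> last us = n - 1"
        then show ?thesis using last_in_set[of us] by simp
      qed (simp add: before_Cons)
      then show ?thesis by (auto simp: w'_eq before_append)
    qed
    moreover have "n - 2 \<in> set vs" using c by auto
    ultimately have "before w (n - 1) (n - 2)" "before w n (n - 2)" by (auto simp: before_w)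
    moreover have "n - 2 < n - 1" "n - 1 < n" using n by auto
    ultimately have "\<not> adjacent_swaps w" unfolding adjacent_swaps_def by blast
    then show "avoids_312 w \<and> \<not> adjacent_swaps w" using dec nomid by (simp add: avoids_w)
  qed
qed

lemma first_two_stable:
  assumes "2 \<le> length us"
  shows "w ! 0 = w' ! 0 \<and> w ! 1 = w' ! 1"
proof -
  have "0 < length us" "1 < length us" using assms by auto
  then show ?thesis by (simp add: w_eq w'_eq nth_append)
qed

text \<open>A decreasing list is determined by its values, so \<open>us\<close> alone fixes the
  permutation.\<close>

lemma descending_exception_iff:
  "w = [n - 1, n] @ rev [1..<n - 1] \<longleftrightarrow> us = [n - 1] \<and> sorted_wrt (>) vs"
proof
  assume "w = [n - 1, n] @ rev [1..<n - 1]"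
  then have "us @ n # vs = [n - 1] @ n # rev [1..<n - 1]" by (simp add: w_eq)
  moreover have "n \<notin> set [n - 1]" "n \<notin> set (rev [1..<n - 1])" using n by auto
  ultimately have "us = [n - 1] \<and> vs = rev [1..<n - 1]"
    using distinct_parts(4,5) append_Cons_eq_iff[of n us vs "[n - 1]" "rev [1..<n - 1]"] by blast
  then show "us = [n - 1] \<and> sorted_wrt (>) vs" using decreasing_rev_upt by blast
next
  assume a: "us = [n - 1] \<and> sorted_wrt (>) vs"
  have "set vs = set (rev [1..<n - 1])"
  proof -
    have "insert (n - 1) (set vs) = {1..n - 1}" "n - 1 \<notin> set vs" using set_parts distinct_parts(3) a by auto
    then have "set vs = {1..n - 1} - {n - 1}" by blast
    also have "\<dots> = set (rev [1..<n - 1])" by auto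
    finally show ?thesis .
  qed
  then have "vs = rev [1..<n - 1]" using a decreasing_unique decreasing_rev_upt by blast
  then show "w = [n - 1, n] @ rev [1..<n - 1]" using a by (simp add: w_eq)
qed

lemma block_exception_iff:
  assumes l: "1 \<le> l" "l \<le> n - 2"
  shows "w = [n, l] @ rev [l + 1..<n] @ rev [1..<l] \<longleftrightarrow> us = [] \<and> (\<exists>ts. vs = l # ts \<and> sorted_wrt (>) ts)"
proof -
  let ?ts = "rev [l + 1..<n] @ rev [1..<l]"
  have ts: "sorted_wrt (>) ?ts" by (auto simp: sorted_wrt_append sorted_wrt_rev)
  show ?thesis
  proof
    assume "w = [n, l] @ ?ts"
    then have "us @ n # vs = [] @ n # l # ?ts" by (simp add: w_eq)
    moreover have "n \<notin> set []" "n \<notin> set (l # ?ts)" using l n by auto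
    ultimately have "us = [] \<and> vs = l # ?ts"
      using distinct_parts(4,5) append_Cons_eq_iff[of n us vs "[]" "l # ?ts"] by blast
    then show "us = [] \<and> (\<exists>ts. vs = l # ts \<and> sorted_wrt (>) ts)" using ts by blast
  next
    assume "us = [] \<and> (\<exists>ts. vs = l # ts \<and> sorted_wrt (>) ts)"
    then obtain ts' where a: "us = []" "vs = l # ts'" "sorted_wrt (>) ts'" by blast
    have "set ts' = set ?ts"
    proof -
      have "insert l (set ts') = {1..n - 1}" "l \<notin> set ts'" using set_parts distinct_parts(2) a by auto
      then have "set ts' = {1..n - 1} - {l}" by blast
      also have "\<dots> = set ?ts" using l by auto
      finally show ?thesis .
    qed
    then have "ts' = ?ts" using a(3) decreasing_unique ts by blast
    then show "w = [n, l] @ ?ts" using a by (simp add: w_eq)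
  qed
qed

lemma swaps_persist: "\<not> adjacent_swaps w' \<Longrightarrow> \<not> adjacent_swaps w"
  using adjacent_swaps_mono by blast

lemma avoids_iff_large_adjacent: "avoids_312 w' \<Longrightarrow> avoids_312 w \<longleftrightarrow> large_adjacent"
  using avoids_w desc_if_avoids large_adjacent_if_decreasing decreasing_if_large_adjacent by blast

text \<open>The split is whether \<open>w'\<close> is already a product of adjacent transpositions.
  If it is not, neither is \<open>w\<close>, and avoidance is decided by the place of
  \<open>n - 1\<close>.\<close>

lemma recursion_diagonal:
  "avoids_312 w \<and> \<not> adjacent_swaps w \<longleftrightarrow>
    (adjacent_swaps w' \<and> avoids_312 w \<and> \<not> adjacent_swaps w) \<or>
    (avoids_312 w' \<and> \<not> adjacent_swaps w' \<and> w' \<in> desc_perms (n - 1) \<and> large_adjacent)"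
  using avoids_iff_large_adjacent avoids_w swaps_persist desc_if_avoids by blast

text \<open>At most two values follow \<open>n\<close> in either ending, so \<open>n\<close> can be
  among the first two positions only if \<open>n = 4\<close>; then 1 comes first.\<close>

lemma swaps_extension_second:
  assumes "adjacent_swaps w'" "avoids_312 w" "\<not> adjacent_swaps w"
  shows "w ! 0 = 1 \<or> 2 \<le> length us"
proof (rule disjCI)
  assume "\<not> 2 \<le> length us"
  have "(vs = [n - 2] \<and> us \<noteq> [] \<and> last us = n - 1) \<or> vs = [n - 1, n - 2]"
    using assms swaps_extension by blast
  moreover have "2 \<le> length vs" using lengths n \<open>\<not> 2 \<le> length us\<close> by simp
  ultimately have vs': "vs = [n - 1, n - 2]" by auto
  then have "length vs = 2" by simp
  then have vs: "vs = [n - 1, n - 2]" "length us = 1" "n = 4"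
    using lengths n \<open>\<not> 2 \<le> length us\<close> vs' by linarith+
  then obtain a where a: "us = [a]" by (auto simp: length_Suc_conv)
  have "1 \<in> set us" using other_part[of 1] vs by auto
  then show "w ! 0 = 1" by (simp add: w_eq a)
qed

text \<open>The forbidden shape, maximum second after a first value other than 1, is compared for
  \<open>w\<close> and \<open>w'\<close> in \<open>new\<close>. With nothing before \<open>n\<close>
  neither has it. With one value they agree, except at the excluded permutation. With two or more
  \<open>w\<close> never has it, and a \<open>w'\<close> of this shape falls under the last
  term.\<close>

lemma recursion_pred:
  "(avoids_312 w \<and> \<not> (w ! 0 \<noteq> 1 \<and> w ! 1 = n)) \<and> \<not> adjacent_swaps w \<longleftrightarrow>
    (adjacent_swaps w' \<and> avoids_312 w \<and> \<not> adjacent_swaps w) \<or>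
    ((avoids_312 w' \<and> \<not> adjacent_swaps w' \<and> w' \<in> desc_perms (n - 1) \<and> large_adjacent \<and> w \<noteq> [n - 1, n] @ rev [1..<n - 1])
       \<and> \<not> (w' ! 0 \<noteq> 1 \<and> w' ! 1 = n - 1)) \<or>
    (avoids_312 w' \<and> \<not> adjacent_swaps w' \<and> (w' ! 0 \<noteq> 1 \<and> w' ! 1 = n - 1) \<and> n - 1 \<in> set us)"
proof -
  have n_at: "w ! 1 = n \<longleftrightarrow> length us = 1"
  proof
    assume "w ! 1 = n"
    moreover have "w ! length us = n" by (simp add: w_eq)
    ultimately show "length us = 1"
      using w lengths perms_length[OF w] n nth_eq_iff_index_eq[of w 1 "length us"] by (simp add: perms_iff)
  next
    assume "length us = 1"
    then show "w ! 1 = n" by (simp add: w_eq nth_append)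
  qed
  have old: "\<not> (w ! 0 \<noteq> 1 \<and> w ! 1 = n)" if "adjacent_swaps w' \<and> avoids_312 w \<and> \<not> adjacent_swaps w"
    using swaps_extension_second that n_at by auto
  have new: "\<not> (w ! 0 \<noteq> 1 \<and> w ! 1 = n) \<longleftrightarrow>
      (w \<noteq> [n - 1, n] @ rev [1..<n - 1] \<and> \<not> (w' ! 0 \<noteq> 1 \<and> w' ! 1 = n - 1)) \<or>
      ((w' ! 0 \<noteq> 1 \<and> w' ! 1 = n - 1) \<and> n - 1 \<in> set us)" if "avoids_312 w'" "avoids_312 w"
  proof -
    have dec: "sorted_wrt (>) vs" using that avoids_w by blast
    have adj: "n - 1 \<in> set us \<or> (vs \<noteq> [] \<and> hd vs = n - 1)"
      using large_adjacent_if_decreasing[OF dec] by (simp only: large_adjacent_def)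
    consider (zero) "us = []" | (one) a where "us = [a]" | (two) "2 \<le> length us"
      by (metis One_nat_def length_0_conv length_Suc_conv less_2_cases not_le)
    then show ?thesis
    proof cases
      case zero
      then obtain bs where "vs = (n - 1) # bs" using adj by (cases vs) auto
      moreover have "n - 1 \<notin> set bs" using \<open>vs = _\<close> distinct_parts(2) by simp
      moreover have "length bs \<noteq> 0" using lengths zero \<open>vs = _\<close> n by auto
      ultimately have "w' ! 1 \<noteq> n - 1" using zero by (cases bs) (auto simp: w'_eq)
      then show ?thesis using zero n_at descending_exception_iff by simp
    next
      case (one a)
      have w0: "w ! 0 = a" "w' ! 0 = a" "w ! 1 = n" by (simp_all add: w_eq w'_eq one)
      show ?thesis
      proof (cases "a = n - 1")
        case True
        have "vs \<noteq> []" using lengths one n by auto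
        then have "w' ! 1 = hd vs" "hd vs \<in> set vs" by (simp_all add: w'_eq one hd_conv_nth)
        then have "w' ! 1 \<noteq> n - 1" using distinct_parts(3) one True by auto
        then show ?thesis using True one dec w0 n descending_exception_iff by auto
      next
        case False
        then have h: "vs \<noteq> []" "hd vs = n - 1" using adj one by auto
        then have "w' ! 1 = n - 1" by (simp add: w'_eq one hd_conv_nth)
        moreover have "n - 1 \<notin> set us" using False one by simp
        moreover have "w \<noteq> [n - 1, n] @ rev [1..<n - 1]" using descending_exception_iff one False by simp
        ultimately show ?thesis using w0 by simp
      qed
    next
      case two
      have "w' ! 1 \<in> set us" using two by (simp add: w'_eq nth_append)
      moreover have "w \<noteq> [n - 1, n] @ rev [1..<n - 1]" using descending_exception_iff two by auto
      ultimately show ?thesis using n_at two by auto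
    qed
  qed
  show ?thesis
    using old new recursion_diagonal avoids_w avoids_iff_large_adjacent desc_if_avoids swaps_persist
    by (smt (verit) large_adjacent_def)
qed

text \<open>An ascent after \<open>n - 1\<close> is a 312 pattern whose 1 must be the second value,
  so \<open>n - 1\<close> is first.\<close>

lemma not_descending:
  assumes "\<And>y. middle_of_312 w' y \<Longrightarrow> y = w' ! 1" "w' \<notin> desc_perms (n - 1)"
  shows "w' ! 0 = n - 1"
proof -
  obtain u v where uv: "before w' (n - 1) u" "before w' u v" "\<not> v < u"
    using assms(2) unfolding desc_iff by blast
  have d: "distinct w'" using perms_w' by (simp add: perms_iff)
  then have "u \<noteq> v" "n - 1 \<noteq> v" using uv by (auto simp: before_def nth_eq_iff_index_eq)
  then have "u < v" "v < n - 1" using uv before_w'_less[of u v] by auto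
  then have "u = w' ! 1" using assms(1)[of u] uv by (auto simp: middle_of_312_def)
  then have "before w' (n - 1) (w' ! 1)" using uv by simp
  then have "n - 1 \<in> prefix_set w' 1" using before_nth_right[OF perms_w', of 1] n by simp
  then show ?thesis using perms_first_two(1)[OF perms_w'] n by simp
qed

lemma two_apart_iff:
  assumes "w' ! 0 = n - 1"
  shows "pos w (n - 1) + 2 \<le> pos w n \<longleftrightarrow> 2 \<le> length us"
proof (cases us)
  case Nil
  then have "length vs + 1 = n" using lengths by simp
  then have "0 < length vs" using n by linarith
  then show ?thesis using pos_vs[of 0] assms pos_max Nil by (simp add: w'_eq)
next
  case (Cons a as)
  then show ?thesis using pos_us[of 0] assms pos_max by (simp add: w'_eq)
qed

text \<open>The value \<open>n - 1\<close>, standing before \<open>n\<close>, takes over the role of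
  3.\<close>

lemma middle_extension:
  assumes "middle_of_312 w y" "n - 1 \<in> set us"
  shows "middle_of_312 w' y"
proof (cases "\<exists>c. y < c \<and> before vs y c")
  case True
  then obtain c where c: "y < c" "before vs y c" by blast
  then have "y \<in> set vs" "c \<in> set vs" using before_set by auto
  then have "before w' (n - 1) y" "before w' y c" "c < n" "c \<noteq> n - 1"
    using assms(2) c in_parts[of c] distinct_parts(3) by (auto simp: w'_eq before_append)
  then show ?thesis using c unfolding middle_of_312_def by (intro exI[of _ "n - 1"] exI[of _ c]) auto
qed (use assms(1) middle_w in blast)

lemma middle_notin: "middle_of_312 w y \<Longrightarrow> y \<noteq> n"
  using before_in_perms[OF w] unfolding middle_of_312_def by fastforce

text \<open>The number of values before \<open>n\<close> decides. With none, only
  \<open>n - 1\<close> or \<open>l\<close> may follow \<open>n\<close>; with one, \<open>n\<close>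
  is second and the first value must be 1; with two or more, \<open>w\<close> and \<open>w'\<close>
  share their first two values.\<close>

lemma recursion_block:
  assumes l: "1 \<le> l" "l \<le> n - 2"
  shows "block_compatible l w \<and> \<not> adjacent_swaps w \<longleftrightarrow>
    (adjacent_swaps w' \<and> avoids_312 w \<and> \<not> adjacent_swaps w) \<or>
    (block_compatible l w' \<and> \<not> adjacent_swaps w' \<and> w' \<in> desc_perms (n - 1) \<and> large_adjacent
       \<and> w \<noteq> [n - 1, n] @ rev [1..<n - 1]) \<or>
    (block_compatible l w' \<and> \<not> adjacent_swaps w' \<and> w' \<notin> desc_perms (n - 1) \<and> pos w (n - 1) + 2 \<le> pos w n) \<or>
    w = [n, l] @ rev [l + 1..<n] @ rev [1..<l]" (is "?L \<longleftrightarrow> ?R1 \<or> ?R2 \<or> ?R3 \<or> ?R4")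
proof
  assume L: ?L
  have comp: "\<And>y. middle_of_312 w y \<Longrightarrow> y = w ! 1"
    and H: "w ! 0 = 1 \<or> w ! 0 = w ! 1 + 1 \<or> (w ! 0 < w ! 1 \<and> w ! 1 \<le> l) \<or> w ! 1 = l"
    using L by (auto simp: block_compatible_def)
  consider (zero) "us = []" | (one) a where "us = [a]" | (two) "2 \<le> length us"
    by (metis One_nat_def length_0_conv length_Suc_conv less_2_cases not_le)
  then show "?R1 \<or> ?R2 \<or> ?R3 \<or> ?R4"
  proof cases
    case zero
    obtain b bs where vs: "vs = b # bs" using lengths zero n by (cases vs) auto
    have w01: "w ! 0 = n" "w ! 1 = b" "w' = b # bs" by (simp_all add: w_eq w'_eq zero vs)
    \<comment> \<open>Only the second value \<open>b\<close> may be a middle, so no ascent starts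
      inside \<open>bs\<close>.\<close>
    have bs: "sorted_wrt (>) bs"
    proof -
      have "\<not> y < c" if y: "before bs y c" for y c
      proof
        assume "y < c"
        moreover have "before vs y c" using y by (simp add: vs before_Cons)
        ultimately have "y = b" using comp[of y] middle_w w01 by auto
        then show False using before_set[OF y] distinct_parts(2) by (simp add: vs)
      qed
      moreover have "c \<noteq> y" if "before bs y c" for y c
        using that distinct_parts(2) by (auto simp: vs before_def nth_eq_iff_index_eq)
      ultimately show ?thesis unfolding sorted_wrt_greater_before by (meson linorder_neqE_nat)
    qed
    have "b < n" using in_parts[of b] by (simp add: vs)
    then consider "b = n - 1" | "b = l" using H w01 n by auto
    then show ?thesis
    proof cases
      case 1
      have dec: "sorted_wrt (>) vs"
      proof -
        have "x < b" if "x \<in> set bs" for x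
        proof -
          have "x < n" "x \<noteq> b" using that in_parts[of x] distinct_parts(2) by (auto simp: vs)
          then show ?thesis using 1 by simp
        qed
        then show ?thesis using bs by (simp add: vs)
      qed
      have "w' = rev [1..<n]"
      proof -
        have "set w' = {1..n - 1}" using perms_w' unfolding perms_iff by blast
        also have "\<dots> = set (rev [1..<n])" using n by auto
        finally have "set w' = set (rev [1..<n])" .
        moreover have "sorted_wrt (>) w'" using dec by (simp add: w'_eq zero)
        ultimately show ?thesis using decreasing_unique decreasing_rev_upt by blast
      qed
      then have w'n: "w' ! 0 = n - 1" "w' ! 1 = n - 2" "w' ! 2 = n - 3"
        using n by (simp_all add: rev_nth)
      have av: "avoids_312 w'"
        using dec unfolding avoids_312_def middle_of_312_def sorted_wrt_greater_before w'_eq zero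
        by (metis append_Nil order.asym)
      \<comment> \<open>As \<open>n \<ge> 4\<close>, the decreasing \<open>w'\<close> has a third
        value, preceded by two larger ones.\<close>
      have "before w' (n - 2) (n - 3)" "before w' (n - 1) (n - 3)"
        using before_nth[OF perms_w', of 1 2] before_nth[OF perms_w', of 0 2] n unfolding w'n by auto
      moreover have "n - 3 < n - 2" "n - 2 < n - 1" using n by auto
      ultimately have "\<not> adjacent_swaps w'" unfolding adjacent_swaps_def by blast
      moreover have "block_compatible l w'" using av w'n n by (auto simp: block_compatible_def avoids_312_def)
      moreover have "w \<noteq> [n - 1, n] @ rev [1..<n - 1]" using descending_exception_iff zero by simp
      ultimately show ?thesis using desc_if_avoids[OF av] large_adjacent_if_decreasing[OF dec] by blast
    next
      case 2
      then show ?thesis using block_exception_iff[OF l] zero vs bs by blast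
    qed
  next
    case (one a)
    have w01: "w ! 0 = a" "w ! 1 = n" "w' ! 0 = a" by (simp_all add: w_eq w'_eq one)
    \<comment> \<open>The second value \<open>n\<close> exceeds \<open>l\<close> and every other
      value, so only the first alternative is left.\<close>
    have a1: "a = 1" using H w01 l n in_parts[of a] one by auto
    have av: "avoids_312 w" using comp middle_notin w01 by (auto simp: avoids_312_def)
    show ?thesis
    proof (cases "adjacent_swaps w'")
      case False
      have "avoids_312 w'" "sorted_wrt (>) vs" using av avoids_w by auto
      moreover have "w \<noteq> [n - 1, n] @ rev [1..<n - 1]" using descending_exception_iff one a1 n by auto
      moreover have "block_compatible l w'"
        using \<open>avoids_312 w'\<close> w01 a1 by (simp add: block_compatible_def avoids_312_def)
      ultimately show ?thesis using False desc_if_avoids large_adjacent_if_decreasing by blast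
    qed (use av L in blast)
  next
    case two
    note same = first_two_stable[OF two]
    have w1: "w ! 1 \<in> set us" using same two by (simp add: w'_eq nth_append)
    have dec: "sorted_wrt (>) vs"
    proof (rule decreasing_if)
      fix y c assume b: "before vs y c"
      show "\<not> y < c"
      proof
        assume "y < c"
        then have "y = w ! 1" using comp middle_w b by blast
        then show False using w1 before_set[OF b] distinct_parts(3) by auto
      qed
    qed
    show ?thesis
    proof (cases "adjacent_swaps w'")
      case True
      then have "avoids_312 w" using dec avoids_w by (simp add: adjacent_swaps_def avoids_312_def)
      then show ?thesis using True L by blast
    next
      case False
      have c': "block_compatible l w'" using comp H same middle_mono by (auto simp: block_compatible_def)
      have ne: "w \<noteq> [n - 1, n] @ rev [1..<n - 1]" using descending_exception_iff two by auto
      show ?thesis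
      proof (cases "w' \<in> desc_perms (n - 1)")
        case True
        then show ?thesis using c' False ne large_adjacent_if_decreasing[OF dec] by blast
      next
        case nd: False
        then have "w' ! 0 = n - 1" using c' by (intro not_descending) (auto simp: block_compatible_def)
        then show ?thesis using c' False nd two_apart_iff two by blast
      qed
    qed
  qed
next
  assume "?R1 \<or> ?R2 \<or> ?R3 \<or> ?R4"
  then consider (R1) ?R1 | (R2) ?R2 | (R3) ?R3 | (R4) ?R4 by blast
  then show ?L
  proof cases
    case R1
    have "w ! 0 = 1 \<or> w ! 0 = w ! 1 + 1 \<or> (w ! 0 < w ! 1 \<and> w ! 1 \<le> l) \<or> w ! 1 = l"
    proof (cases "2 \<le> length us")
      case True
      have "block_compatible l w'" using adjacent_swaps_compatible[OF perms_w'] R1 n by simp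
      then show ?thesis using first_two_stable[OF True] by (simp add: block_compatible_def)
    qed (use swaps_extension_second R1 in blast)
    then show ?thesis using R1 by (simp add: block_compatible_def avoids_312_def)
  next
    case R2
    have dec: "sorted_wrt (>) vs" using R2 decreasing_if_large_adjacent by blast
    have comp: "\<And>y. middle_of_312 w y \<Longrightarrow> y = w' ! 1"
      and H: "w' ! 0 = 1 \<or> w' ! 0 = w' ! 1 + 1 \<or> (w' ! 0 < w' ! 1 \<and> w' ! 1 \<le> l) \<or> w' ! 1 = l"
      using R2 middle_eq[OF dec] by (auto simp: block_compatible_def)
    have adj: "n - 1 \<in> set us \<or> (vs \<noteq> [] \<and> hd vs = n - 1)" using R2 by (simp only: large_adjacent_def)
    have max': "y \<noteq> n - 1" if mid: "middle_of_312 w y" for y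
    proof -
      have "middle_of_312 w' y" using middle_eq[OF dec] mid by blast
      then obtain x c where "y < c" "c < x" "before w' x y" unfolding middle_of_312_def by auto
      then show ?thesis using before_w'_less[of x y] by linarith
    qed
    consider (zero) "us = []" | (one) a where "us = [a]" | (two) "2 \<le> length us"
      by (metis One_nat_def length_0_conv length_Suc_conv less_2_cases not_le)
    then have "block_compatible l w"
    proof cases
      case zero
      then have "w ! 0 = n" "w ! 1 = n - 1" using adj by (auto simp: w_eq hd_conv_nth)
      moreover have "\<not> middle_of_312 w' y" for y
        using dec unfolding middle_of_312_def sorted_wrt_greater_before w'_eq zero
        by (metis append_Nil order.asym)
      ultimately show ?thesis using middle_eq[OF dec] n by (auto simp: block_compatible_def)
    next
      case (one a)
      have "a \<noteq> n - 1" using descending_exception_iff R2 dec one by auto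
      then have h: "vs \<noteq> []" "hd vs = n - 1" using adj one by auto
      then have w'01: "w' ! 0 = a" "w' ! 1 = n - 1" by (simp_all add: w'_eq one hd_conv_nth)
      have "a < n" using in_parts[of a] one by simp
      \<comment> \<open>The second value \<open>n - 1\<close> of \<open>w'\<close> exceeds
        \<open>l\<close>; with \<open>a < n\<close> only the first alternative remains.\<close>
      then have "a = 1" using H w'01 l n by auto
      moreover have "\<not> middle_of_312 w y" for y using comp[of y] max'[of y] w'01 by auto
      ultimately show ?thesis by (simp add: block_compatible_def w_eq one)
    next
      case two
      then show ?thesis using comp H first_two_stable[OF two] by (simp add: block_compatible_def)
    qed
    then show ?thesis using R2 swaps_persist by blast
  next
    case R3
    then have first: "w' ! 0 = n - 1" by (intro not_descending) (auto simp: block_compatible_def)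
    then have two: "2 \<le> length us" using two_apart_iff R3 by blast
    have "0 < length us" using two by linarith
    then have "n - 1 \<in> set us" using first by (metis nth_append nth_mem w'_eq)
    then have "block_compatible l w"
      using R3 middle_extension first_two_stable[OF two] by (simp add: block_compatible_def)
    then show ?thesis using R3 swaps_persist by blast
  next
    case R4
    then obtain ts where ts: "us = []" "vs = l # ts" "sorted_wrt (>) ts" using block_exception_iff[OF l] by blast
    have w01: "w ! 0 = n" "w ! 1 = l" by (simp_all add: w_eq ts)
    \<comment> \<open>A pattern yields an ascent in \<open>vs\<close>, and as \<open>ts\<close>
      decreases, the ascent starts at \<open>l\<close>.\<close>
    have "y = l" if mid: "middle_of_312 w y" for y
    proof -
      have "w' = vs" by (simp add: w'_eq ts(1))
      then obtain c where "y < c" "before vs y c"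
        using mid middle_w[of y] unfolding middle_of_312_def[of w'] by metis
      then show ?thesis using ts(3) unfolding ts(2) before_Cons sorted_wrt_greater_before by (meson order.asym)
    qed
    then have "block_compatible l w" using w01 by (simp add: block_compatible_def)
    moreover have "middle_of_312 w (w ! 1)" using middle_of_312_second[OF w] w01 l n by simp
    ultimately show ?thesis by (auto simp: adjacent_swaps_def)
  qed
qed

section \<open>The recursions as statements about membership\<close>

lemma T_set_mem: "1 \<le> l \<Longrightarrow> w \<in> T_set (K :: 'k::field itself) n l \<longleftrightarrow> block_compatible l w \<and> \<not> adjacent_swaps w"
  using T_set_iff[OF w, of l K] n by simp

lemma T_under_mem:
  "1 \<le> l \<Longrightarrow> w \<in> T_under (K :: 'k::field itself) n l \<longleftrightarrow> block_compatible l w' \<and> \<not> adjacent_swaps w'"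
  using T_set_iff[OF perms_w', of l K] n w by (simp add: T_under_def delete_max)

lemma A1_mem:
  "w \<in> A1 (K :: 'k::field itself) n \<longleftrightarrow> adjacent_swaps w' \<and> avoids_312 w \<and> \<not> adjacent_swaps w"
  using Z_set_iff[OF perms_w', of K] n w unfolding swaps_extension A1_iff[symmetric]
  by (simp add: A1_def Z_under_def delete_max)

lemma A2_mem: "1 \<le> l \<Longrightarrow> w \<in> A2 (K :: 'k::field itself) n l \<longleftrightarrow>
    block_compatible l w' \<and> \<not> adjacent_swaps w' \<and> w' \<in> desc_perms (n - 1) \<and> large_adjacent"
  using T_under_mem[of l K] w large_adjacent_iff by (simp add: A2_def delete_max)

lemma A3_mem: "1 \<le> l \<Longrightarrow> w \<in> A3 (K :: 'k::field itself) n l \<longleftrightarrow>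
    block_compatible l w' \<and> \<not> adjacent_swaps w' \<and> w' \<notin> desc_perms (n - 1) \<and> pos w (n - 1) + 2 \<le> pos w n"
  using T_under_mem[of l K] w perms_w' by (simp add: A3_def delete_max)

lemma T_set_diagonal_recursion: "w \<in> T_set (K :: 'k::field itself) n n \<longleftrightarrow> w \<in> A1 K n \<union> A2 K n n"
  using recursion_diagonal n block_compatible_diagonal[OF w, of n] block_compatible_diagonal[OF perms_w', of n]
  by (simp add: T_set_mem A1_mem A2_mem)

text \<open>For \<open>w'\<close>, of length \<open>n - 1\<close>, the index \<open>n - 1\<close> is
  the diagonal case and \<open>n - 2\<close> the case just below it, so both tilde sets become
  conditions on avoidance and the forbidden shape.\<close>

lemma T_set_pred_recursion:
  "w \<in> T_set (K :: 'k::field itself) n (n - 1) \<longleftrightarrow> w \<in> A1 K n \<union> A1_tilde K n \<union> A2_tilde K n"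
proof -
  have l: "1 \<le> n - 1" "1 \<le> n - 2" using n by auto
  have c: "block_compatible (n - 1) w \<longleftrightarrow> avoids_312 w \<and> \<not> (w ! 0 \<noteq> 1 \<and> w ! 1 = n)"
    "block_compatible (n - 1) w' \<longleftrightarrow> avoids_312 w'"
    using block_compatible_pred[OF w] block_compatible_diagonal[OF perms_w', of "n - 1"] n by auto
  have c2: "block_compatible (n - 2) w' \<longleftrightarrow> avoids_312 w' \<and> \<not> (w' ! 0 \<noteq> 1 \<and> w' ! 1 = n - 1)"
    using block_compatible_pred[OF perms_w'] n by (simp add: numeral_2_eq_2)
  have "w \<in> A1_tilde K n \<longleftrightarrow>
    ((avoids_312 w' \<and> \<not> adjacent_swaps w' \<and> w' \<in> desc_perms (n - 1) \<and> large_adjacent \<and> w \<noteq> [n - 1, n] @ rev [1..<n - 1])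
       \<and> \<not> (w' ! 0 \<noteq> 1 \<and> w' ! 1 = n - 1))"
    unfolding A1_tilde_def A2'_def Int_iff Diff_iff A2_mem[OF l(1)] T_under_mem[OF l(2)] c c2 by blast
  moreover have "w \<in> A2_tilde K n \<longleftrightarrow>
    (avoids_312 w' \<and> \<not> adjacent_swaps w' \<and> (w' ! 0 \<noteq> 1 \<and> w' ! 1 = n - 1) \<and> n - 1 \<in> set us)"
    unfolding A2_tilde_def Int_iff Diff_iff T_under_mem[OF l(1)] T_under_mem[OF l(2)] c c2 mem_Collect_eq late_iff
    using w by blast
  ultimately show ?thesis
    unfolding T_set_mem[OF l(1)] c Un_iff A1_mem using recursion_pred by blast
qed

lemma T_set_block_recursion:
  assumes l: "1 \<le> l" "l \<le> n - 2"
  shows "w \<in> T_set (K :: 'k::field itself) n l \<longleftrightarrow> w \<in> A1 K n \<union> A2' K n l \<union> A3 K n l \<union>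
         {[n, l] @ rev [l + 1..<n] @ rev [1..<l]}"
  unfolding T_set_mem[OF l(1)] recursion_block[OF l] A2'_def Un_iff Diff_iff A1_mem A2_mem[OF l(1)] A3_mem[OF l(1)]
  by blast

end

lemma perms_split_max:
  assumes "w \<in> perms n" "1 \<le> n"
  obtains us vs where "w = us @ n # vs"
  using assms split_list[of n w] by (auto simp: perms_iff)

lemma block_exception_perms:
  assumes "1 \<le> l" "l \<le> n - 2"
  shows "[n, l] @ rev [l + 1..<n] @ rev [1..<l] \<in> perms n"
  unfolding perms_iff using assms by auto

lemma T_set_subset: "T_set K m l \<subseteq> perms m"
  by (auto simp: T_set_def)

theorem theoremC:
  fixes K :: "'k::field_char_0 itself" and n :: nat
  assumes "n \<ge> 4"
  shows "T_set K n n = A1 K n \<union> A2 K n n \<and>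
    T_set K n (n - 1) = A1 K n \<union> A1_tilde K n \<union> A2_tilde K n \<and>
    (\<forall>l. 1 \<le> l \<and> l \<le> n - 2 \<longrightarrow>
       T_set K n l = A1 K n \<union> A2' K n l \<union> A3 K n l \<union>
         {[n, l] @ rev [l + 1..<n] @ rev [1..<l]})"
proof -
  \<comment> \<open>All sets consist of permutations, and each permutation splits at its value
    \<open>n\<close>; this reduces every equality to the form of the recursions.\<close>
  have eq: "S = T" if "S \<subseteq> perms n" "T \<subseteq> perms n"
    "\<And>us vs. us @ n # vs \<in> perms n \<Longrightarrow> us @ n # vs \<in> S \<longleftrightarrow> us @ n # vs \<in> T" for S T
  proof (rule set_eqI)
    fix w show "w \<in> S \<longleftrightarrow> w \<in> T"
    proof (cases "w \<in> perms n")
      case True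
      moreover have "1 \<le> n" using assms by simp
      ultimately obtain us vs where "w = us @ n # vs" by (rule perms_split_max)
      then show ?thesis using that(3)[of us vs] True by simp
    qed (use that in blast)
  qed
  have sub: "A1 K n \<subseteq> perms n" "A2 K n l \<subseteq> perms n" "A3 K n l \<subseteq> perms n"
    "A2' K n l \<subseteq> perms n" "A1_tilde K n \<subseteq> perms n" "A2_tilde K n \<subseteq> perms n" for l
    by (auto simp: A1_def A2_def A3_def A2'_def A1_tilde_def A2_tilde_def)
  have "T_set K n n = A1 K n \<union> A2 K n n"
    by (rule eq[OF T_set_subset _ T_set_diagonal_recursion[OF _ assms refl refl]]) (use sub in blast)+
  moreover have "T_set K n (n - 1) = A1 K n \<union> A1_tilde K n \<union> A2_tilde K n"
    by (rule eq[OF T_set_subset _ T_set_pred_recursion[OF _ assms refl refl]]) (use sub in blast)+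
  moreover have "T_set K n l = A1 K n \<union> A2' K n l \<union> A3 K n l \<union> {[n, l] @ rev [l + 1..<n] @ rev [1..<l]}"
    if l: "1 \<le> l" "l \<le> n - 2" for l
  proof (rule eq)
    show "A1 K n \<union> A2' K n l \<union> A3 K n l \<union> {[n, l] @ rev [l + 1..<n] @ rev [1..<l]} \<subseteq> perms n"
      using sub block_exception_perms[OF l] by blast
  qed (rule T_set_subset, rule T_set_block_recursion[OF _ assms refl refl l])
  ultimately show ?thesis by blast
qed

end
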